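(* Let $r,c\in\mathbb{N}$ with $r\le c$ and let $\lambda=\min(r,c)$ be the security parameter. Let $\varphi:\{0,1\}^{r+c}\to\{0,1\}^{r+c}$ be a uniformly random permutation. Let $\mathsf{C}$ be the one-round sponge construction with $$\mathsf{C}^{\mathrm{priv}}_\lambda=\mathsf{Sp}^\varphi\qquad\text{and}\qquad \mathsf{C}^{\mathrm{pub}}_\lambda=(\varphi,\varphi^{-1}),$$ and let $\mathsf{R}$ be the random oracle construction in which the interfaces $\mathsf{R}^{\mathrm{priv}}=\mathsf{R}^{\mathrm{pub}}$ are an oracle for a uniformly random function $f:\{0,1\}^r\to\{0,1\}^r$. Then, both in the classical setting and in the quantum setting, $\mathsf{C}$ is strongly $\epsilon$-perfect reset indifferentiable, with shared randomness, from $\mathsf{R}$, where $\epsilon=O(2^{-r/2})$.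
   Context: One-round sponge: for a permutation $\varphi$ of $\{0,1\}^{r+c}$, $\mathsf{Sp}^\varphi:\{0,1\}^r\to\{0,1\}^r$ maps $x$ to the first $r$ bits of $\varphi(x\Vert 0^c)$. Strong $\epsilon$-perfect reset indifferentiability with shared randomness of $\mathsf{C}$ from $\mathsf{R}$: there exists an efficient simulator $\mathcal{S}$, not depending on the distinguisher ("strong"), such that for every computation- and query-unbounded distinguisher $\mathcal{D}$ with one output bit ("$\epsilon$-perfect"), $$\Big|\Pr\big[\mathcal{D}[\mathsf{C}^{\mathrm{priv}}_\lambda,\mathsf{C}^{\mathrm{pub}}_\lambda]=1\big]-\Pr\big[\mathcal{D}[\mathsf{R}^{\mathrm{priv}}_\lambda,\mathcal{S}[\mathsf{R}^{\mathrm{pub}}_\lambda,\mathsf{SR}]]=1\big]\Big|\le\epsilon .$$ Here $\mathcal{S}$ has oracle access to $\mathsf{R}^{\mathrm{pub}}$ and answers $\mathcal{D}$'s queries to the public interface (both $\varphi$- and $\varphi^{-1}$-queries). $\mathcal{S}$ is stateless ("reset"): it keeps no state between queries, except that on every query it has access to the same string $\mathsf{SR}\in\{0,1\}^*$ of random coins, of arbitrary length, not revealed to $\mathcal{D}$ ("shared randomness"). Classical setting: all algorithms and queries are classical. Quantum setting: $\mathcal{D}$ and $\mathcal{S}$ are quantum algorithms that may make quantum queries; a quantum query to a function $F$ applies the unitary $|x\rangle|y\rangle\mapsto|x\rangle|y\oplus F(x)\rangle$. *)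

theory Defs
  imports
    "HOL-Probability.Probability"
    "HOL-Combinatorics.Permutations"
    "HOL-Computational_Algebra.Polynomial"
    "HOL-Library.Landau_Symbols"
begin

section \<open>Bit strings and constructions\<close>

type_synonym bits = "bool list"
type_synonym func = "bits \<Rightarrow> bits"

definition bitstrings :: "nat \<Rightarrow> bits set" where
  "bitstrings k = {x. length x = k}"

definition slice :: "nat \<Rightarrow> nat \<Rightarrow> bits \<Rightarrow> bits" where
  "slice i k b = take k (drop i b)"

text \<open>XOR the string \<open>v\<close> into the wires \<open>t, \<dots>, t + length v - 1\<close> of \<open>b\<close>.\<close>

definition xor_into :: "nat \<Rightarrow> bits \<Rightarrow> bits \<Rightarrow> bits" where
  "xor_into t v b =
     map (\<lambda>i. if t \<le> i \<and> i < t + length v then b ! i \<noteq> v ! (i - t) else b ! i) [0..<length b]"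

definition Sp :: "nat \<Rightarrow> nat \<Rightarrow> func \<Rightarrow> func" where
  "Sp r c \<phi> x = take r (\<phi> (x @ replicate c False))"

text \<open>
  A construction whose public interface is a permutation and its inverse is a joint distribution
  of the triple (private interface, forward public interface, backward public interface); an ideal
  construction is a joint distribution of the pair (private interface, public interface). Both
  are indexed by \<open>r\<close> and \<open>c\<close>.
\<close>

type_synonym construction = "nat \<Rightarrow> nat \<Rightarrow> (func \<times> func \<times> func) pmf"
type_synonym ideal = "nat \<Rightarrow> nat \<Rightarrow> (func \<times> func) pmf"

definition sponge :: construction where
  "sponge r c =
     map_pmf (\<lambda>\<phi>. (Sp r c \<phi>, \<phi>, inv \<phi>)) (pmf_of_set {\<phi>. \<phi> permutes bitstrings (r + c)})"

definition random_oracle :: ideal where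
  "random_oracle r c =
     map_pmf (\<lambda>f. (f, f)) (pmf_of_set (bitstrings r \<rightarrow>\<^sub>E bitstrings r))"


section \<open>Uniform families of circuits with access to the interfaces\<close>

text \<open>
  \<open>Pub i t\<close> XORs the value of the ideal public interface at the \<open>r\<close> wires from \<open>i\<close> on into the
  \<open>r\<close> wires from \<open>t\<close> on. \<open>Coin a l t\<close> reads the \<open>l\<close> wires from \<open>a\<close> on as a binary address (least
  significant bit first) into the shared random string and XORs the bit found there into wire
  \<open>t\<close>; addresses beyond the end of the string yield \<open>0\<close>. \<open>Phase\<close> is the gate
  diag\<open>(1, exp (\<i> \<pi> / 4))\<close>.
\<close>

datatype 'w gate =
    Flip 'w
  | CNot 'w 'w
  | Toffoli 'w 'w 'w
  | Pub 'w 'w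
  | Coin 'w 'w 'w
  | Hadamard 'w
  | Phase 'w

fun classical_gate :: "'w gate \<Rightarrow> bool" where
  "classical_gate (Hadamard i) = False"
| "classical_gate (Phase i) = False"
| "classical_gate g = True"

fun wf_gate :: "nat \<Rightarrow> nat \<Rightarrow> nat gate \<Rightarrow> bool" where
  "wf_gate r N (Flip t) \<longleftrightarrow> t < N"
| "wf_gate r N (CNot i t) \<longleftrightarrow> i < N \<and> t < N \<and> i \<noteq> t"
| "wf_gate r N (Toffoli i j t) \<longleftrightarrow> i < N \<and> j < N \<and> t < N \<and> i \<noteq> j \<and> i \<noteq> t \<and> j \<noteq> t"
| "wf_gate r N (Pub i t) \<longleftrightarrow> i + r \<le> N \<and> t + r \<le> N \<and> (i + r \<le> t \<or> t + r \<le> i)"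
| "wf_gate r N (Coin a l t) \<longleftrightarrow> a + l \<le> N \<and> t < N \<and> (t < a \<or> a + l \<le> t)"
| "wf_gate r N (Hadamard i) \<longleftrightarrow> i < N"
| "wf_gate r N (Phase i) \<longleftrightarrow> i < N"

definition coin_at :: "bits \<Rightarrow> bits \<Rightarrow> bool" where
  "coin_at sr a = (let k = horner_sum of_bool (2::nat) a in k < length sr \<and> sr ! k)"

text \<open>Action of the classical gates on bit strings (the value at the other two gates is unused).\<close>

fun gate_map :: "nat \<Rightarrow> func \<Rightarrow> bits \<Rightarrow> nat gate \<Rightarrow> bits \<Rightarrow> bits" where
  "gate_map r f sr (Flip t) b = xor_into t [True] b"
| "gate_map r f sr (CNot i t) b = xor_into t [b ! i] b"
| "gate_map r f sr (Toffoli i j t) b = xor_into t [b ! i \<and> b ! j] b"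
| "gate_map r f sr (Pub i t) b = xor_into t (f (slice i r b)) b"
| "gate_map r f sr (Coin a l t) b = xor_into t [coin_at sr (slice a l b)] b"
| "gate_map r f sr (Hadamard i) b = b"
| "gate_map r f sr (Phase i) b = b"

text \<open>
  A family of circuits is generated by a single program, independent of \<open>r\<close> and \<open>c\<close>: a nest of
  bounded loops that emits gates whose wires are given by arithmetic expressions. Variables are
  de Bruijn indices into the environment, innermost loop counter first; the initial environment
  is \<open>[r, c]\<close>. Loop bounds are expressions too, so every loop counter is polynomially bounded in
  \<open>r + c\<close> and the circuits are generated in time polynomial in \<open>r + c\<close>. Conversely, the tableau
  of a polynomial-time machine is such a family.
\<close>

datatype aexp =
    Const nat
  | Var nat
  | Plus aexp aexp
  | Minus aexp aexp
  | Times aexp aexp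
  | Div aexp aexp

primrec aval :: "nat list \<Rightarrow> aexp \<Rightarrow> nat" where
  "aval env (Const k) = k"
| "aval env (Var i) = (if i < length env then env ! i else 0)"
| "aval env (Plus d e) = aval env d + aval env e"
| "aval env (Minus d e) = aval env d - aval env e"
| "aval env (Times d e) = aval env d * aval env e"
| "aval env (Div d e) = aval env d div aval env e"

datatype prog =
    Skip
  | Emit "aexp gate"
  | Seq prog prog
  | IfLess aexp aexp prog prog
  | For aexp prog
  | ForDown aexp prog

primrec unroll :: "prog \<Rightarrow> nat list \<Rightarrow> nat gate list" where
  "unroll Skip env = []"
| "unroll (Emit g) env = [map_gate (aval env) g]"
| "unroll (Seq p q) env = unroll p env @ unroll q env"
| "unroll (IfLess d e p q) env = (if aval env d < aval env e then unroll p env else unroll q env)"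
| "unroll (For e p) env = concat (map (\<lambda>i. unroll p (i # env)) [0..<aval env e])"
| "unroll (ForDown e p) env = concat (map (\<lambda>i. unroll p (i # env)) (rev [0..<aval env e]))"

text \<open>
  A simulator consists of one program per direction of the public interface, the number of
  ancilla wires, and the length of the shared random string. With \<open>n = r + c\<close>, wires
  \<open>0, \<dots>, n - 1\<close> of its circuits hold the query, wires \<open>n, \<dots>, 2 * n - 1\<close> receive the answer,
  and the remaining wires are ancillas. These are reset to \<open>0\<close> at the beginning of every query
  and discarded at its end, so that no state is kept between queries.
\<close>

datatype simulator = Simulator
  (sim_fwd: prog) (sim_bwd: prog) (sim_anc: aexp) (sim_coins: "nat \<Rightarrow> nat \<Rightarrow> nat")

definition anc :: "simulator \<Rightarrow> nat \<Rightarrow> nat \<Rightarrow> nat" where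
  "anc S r c = aval [r, c] (sim_anc S)"

definition efficient :: "(nat \<times> nat) set \<Rightarrow> simulator \<Rightarrow> bool" where
  "efficient A S \<longleftrightarrow>
     (\<forall>(r, c) \<in> A. \<forall>p \<in> {sim_fwd S, sim_bwd S}. \<forall>g \<in> set (unroll p [r, c]).
        wf_gate r (2 * (r + c) + anc S r c) g) \<and>
     (\<exists>q :: nat poly. \<forall>(r, c) \<in> A. anc S r c \<le> poly q (r + c) \<and>
        (\<forall>p \<in> {sim_fwd S, sim_bwd S}. length (unroll p [r, c]) \<le> poly q (r + c)))"

definition classical_simulator :: "(nat \<times> nat) set \<Rightarrow> simulator \<Rightarrow> bool" where
  "classical_simulator A S \<longleftrightarrow>
     (\<forall>(r, c) \<in> A. \<forall>p \<in> {sim_fwd S, sim_bwd S}. \<forall>g \<in> set (unroll p [r, c]). classical_gate g)"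


section \<open>The classical setting\<close>

text \<open>
  A classical distinguisher is a decision tree of unbounded depth with arbitrary discrete
  randomness and unbounded computation between queries. Queries of the wrong length are rejected
  with the empty answer in both worlds.
\<close>

datatype cdist =
    Output bool
  | Sample "nat pmf" "nat \<Rightarrow> cdist"
  | QueryPriv bits "bits \<Rightarrow> cdist"
  | QueryFwd bits "bits \<Rightarrow> cdist"
  | QueryBwd bits "bits \<Rightarrow> cdist"

definition answer :: "nat \<Rightarrow> func \<Rightarrow> func" where
  "answer k F x = (if length x = k then F x else [])"

primrec crun :: "nat \<Rightarrow> nat \<Rightarrow> func \<times> func \<times> func \<Rightarrow> cdist \<Rightarrow> bool pmf" where
  "crun r c I (Output b) = return_pmf b"
| "crun r c I (Sample p D) = bind_pmf p (\<lambda>i. crun r c I (D i))"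
| "crun r c I (QueryPriv x D) = crun r c I (D (answer r (fst I) x))"
| "crun r c I (QueryFwd x D) = crun r c I (D (answer (r + c) (fst (snd I)) x))"
| "crun r c I (QueryBwd x D) = crun r c I (D (answer (r + c) (snd (snd I)) x))"

definition csim :: "simulator \<Rightarrow> nat \<Rightarrow> nat \<Rightarrow> func \<Rightarrow> bits \<Rightarrow> prog \<Rightarrow> func" where
  "csim S r c f sr p x =
     slice (r + c) (r + c)
       (fold (gate_map r f sr) (unroll p [r, c]) (x @ replicate (r + c + anc S r c) False))"

definition creal :: "construction \<Rightarrow> nat \<Rightarrow> nat \<Rightarrow> cdist \<Rightarrow> real" where
  "creal C r c D = pmf (bind_pmf (C r c) (\<lambda>I. crun r c I D)) True"

definition cideal :: "ideal \<Rightarrow> simulator \<Rightarrow> nat \<Rightarrow> nat \<Rightarrow> cdist \<Rightarrow> real" where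
  "cideal R S r c D =
     pmf (bind_pmf (pair_pmf (R r c) (pmf_of_set (bitstrings (sim_coins S r c))))
       (\<lambda>((priv, pub), sr).
          crun r c (priv, csim S r c pub sr (sim_fwd S), csim S r c pub sr (sim_bwd S)) D)) True"

text \<open>Strong \<open>\<epsilon>\<close>-perfect reset indifferentiability with shared randomness, for parameters in \<open>A\<close>.\<close>

definition classical_reset_indiff ::
    "(nat \<times> nat) set \<Rightarrow> construction \<Rightarrow> ideal \<Rightarrow> (nat \<Rightarrow> real) \<Rightarrow> bool" where
  "classical_reset_indiff A C R \<epsilon> \<longleftrightarrow>
     (\<exists>S. efficient A S \<and> classical_simulator A S \<and>
       (\<forall>(r, c) \<in> A. \<forall>D. \<bar>creal C r c D - cideal R S r c D\<bar> \<le> \<epsilon> (min r c)))"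


section \<open>The quantum setting\<close>

text \<open>
  Operators and density operators on \<open>k\<close> qubits are given by their matrix entries in the
  computational basis \<open>bitstrings k\<close>; entries outside the basis are irrelevant.
\<close>

type_synonym qop = "bits \<Rightarrow> bits \<Rightarrow> complex"

definition unitary_op :: "nat \<Rightarrow> qop \<Rightarrow> bool" where
  "unitary_op k U \<longleftrightarrow>
     (\<forall>a \<in> bitstrings k. \<forall>b \<in> bitstrings k.
        (\<Sum>d \<in> bitstrings k. cnj (U d a) * U d b) = of_bool (a = b))"

definition mult_op :: "nat \<Rightarrow> qop \<Rightarrow> qop \<Rightarrow> qop" where
  "mult_op k U V a b = (\<Sum>d \<in> bitstrings k. U a d * V d b)"

definition conj_op :: "nat \<Rightarrow> qop \<Rightarrow> qop \<Rightarrow> qop" where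
  "conj_op k U \<rho> a b =
     (\<Sum>a' \<in> bitstrings k. \<Sum>b' \<in> bitstrings k. U a a' * \<rho> a' b' * cnj (U b b'))"

text \<open>The operator \<open>K\<close> on the first \<open>k\<close> qubits, tensored with the identity on the others.\<close>

definition lift_op :: "nat \<Rightarrow> qop \<Rightarrow> qop" where
  "lift_op k K a b = (if drop k a = drop k b then K (take k a) (take k b) else 0)"

text \<open>The query unitary of \<open>F\<close> with input in the first \<open>k\<close> qubits, output in the qubits after them.\<close>

definition query_op :: "nat \<Rightarrow> func \<Rightarrow> qop" where
  "query_op k F a b = of_bool (a = xor_into k (F (take k b)) b)"

fun gate_op :: "nat \<Rightarrow> func \<Rightarrow> bits \<Rightarrow> nat gate \<Rightarrow> qop" where
  "gate_op r f sr (Hadamard i) a b =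
     (if a[i := b ! i] = b then (if a ! i \<and> b ! i then - 1 else 1) / sqrt 2 else 0)"
| "gate_op r f sr (Phase i) a b = (if a = b then if b ! i then cis (pi / 4) else 1 else 0)"
| "gate_op r f sr g a b = of_bool (a = gate_map r f sr g b)"

primrec circuit_op :: "nat \<Rightarrow> nat \<Rightarrow> func \<Rightarrow> bits \<Rightarrow> nat gate list \<Rightarrow> qop" where
  "circuit_op N r f sr [] = (\<lambda>a b. of_bool (a = b))"
| "circuit_op N r f sr (g # gs) = mult_op N (circuit_op N r f sr gs) (gate_op r f sr g)"

text \<open>
  A quantum query to the simulator: its circuit is run on the query and answer registers (the
  first \<open>2 * (r + c)\<close> of \<open>m\<close> qubits) and on ancillas prepared in the zero state, and the ancillas
  are traced out.
\<close>

definition qsim :: "simulator \<Rightarrow> nat \<Rightarrow> nat \<Rightarrow> func \<Rightarrow> bits \<Rightarrow> prog \<Rightarrow> nat \<Rightarrow> qop \<Rightarrow> qop" where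
  "qsim S r c f sr p m \<rho> a b =
     (let n = r + c; l = anc S r c;
          K = (\<lambda>z x y. circuit_op (2 * n + l) r f sr (unroll p [r, c])
                         (x @ z) (y @ replicate l False))
      in \<Sum>z \<in> bitstrings l. conj_op m (lift_op (2 * n) (K z)) \<rho> a b)"

text \<open>
  A quantum distinguisher alternates arbitrary unitaries on its \<open>m\<close> qubits with arbitrarily many
  queries on the first qubits; its output bit is the outcome of measuring the last qubit.
\<close>

datatype qstep = Unitary qop | QPriv | QFwd | QBwd

definition quantum_distinguisher :: "nat \<Rightarrow> nat \<Rightarrow> nat \<Rightarrow> qstep list \<Rightarrow> bool" where
  "quantum_distinguisher r c m D \<longleftrightarrow>
     2 * (r + c) < m \<and> (\<forall>U. Unitary U \<in> set D \<longrightarrow> unitary_op m U)"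

primrec qstep_run :: "nat \<Rightarrow> (qop \<Rightarrow> qop) \<times> (qop \<Rightarrow> qop) \<times> (qop \<Rightarrow> qop) \<Rightarrow> qstep \<Rightarrow> qop \<Rightarrow> qop" where
  "qstep_run m Q (Unitary U) = conj_op m U"
| "qstep_run m Q QPriv = fst Q"
| "qstep_run m Q QFwd = fst (snd Q)"
| "qstep_run m Q QBwd = snd (snd Q)"

definition qrun :: "nat \<Rightarrow> (qop \<Rightarrow> qop) \<times> (qop \<Rightarrow> qop) \<times> (qop \<Rightarrow> qop) \<Rightarrow> qstep list \<Rightarrow> real" where
  "qrun m Q D =
     (let z = replicate m False;
          \<rho> = fold (qstep_run m Q) D (\<lambda>a b. of_bool (a = z \<and> b = z))
      in \<Sum>b \<in> {b \<in> bitstrings m. last b}. Re (\<rho> b b))"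

definition qreal :: "construction \<Rightarrow> nat \<Rightarrow> nat \<Rightarrow> nat \<Rightarrow> qstep list \<Rightarrow> real" where
  "qreal C r c m D =
     measure_pmf.expectation (C r c)
       (\<lambda>(priv, fwd, bwd).
          qrun m (conj_op m (query_op r priv), conj_op m (query_op (r + c) fwd),
                  conj_op m (query_op (r + c) bwd)) D)"

definition qideal :: "ideal \<Rightarrow> simulator \<Rightarrow> nat \<Rightarrow> nat \<Rightarrow> nat \<Rightarrow> qstep list \<Rightarrow> real" where
  "qideal R S r c m D =
     measure_pmf.expectation (pair_pmf (R r c) (pmf_of_set (bitstrings (sim_coins S r c))))
       (\<lambda>((priv, pub), sr).
          qrun m (conj_op m (query_op r priv), qsim S r c pub sr (sim_fwd S) m,
                  qsim S r c pub sr (sim_bwd S) m) D)"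

definition quantum_reset_indiff ::
    "(nat \<times> nat) set \<Rightarrow> construction \<Rightarrow> ideal \<Rightarrow> (nat \<Rightarrow> real) \<Rightarrow> bool" where
  "quantum_reset_indiff A C R \<epsilon> \<longleftrightarrow>
     (\<exists>S. efficient A S \<and>
       (\<forall>(r, c) \<in> A. \<forall>m D. quantum_distinguisher r c m D \<longrightarrow>
          \<bar>qreal C r c m D - qideal R S r c m D\<bar> \<le> \<epsilon> (min r c)))"

end

(*
  The simulator evaluates the permutation T o g o K, where g is a Feistel-type permutation that uses
  one query to f and maps (x, 0) to (f x, x, 0), K permutes the strings whose last c bits are not all
  zero, and T permutes the strings with a given r-bit prefix. If K and T are uniform, then T o g o K is
  uniform among the permutations whose sponge function is f (a double coset argument). Hence the ideal
  world differs from the real one only in the distribution of the sponge function of a random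
  permutation, and its distance from a uniform function is a comparison of sampling with and without
  replacement (Stam): the likelihood ratio is a martingale bounded by 2, and its variance is
  O(2^(-r)).

  K and T are computed from the shared random string, which is long enough to be a random function, by
  swap-or-not shuffles (Hoang, Morris, Rogaway), applied in levels to the strings with more and more
  leading zeros (Morris, Rogaway): a level places about half of its strings almost uniformly, given
  that the remaining ones are already permuted uniformly. Since each round is an involution
  controlled by symmetric data, T o g o K has a reversible circuit with clean ancillas, so the
  simulator answers superposition queries exactly as an oracle for the permutation would. Both
  settings thus reduce to the statistical distance of (f, T o g o K) in the two worlds.
*)
theory Submission
  imports Defs
begin

section \<open>Finite averages\<close>

text \<open>The distinguisher may query every point, so the simulator has to produce, consistently
  over all queries, a complete permutation of \<open>2 ^ (r + c)\<close> strings with nearly the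
  right law, while each query gets only polynomially many gates. The usual analysis of swap-or-not
  covers a bounded fraction of the points: the gain of a round at the point being placed is
  proportional to the number of points whose images are still open, and it vanishes as they run out.
  Levels keep that number at a quarter of the number of keys or more, whence the contraction
  \<open>sqrt (7 / 8)\<close> per round; \<open>48 * n\<close> rounds then pay for a union bound
  over all points and levels. Clean ancillas are indispensable in the quantum setting, since
  leftover work bits would act as a measurement of the query. The condition \<open>r \<le> c\<close>
  enters twice: the Feistel map needs \<open>r\<close> capacity bits for the input, and for
  \<open>2 ^ r\<close> draws from blocks of size \<open>2 ^ c\<close> the variance of the likelihood
  ratio is at most \<open>16 * 2 ^ r / 2 ^ (2 * c)\<close>.\<close>

definition avg :: "'a set \<Rightarrow> ('a \<Rightarrow> real) \<Rightarrow> real" where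
  "avg A f = sum f A / real (card A)"

lemma avg_cong: "A = B \<Longrightarrow> (\<And>a. a \<in> B \<Longrightarrow> f a = g a) \<Longrightarrow> avg A f = avg B g"
  by (simp add: avg_def cong: sum.cong)

lemma avg_const [simp]: "finite A \<Longrightarrow> A \<noteq> {} \<Longrightarrow> avg A (\<lambda>_. k) = k"
  by (simp add: avg_def)

lemma avg_singleton [simp]: "avg {a} f = f a"
  by (simp add: avg_def)

lemma avg_add: "avg A (\<lambda>a. f a + g a) = avg A f + avg A g"
  by (simp add: avg_def sum.distrib add_divide_distrib)

lemma avg_diff: "avg A (\<lambda>a. f a - g a) = avg A f - avg A g"
  by (simp add: avg_def sum_subtractf diff_divide_distrib)

lemma avg_mult_left: "avg A (\<lambda>a. k * f a) = k * avg A f"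
  by (simp add: avg_def sum_distrib_left)

lemma avg_divide: "avg A (\<lambda>a. f a / k) = avg A f / k"
  by (simp add: avg_def sum_divide_distrib[symmetric] mult.commute)

lemma avg_sum: "avg A (\<lambda>a. \<Sum>i\<in>I. f i a) = (\<Sum>i\<in>I. avg A (f i))"
  unfolding avg_def by (subst sum.swap) (simp add: sum_divide_distrib)

lemma avg_mono: "(\<And>a. a \<in> A \<Longrightarrow> f a \<le> g a) \<Longrightarrow> avg A f \<le> avg A g"
  by (simp add: avg_def divide_right_mono sum_mono)

lemma avg_abs_le: "\<bar>avg A f\<bar> \<le> avg A (\<lambda>a. \<bar>f a\<bar>)"
  by (simp add: avg_def divide_right_mono)

text \<open>Division by zero makes the average over an empty or infinite set 0, hence the condition
  \<open>0 \<le> b\<close>.\<close>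

lemma avg_le:
  assumes "\<And>a. a \<in> A \<Longrightarrow> f a \<le> b" "0 \<le> b"
  shows "avg A f \<le> b"
proof (cases "finite A \<and> A \<noteq> {}")
  case True
  then show ?thesis using avg_mono[of A f "\<lambda>_. b"] assms by simp
next
  case False
  then show ?thesis using assms by (auto simp: avg_def)
qed

lemma avg_ge_0: "(\<And>a. a \<in> A \<Longrightarrow> 0 \<le> f a) \<Longrightarrow> 0 \<le> avg A f"
  by (simp add: avg_def sum_nonneg)

lemma avg_abs_le_bound:
  assumes "\<And>a. a \<in> A \<Longrightarrow> \<bar>f a\<bar> \<le> b" "0 \<le> b"
  shows "\<bar>avg A f\<bar> \<le> b"
  using avg_abs_le[of A f] avg_le[of A "\<lambda>a. \<bar>f a\<bar>" b] assms by force

lemma avg_diff_abs_le: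
  assumes "\<And>a. a \<in> A \<Longrightarrow> \<bar>f a - g a\<bar> \<le> b" "0 \<le> b"
  shows "\<bar>avg A f - avg A g\<bar> \<le> b"
  using avg_abs_le_bound[of A "\<lambda>a. f a - g a" b] assms by (simp add: avg_diff)

lemma avg_swap: "avg A (\<lambda>a. avg B (\<lambda>b. f a b)) = avg B (\<lambda>b. avg A (\<lambda>a. f a b))"
proof -
  have "(\<Sum>a\<in>A. \<Sum>b\<in>B. f a b) = (\<Sum>b\<in>B. \<Sum>a\<in>A. f a b)"
    by (rule sum.swap)
  then show ?thesis
    by (simp add: avg_def sum_divide_distrib[symmetric] mult.commute)
qed

lemma avg_bij_betw: "bij_betw g A B \<Longrightarrow> avg B f = avg A (\<lambda>a. f (g a))"
  by (simp add: avg_def bij_betw_same_card[symmetric] sum.reindex_bij_betw)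

lemma avg_Times: "avg (A \<times> B) f = avg A (\<lambda>a. avg B (\<lambda>b. f (a, b)))"
  by (simp add: avg_def sum.cartesian_product card_cartesian_product sum_divide_distrib[symmetric])

lemma avg_Sigma:
  assumes "finite A" "\<And>a. a \<in> A \<Longrightarrow> finite (B a)" "\<And>a. a \<in> A \<Longrightarrow> card (B a) = k"
  shows "avg (Sigma A B) f = avg A (\<lambda>a. avg (B a) (\<lambda>b. f (a, b)))"
proof -
  have "sum f (Sigma A B) = (\<Sum>a\<in>A. \<Sum>b\<in>B a. f (a, b))"
    using assms by (simp add: sum.Sigma)
  moreover have "card (Sigma A B) = card A * k"
    using assms by simp
  moreover have "avg A (\<lambda>a. avg (B a) (\<lambda>b. f (a, b))) = (\<Sum>a\<in>A. (\<Sum>b\<in>B a. f (a, b)) / real k) / real (card A)"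
    using assms by (simp add: avg_def)
  ultimately show ?thesis
    by (simp add: avg_def sum_divide_distrib[symmetric] mult.commute)
qed

lemma avg_equal_fibres:
  assumes fin: "finite A" "finite B" and g: "\<And>a. a \<in> A \<Longrightarrow> g a \<in> B"
    and card: "\<And>b. b \<in> B \<Longrightarrow> card {a \<in> A. g a = b} = k" and k: "k > 0"
  shows "avg A (\<lambda>a. f (g a)) = avg B f"
proof -
  have "sum (\<lambda>a. f (g a)) A = (\<Sum>b\<in>B. \<Sum>a\<in>{a \<in> A. g a = b}. f (g a))"
    using fin g by (intro sum.group[symmetric]) auto
  also have "\<dots> = (\<Sum>b\<in>B. real k * f b)"
    using card by (intro sum.cong) auto
  finally have s: "sum (\<lambda>a. f (g a)) A = real k * sum f B"
    by (simp add: sum_distrib_left)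
  have "card A = (\<Sum>b\<in>B. card {a \<in> A. g a = b})"
    using fin g sum.group[of A B g "\<lambda>_. 1::nat"] by (simp add: image_subset_iff)
  then have "card A = k * card B" using card by simp
  with s k show ?thesis by (simp add: avg_def)
qed

text \<open>Law of total expectation: the inner average is the conditional expectation of
  \<open>f\<close> given \<open>g\<close>, and summing it over a fibre restores the sum of
  \<open>f\<close> there.\<close>

lemma avg_tower:
  assumes fin: "finite A"
  shows "avg A f = avg A (\<lambda>a. avg {a' \<in> A. g a' = g a} f)"
proof -
  have "sum (\<lambda>a. avg {a' \<in> A. g a' = g a} f) A =
     (\<Sum>b\<in>g ` A. \<Sum>a\<in>{a \<in> A. g a = b}. avg {a' \<in> A. g a' = g a} f)"
    using fin by (intro sum.group[symmetric]) auto
  also have "\<dots> = (\<Sum>b\<in>g ` A. \<Sum>a\<in>{a \<in> A. g a = b}. f a)"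
  proof (rule sum.cong[OF refl])
    fix b assume "b \<in> g ` A"
    then have ne: "card {a \<in> A. g a = b} \<noteq> 0" using fin by auto
    have "(\<Sum>a\<in>{a \<in> A. g a = b}. avg {a' \<in> A. g a' = g a} f) =
        (\<Sum>a\<in>{a \<in> A. g a = b}. avg {a' \<in> A. g a' = b} f)"
      by (intro sum.cong) auto
    with ne show "(\<Sum>a\<in>{a \<in> A. g a = b}. avg {a' \<in> A. g a' = g a} f) = (\<Sum>a\<in>{a \<in> A. g a = b}. f a)"
      by (simp add: avg_def)
  qed
  also have "\<dots> = sum f A"
    using fin by (intro sum.group) auto
  finally show ?thesis by (simp add: avg_def)
qed

lemma avg_square_le: "(avg A f)\<^sup>2 \<le> avg A (\<lambda>a. (f a)\<^sup>2)"
proof (cases "card A = 0")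
  case False
  have "(sum f A)\<^sup>2 \<le> (\<Sum>a\<in>A. (f a)\<^sup>2) * real (card A)"
    using sum_squared_le_sum_of_squares[of f A] False by (simp add: card_gt_0_iff mult.commute)
  then have "(sum f A)\<^sup>2 / (real (card A))\<^sup>2 \<le> (\<Sum>a\<in>A. (f a)\<^sup>2) * real (card A) / (real (card A))\<^sup>2"
    by (intro divide_right_mono) auto
  with False show ?thesis by (simp add: avg_def power_divide power2_eq_square)
qed (simp add: avg_def)

lemma avg_le_sqrt: "avg A f \<le> sqrt (avg A (\<lambda>a. (f a)\<^sup>2))"
  using avg_square_le by (rule real_le_rsqrt)

section \<open>Sampling with and without replacement\<close>

definition words :: "'a set \<Rightarrow> nat \<Rightarrow> 'a list set" where
  "words Y k = {xs. set xs \<subseteq> Y \<and> length xs = k}"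

definition dwords :: "'a set \<Rightarrow> nat \<Rightarrow> 'a list set" where
  "dwords V k = {xs. set xs \<subseteq> V \<and> length xs = k \<and> distinct xs}"

lemma words_0 [simp]: "words Y 0 = {[]}"
  by (auto simp: words_def)

lemma dwords_0 [simp]: "dwords V 0 = {[]}"
  by (auto simp: dwords_def)

lemma finite_words: "finite Y \<Longrightarrow> finite (words Y k)"
  unfolding words_def by (rule finite_lists_length_eq)

lemma finite_dwords: "finite V \<Longrightarrow> finite (dwords V k)"
  by (rule finite_subset[OF _ finite_words[of V k]]) (auto simp: words_def dwords_def)

lemma words_ne: "Y \<noteq> {} \<Longrightarrow> words Y k \<noteq> {}"
  by (auto simp: words_def intro!: exI[of _ "replicate k (SOME y. y \<in> Y)"] some_in_eq[THEN iffD2])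

text \<open>The newest draw is the head of the list, so the tail is the history on which the law of
  the next draw may depend.\<close>

lemma avg_words_Suc:
  assumes "finite Y"
  shows "avg (words Y (Suc k)) G = avg (words Y k) (\<lambda>xs. avg Y (\<lambda>y. G (y # xs)))"
proof -
  have "bij_betw (\<lambda>(xs, y). y # xs) (words Y k \<times> Y) (words Y (Suc k))"
    by (rule bij_betw_byWitness[where f' = "\<lambda>zs. (tl zs, hd zs)"])
       (auto simp: words_def length_Suc_conv)
  from avg_bij_betw[OF this] show ?thesis by (simp add: avg_Times)
qed

lemma avg_dwords_Suc:
  assumes "finite V"
  shows "avg (dwords V (Suc k)) G = avg (dwords V k) (\<lambda>xs. avg (V - set xs) (\<lambda>y. G (y # xs)))"
proof -
  have "bij_betw (\<lambda>(xs, y). y # xs) (Sigma (dwords V k) (\<lambda>xs. V - set xs)) (dwords V (Suc k))"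
    by (rule bij_betw_byWitness[where f' = "\<lambda>zs. (tl zs, hd zs)"])
       (auto simp: dwords_def length_Suc_conv)
  from avg_bij_betw[OF this, of G]
  have "avg (dwords V (Suc k)) G = avg (Sigma (dwords V k) (\<lambda>xs. V - set xs)) (\<lambda>(xs, y). G (y # xs))"
    by (simp add: case_prod_unfold)
  also have "\<dots> = avg (dwords V k) (\<lambda>xs. avg (V - set xs) (\<lambda>y. G (y # xs)))"
    by (subst avg_Sigma[where k = "card V - k"])
       (use assms finite_dwords[OF assms, of k] in \<open>auto simp: dwords_def card_Diff_subset distinct_card\<close>)
  finally show ?thesis .
qed

text \<open>
  The probability that sampling without replacement from \<open>M\<close> blocks of size \<open>S\<close> hits the blocks in
  the list (last element first), relative to that of sampling with replacement.
\<close>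

fun ratio :: "real \<Rightarrow> real \<Rightarrow> 'a list \<Rightarrow> real" where
  "ratio M S [] = 1"
| "ratio M S (y # xs) = ratio M S xs * (M * (S - count_list xs y) / (M * S - length xs))"

text \<open>Change of measure. After the draws \<open>xs\<close>, block \<open>y\<close> has
  \<open>S - count_list (map p xs) y\<close> points left among \<open>M * S - length xs\<close>,
  against the chance \<open>1 / M\<close> with replacement; the quotient is the next factor of
  \<open>ratio\<close>. The bound \<open>k \<le> S\<close> keeps these subtractions exact.\<close>

lemma avg_dwords_map:
  fixes p :: "'v \<Rightarrow> 'y"
  assumes V: "finite V" and Y: "finite Y" "p ` V \<subseteq> Y"
    and fib: "\<And>y. y \<in> Y \<Longrightarrow> card {v \<in> V. p v = y} = S"
    and M: "card Y = M" "M > 0" and k: "k \<le> S"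
  shows "avg (dwords V k) (\<lambda>xs. G (map p xs)) = avg (words Y k) (\<lambda>ys. ratio M S ys * G ys)"
  using k
proof (induction k arbitrary: G)
  case (Suc k)
  have cV: "card V = M * S"
    using card_eq_sum[of V] sum.group[of V Y p "\<lambda>_. 1::nat"] V Y fib M by simp
  have kl: "k < S" using Suc.prems by simp
  have step: "avg (V - set xs) (\<lambda>v. G (p v # map p xs)) =
      avg Y (\<lambda>y. real M * (real S - count_list (map p xs) y) / (real M * real S - length (map p xs)) * G (y # map p xs))"
    if "xs \<in> dwords V k" for xs
  proof -
    from that have xs: "set xs \<subseteq> V" "length xs = k" "distinct xs" by (auto simp: dwords_def)
    have cnt: "card {v \<in> V - set xs. p v = y} = S - count_list (map p xs) y"
        "count_list (map p xs) y \<le> k" if "y \<in> Y" for y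
    proof -
      have "count_list (map p xs) y = length (filter (\<lambda>v. p v = y) xs)"
        by (induction xs) auto
      also have "\<dots> = card {v \<in> set xs. p v = y}"
        using xs by (simp add: distinct_card[symmetric])
      finally have *: "count_list (map p xs) y = card {v \<in> set xs. p v = y}" .
      have "{v \<in> V - set xs. p v = y} = {v \<in> V. p v = y} - {v \<in> set xs. p v = y}" by auto
      then show "card {v \<in> V - set xs. p v = y} = S - count_list (map p xs) y"
        using xs fib[OF that] * V by (simp add: card_Diff_subset subset_iff)
      show "count_list (map p xs) y \<le> k"
        unfolding * using xs card_mono[of "set xs" "{v \<in> set xs. p v = y}"] distinct_card[of xs] by auto
    qed
    have "(\<Sum>v\<in>V - set xs. G (p v # map p xs)) =
        (\<Sum>y\<in>Y. \<Sum>v\<in>{v \<in> V - set xs. p v = y}. G (p v # map p xs))"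
      using V Y by (intro sum.group[symmetric]) auto
    also have "\<dots> = (\<Sum>y\<in>Y. (real S - count_list (map p xs) y) * G (y # map p xs))"
    proof (rule sum.cong[OF refl])
      fix y assume y: "y \<in> Y"
      have "real (S - count_list (map p xs) y) = real S - count_list (map p xs) y"
        using cnt(2)[OF y] kl by (simp add: of_nat_diff)
      then show "(\<Sum>v\<in>{v \<in> V - set xs. p v = y}. G (p v # map p xs)) =
          (real S - count_list (map p xs) y) * G (y # map p xs)"
        using cnt(1)[OF y] by simp
    qed
    finally have s: "(\<Sum>v\<in>V - set xs. G (p v # map p xs)) = \<dots>" .
    have "k \<le> M * S" using kl M by (metis le_trans less_imp_le mult_le_mono1 nat_mult_1 One_nat_def Suc_leI)
    then have c: "real (card (V - set xs)) = real M * real S - real k"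
      using xs V cV by (simp add: card_Diff_subset distinct_card of_nat_diff)
    show ?thesis
      unfolding avg_def s c using M xs
      by (simp add: sum_divide_distrib sum_distrib_left mult.assoc)
  qed
  have "avg (dwords V (Suc k)) (\<lambda>xs. G (map p xs)) =
      avg (dwords V k) (\<lambda>xs. avg (V - set xs) (\<lambda>v. G (p v # map p xs)))"
    using V by (simp add: avg_dwords_Suc)
  also have "\<dots> = avg (dwords V k) (\<lambda>xs. avg Y (\<lambda>y. real M * (real S - count_list (map p xs) y) /
      (real M * real S - length (map p xs)) * G (y # map p xs)))"
    by (intro avg_cong refl step)
  also have "\<dots> = avg (words Y k) (\<lambda>ys. ratio M S ys * avg Y (\<lambda>y. real M * (real S - count_list ys y) /
      (real M * real S - length ys) * G (y # ys)))"
    using Suc.IH[of "\<lambda>ys. avg Y (\<lambda>y. real M * (real S - count_list ys y) /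
      (real M * real S - length ys) * G (y # ys))"] kl by simp
  also have "\<dots> = avg (words Y (Suc k)) (\<lambda>ys. ratio M S ys * G ys)"
    using Y by (simp add: avg_words_Suc mult.assoc flip: avg_mult_left)
  finally show ?case .
qed simp

lemma sum_count_list: "finite Y \<Longrightarrow> set xs \<subseteq> Y \<Longrightarrow> (\<Sum>y\<in>Y. real (count_list xs y)) = length xs"
  using sum_count_set[of xs Y] by (simp flip: of_nat_sum)

section \<open>The likelihood ratio of the two kinds of sampling as a martingale\<close>

context
  fixes Y :: "'y set" and M S :: nat
  assumes Y: "finite Y" "card Y = M" "M > 0"
begin

lemma Y_ne: "Y \<noteq> {}"
  using Y by auto

lemma ratio_nonneg:
  "set xs \<subseteq> Y \<Longrightarrow> length xs \<le> S \<Longrightarrow> 0 \<le> ratio M S xs"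
proof (induction xs)
  case (Cons y xs)
  have "S \<le> M * S" using Y by simp
  then have "real (length xs) \<le> real M * real S"
    using Cons.prems(2) by (metis Suc_leD le_trans length_Cons of_nat_le_iff of_nat_mult)
  moreover have "real (count_list xs y) \<le> real S"
    using Cons.prems(2) count_le_length[of xs y] by auto
  ultimately show ?case using Cons by auto
qed simp

text \<open>The first equation is the martingale property. In the second, the numerator is
  \<open>M\<close> times the squared Euclidean distance of the occupancy counts from the flat
  vector: uneven histories are what makes the ratio fluctuate.\<close>

lemma avg_ratio_step:
  assumes "set xs \<subseteq> Y" "length xs < M * S"
  shows "avg Y (\<lambda>y. real M * (real S - count_list xs y) / (real M * real S - length xs)) = 1"
    "avg Y (\<lambda>y. (real M * (real S - count_list xs y) / (real M * real S - length xs))\<^sup>2) =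
     1 + (M * (\<Sum>y\<in>Y. (real (count_list xs y))\<^sup>2) - (real (length xs))\<^sup>2) / (real M * real S - length xs)\<^sup>2"
proof -
  define N where "N = real M * real S"
  define k where "k = real (length xs)"
  define q where "q = (\<Sum>y\<in>Y. (real (count_list xs y))\<^sup>2)"
  have kN: "N - k > 0" using assms(2) unfolding N_def k_def by (simp flip: of_nat_mult)
  have sc: "(\<Sum>y\<in>Y. real (count_list xs y)) = k"
    using sum_count_list[OF Y(1) assms(1)] by (simp add: k_def)
  have "(\<Sum>y\<in>Y. real M * (real S - count_list xs y)) = M * (N - k)"
    using Y by (simp add: sum_subtractf sc N_def flip: sum_distrib_left)
  then show "avg Y (\<lambda>y. real M * (real S - count_list xs y) / (real M * real S - length xs)) = 1"
    using kN Y by (simp add: avg_def N_def[symmetric] k_def[symmetric] flip: sum_divide_distrib)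
  have "(\<Sum>y\<in>Y. (real M * (real S - count_list xs y))\<^sup>2) =
      (\<Sum>y\<in>Y. N\<^sup>2 - (2 * N * M) * real (count_list xs y) + M\<^sup>2 * (real (count_list xs y))\<^sup>2)"
    unfolding N_def by (intro sum.cong) (auto simp: power2_eq_square algebra_simps)
  also have "\<dots> = M * N\<^sup>2 - (2 * N * M) * k + M\<^sup>2 * q"
    using Y by (simp add: sum.distrib sum_subtractf sc q_def flip: sum_distrib_left)
  also have "\<dots> = M * ((N - k)\<^sup>2 + (M * q - k\<^sup>2))"
    by (simp add: power2_eq_square algebra_simps)
  finally have "(\<Sum>y\<in>Y. (real M * (real S - count_list xs y))\<^sup>2) = M * ((N - k)\<^sup>2 + (M * q - k\<^sup>2))" .
  then show "avg Y (\<lambda>y. (real M * (real S - count_list xs y) / (real M * real S - length xs))\<^sup>2) =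
     1 + (M * (\<Sum>y\<in>Y. (real (count_list xs y))\<^sup>2) - (real (length xs))\<^sup>2) / (real M * real S - length xs)\<^sup>2"
    using kN Y
    by (simp add: avg_def N_def[symmetric] k_def[symmetric] q_def[symmetric] power_divide add_divide_distrib
        flip: sum_divide_distrib)
qed

lemma avg_ratio:
  "k \<le> M * S \<Longrightarrow> avg (words Y k) (ratio M S) = 1"
proof (induction k)
  case (Suc k)
  have "avg (words Y (Suc k)) (ratio M S) =
    avg (words Y k) (\<lambda>xs. ratio M S xs * avg Y (\<lambda>y. real M * (real S - count_list xs y) / (real M * real S - length xs)))"
    using Y by (simp add: avg_words_Suc flip: avg_mult_left)
  also have "\<dots> = avg (words Y k) (ratio M S)"
    by (intro avg_cong refl) (use Suc.prems in \<open>auto simp: words_def avg_ratio_step\<close>)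
  finally show ?case using Suc by simp
qed simp

text \<open>The sum of squares counts the ordered pairs of positions with equal entries: the
  \<open>k\<close> diagonal pairs always agree, and each of the \<open>k * (k - 1)\<close> others
  agrees with probability \<open>1 / M\<close>.\<close>

lemma avg_sum_count_list_square:
  "avg (words Y k) (\<lambda>xs. \<Sum>y\<in>Y. (real (count_list xs y))\<^sup>2) = k + k * (real k - 1) / M"
proof (induction k)
  case (Suc k)
  have *: "(\<Sum>y\<in>Y. (real (count_list (z # xs) y))\<^sup>2) =
      (\<Sum>y\<in>Y. (real (count_list xs y))\<^sup>2) + (2 * real (count_list xs z) + 1)" if "z \<in> Y" for z xs
  proof -
    have "(\<Sum>y\<in>Y. (real (count_list (z # xs) y))\<^sup>2) =
       (\<Sum>y\<in>Y. (real (count_list xs y))\<^sup>2 + (if y = z then 2 * real (count_list xs z) + 1 else 0))"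
      by (intro sum.cong) (auto simp: power2_eq_square algebra_simps)
    then show ?thesis using that Y by (simp add: sum.distrib)
  qed
  have "avg (words Y (Suc k)) (\<lambda>xs. \<Sum>y\<in>Y. (real (count_list xs y))\<^sup>2) =
     avg (words Y k) (\<lambda>xs. avg Y (\<lambda>z. (\<Sum>y\<in>Y. (real (count_list xs y))\<^sup>2) + (2 * real (count_list xs z) + 1)))"
    unfolding avg_words_Suc[OF Y(1)] by (intro avg_cong refl *)
  also have "\<dots> = avg (words Y k) (\<lambda>xs. (\<Sum>y\<in>Y. (real (count_list xs y))\<^sup>2) + (2 * real k / M + 1))"
  proof (intro avg_cong refl)
    fix xs assume "xs \<in> words Y k"
    then have "avg Y (\<lambda>z. real (count_list xs z)) = k / M"
      using sum_count_list[OF Y(1), of xs] Y by (auto simp: avg_def words_def)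
    then show "avg Y (\<lambda>z. (\<Sum>y\<in>Y. (real (count_list xs y))\<^sup>2) + (2 * real (count_list xs z) + 1)) =
        (\<Sum>y\<in>Y. (real (count_list xs y))\<^sup>2) + (2 * real k / M + 1)"
      using Y(1) Y_ne by (simp add: avg_add avg_mult_left)
  qed
  also have "\<dots> = (k + k * (real k - 1) / M) + (2 * real k / M + 1)"
    using Suc finite_words[OF Y(1)] words_ne[OF Y_ne] by (simp add: avg_add)
  also have "\<dots> = Suc k + Suc k * (real (Suc k) - 1) / M"
    using Y by (simp add: field_simps)
  finally show ?case .
qed simp

text \<open>Every factor of \<open>ratio\<close> is at most \<open>N / (N - i)\<close>, where
  \<open>N = M * S\<close> and \<open>i\<close> draws precede it. The product \<open>d\<close> of
  the inverses is at least \<open>1 - k * k / (2 * N)\<close> after \<open>k\<close> draws, which is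
  at least 1/2 because the square of the length is at most \<open>N\<close>.\<close>

lemma ratio_le_2:
  assumes xs: "set xs \<subseteq> Y" "length xs \<le> S" "(length xs)\<^sup>2 \<le> M * S"
  shows "ratio M S xs \<le> 2"
proof -
  define N where "N = real M * real S"
  define d where "d k = (\<Prod>i<k. 1 - real i / N)" for k :: nat
  have S: "S \<le> M * S" using Y by simp
  have d: "d k \<le> 1 \<and> d k \<ge> 1 - k * k / (2 * N) \<and> d k > 0" if "k \<le> S" for k
    using that
  proof (induction k)
    case (Suc k)
    have "real k < real (M * S)" using Suc.prems S by linarith
    then have kN: "real k < N" by (simp add: N_def)
    then have kN': "0 \<le> k / N" "k / N < 1" "N > 0" by (auto simp: field_simps)
    have "d (Suc k) = d k * (1 - k / N)" by (simp add: d_def)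
    moreover have "d k * (k / N) \<le> k / N" using Suc kN' by (intro mult_left_le_one_le) auto
    moreover have "d k * (1 - k / N) > 0" using Suc kN' by auto
    moreover have "d k * (1 - k / N) \<le> 1" using Suc kN' by (intro mult_le_one) auto
    moreover have "k * k / (2 * N) + k / N \<le> real (Suc k) * real (Suc k) / (2 * N)"
      using kN' by (simp add: field_simps)
    ultimately show ?case using Suc by (auto simp: algebra_simps)
  qed (simp add: d_def)
  have "ratio M S xs * d (length xs) \<le> 1"
    using xs(1,2)
  proof (induction xs)
    case (Cons y xs)
    define k where "k = length xs"
    have "length xs + 1 \<le> S" using Cons.prems by simp
    then have "k < M * S" using S unfolding k_def by linarith
    then have "real k < real (M * S)" by (simp only: of_nat_less_iff)
    then have kN: "real k < N" by (simp add: N_def)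
    have r0: "0 \<le> ratio M S xs" using Cons.prems by (intro ratio_nonneg) auto
    have "ratio M S (y # xs) * d (length (y # xs)) =
       (ratio M S xs * d k) * (real M * (real S - count_list xs y) / N)"
    proof -
      have "1 - k / N = (N - k) / N" using kN of_nat_0_le_iff[of k] by (simp add: field_simps)
      then have "d (Suc k) = d k * ((N - k) / N)" by (simp add: d_def)
      moreover have "X * (a / (N - k)) * (e * ((N - k) / N)) = (X * e) * (a / N)" for X a e :: real
        using kN by simp
      ultimately show ?thesis using kN by (simp only: ratio.simps list.size flip: k_def N_def) (simp add: k_def)
    qed
    also have "\<dots> \<le> (ratio M S xs * d k) * 1"
    proof (rule mult_left_mono)
      have "N > 0" using kN of_nat_0_le_iff[of k] by linarith
      moreover have "real M * (real S - count_list xs y) \<le> N"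
        by (simp add: N_def mult_left_mono)
      ultimately show "real M * (real S - count_list xs y) / N \<le> 1" by simp
      show "0 \<le> ratio M S xs * d k"
        using r0 d[of k] Cons.prems by (auto simp: k_def)
    qed
    finally show ?case using Cons by (simp add: k_def)
  qed (simp add: d_def)
  moreover have "d (length xs) \<ge> 1 / 2"
  proof -
    have "real (length xs) * real (length xs) \<le> N"
      using xs(3) unfolding N_def by (metis of_nat_le_iff of_nat_mult power2_eq_square)
    then have "length xs * length xs / (2 * N) \<le> 1 / 2"
      by (cases "N = 0") (auto simp: field_simps N_def)
    then show ?thesis using d[OF xs(2)] by (simp only: of_nat_mult) linarith
  qed
  moreover have "ratio M S xs * (1 / 2) \<le> ratio M S xs * d (length xs)"
    using calculation(2) ratio_nonneg[OF xs(1,2)] by (intro mult_left_mono) auto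
  ultimately show ?thesis by linarith
qed

text \<open>In each step the second moment grows by the average of the squared ratio times an
  occupancy excess. The bound 2 on the ratio decouples the two, and under sampling with replacement
  the excess averages to \<open>(M - 1) * j\<close>. The constant 16 is 4 from the squared ratio
  times 4 from \<open>N - j \<ge> N / 2\<close>.\<close>

lemma avg_ratio_square:
  assumes "k \<le> S" "k\<^sup>2 \<le> M * S" "2 * k \<le> M * S"
  shows "avg (words Y k) (\<lambda>xs. (ratio M S xs)\<^sup>2) \<le> 1 + real k * (16 * real M * real k / (real M * real S)\<^sup>2)"
proof -
  define N where "N = real M * real S"
  define K where "K = real k"
  define e where "e = 16 * real M * K / N\<^sup>2"
  have "j \<le> k \<Longrightarrow> avg (words Y j) (\<lambda>xs. (ratio M S xs)\<^sup>2) \<le> 1 + real j * e" for j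
  proof (induction j)
    case (Suc j)
    have jk: "j \<le> k" "real j \<le> K" using Suc.prems by (auto simp: K_def)
    have "real (2 * k) \<le> real (M * S)" using assms(3) by linarith
    then have KN: "2 * K \<le> N" by (simp add: N_def K_def)
    have N0: "N > 0" using KN Suc.prems by (auto simp: K_def)
    have jN: "j < M * S" using Suc.prems assms by linarith
    have j2: "j\<^sup>2 \<le> M * S" using power_mono[OF jk(1), of 2] assms(2) by linarith
    define v where "v xs = M * (\<Sum>y\<in>Y. (real (count_list xs y))\<^sup>2) - (real (length xs))\<^sup>2" for xs
    have v0: "v xs \<ge> 0" if "set xs \<subseteq> Y" for xs
      using sum_squared_le_sum_of_squares[of "\<lambda>y. real (count_list xs y)" Y] Y sum_count_list[OF Y(1) that]
      by (simp add: v_def card_gt_0_iff mult.commute)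
    have "avg (words Y (Suc j)) (\<lambda>xs. (ratio M S xs)\<^sup>2) =
      avg (words Y j) (\<lambda>xs. (ratio M S xs)\<^sup>2 * avg Y (\<lambda>y. (real M * (real S - count_list xs y) / (real M * real S - length xs))\<^sup>2))"
      using Y by (simp add: avg_words_Suc power_mult_distrib power_divide flip: avg_mult_left)
    also have "\<dots> = avg (words Y j) (\<lambda>xs. (ratio M S xs)\<^sup>2 * (1 + v xs / (N - j)\<^sup>2))"
      by (intro avg_cong refl) (use jN in \<open>auto simp: words_def avg_ratio_step(2) v_def N_def\<close>)
    also have "\<dots> \<le> avg (words Y j) (\<lambda>xs. (ratio M S xs)\<^sup>2 + 4 * (v xs / (N - j)\<^sup>2))"
    proof (rule avg_mono)
      fix xs assume xs: "xs \<in> words Y j"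
      then have "(ratio M S xs)\<^sup>2 \<le> 2\<^sup>2"
        using assms jk j2 by (intro power_mono ratio_le_2 ratio_nonneg) (auto simp: words_def)
      then have "(ratio M S xs)\<^sup>2 * (v xs / (N - j)\<^sup>2) \<le> 4 * (v xs / (N - j)\<^sup>2)"
        using v0[of xs] xs by (intro mult_right_mono) (auto simp: words_def)
      then show "(ratio M S xs)\<^sup>2 * (1 + v xs / (N - j)\<^sup>2) \<le> (ratio M S xs)\<^sup>2 + 4 * (v xs / (N - j)\<^sup>2)"
        by (simp add: distrib_left)
    qed
    also have "\<dots> = avg (words Y j) (\<lambda>xs. (ratio M S xs)\<^sup>2) + 4 * (avg (words Y j) v / (N - j)\<^sup>2)"
      by (simp add: avg_add avg_mult_left avg_divide)
    also have "avg (words Y j) v = M * (j + j * (real j - 1) / M) - (real j)\<^sup>2"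
    proof -
      have "avg (words Y j) v = avg (words Y j) (\<lambda>xs. M * (\<Sum>y\<in>Y. (real (count_list xs y))\<^sup>2) - (real j)\<^sup>2)"
        by (intro avg_cong refl) (auto simp: v_def words_def)
      then show ?thesis
        using finite_words[OF Y(1)] words_ne[OF Y_ne] by (simp add: avg_diff avg_mult_left avg_sum_count_list_square)
    qed
    also have "\<dots> = M * real j - real j"
      using Y by (simp add: field_simps power2_eq_square)
    also have "4 * ((M * real j - real j) / (N - j)\<^sup>2) \<le> e"
    proof -
      have "(M * real j - real j) \<le> M * K"
        using jk Y by (smt (verit, best) mult_left_mono of_nat_0_le_iff)
      moreover have "(N / 2)\<^sup>2 \<le> (N - j)\<^sup>2" using KN jk N0 by (intro power_mono) auto
      ultimately have "(M * real j - real j) / (N - j)\<^sup>2 \<le> M * K / (N / 2)\<^sup>2"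
        using N0 by (intro frac_le) (auto simp: K_def)
      then have "4 * ((M * real j - real j) / (N - j)\<^sup>2) \<le> 4 * (M * K / (N / 2)\<^sup>2)"
        by (intro mult_left_mono) simp_all
      also have "\<dots> = e" by (simp add: e_def power_divide)
      finally show ?thesis .
    qed
    finally show ?case using Suc.IH jk by (simp add: algebra_simps)
  qed simp
  from this[of k] show ?thesis by (simp add: e_def N_def K_def)
qed

text \<open>The average is twice the statistical distance of the two samplings; the Cauchy-Schwarz
  inequality bounds it by the standard deviation of the ratio, whose mean is 1.\<close>

lemma avg_abs_ratio_minus_1:
  assumes "k \<le> S" "k\<^sup>2 \<le> M * S" "2 * k \<le> M * S"
  shows "avg (words Y k) (\<lambda>xs. \<bar>ratio M S xs - 1\<bar>) \<le> sqrt (real k * (16 * real M * real k / (real M * real S)\<^sup>2))"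
proof -
  have "avg (words Y k) (\<lambda>xs. \<bar>ratio M S xs - 1\<bar>\<^sup>2) =
      avg (words Y k) (\<lambda>xs. (ratio M S xs)\<^sup>2 - 2 * ratio M S xs + 1)"
    by (intro avg_cong) (auto simp: power2_eq_square algebra_simps)
  also have "\<dots> = avg (words Y k) (\<lambda>xs. (ratio M S xs)\<^sup>2) - 1"
    using finite_words[OF Y(1)] words_ne[OF Y_ne] assms avg_ratio[of k]
    by (simp add: avg_add avg_diff avg_mult_left)
  also have "\<dots> \<le> real k * (16 * real M * real k / (real M * real S)\<^sup>2)"
    using avg_ratio_square[OF assms] by simp
  finally show ?thesis
    by (intro order_trans[OF avg_le_sqrt]) simp
qed

end

section \<open>The swap-or-not shuffle\<close>

abbreviation tr :: "'a \<Rightarrow> 'a \<Rightarrow> 'a \<Rightarrow> 'a" where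
  "tr \<equiv> Transposition.transpose"

text \<open>The XOR of the coins of both partners decides, so that no representative of the pair has
  to be computed, and a round is an involution as soon as \<open>p\<close> is one.\<close>

definition swap_or_not :: "('v \<Rightarrow> 'v) \<Rightarrow> 'v set \<Rightarrow> 'v set \<Rightarrow> 'v \<Rightarrow> 'v" where
  "swap_or_not p A B x = (if x \<in> A \<and> p x \<in> A \<and> (x \<in> B \<longleftrightarrow> p x \<notin> B) then p x else x)"

text \<open>
  Expectation of \<open>h \<sigma>\<close>, where \<open>\<sigma>\<close> is composed of independent swap-or-not rounds, one for each pair of
  an active set and a set of keys; the head of the list acts first.
\<close>

fun shuffle_avg :: "('k \<Rightarrow> 'v \<Rightarrow> 'v) \<Rightarrow> 'v set \<Rightarrow> ('v set \<times> 'k set) list \<Rightarrow> (('v \<Rightarrow> 'v) \<Rightarrow> real) \<Rightarrow> real" where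
  "shuffle_avg p V [] h = h id"
| "shuffle_avg p V ((A, Ks) # rs) h =
     avg Ks (\<lambda>k. avg (Pow V) (\<lambda>B. shuffle_avg p V rs (\<lambda>\<sigma>. h (\<sigma> \<circ> swap_or_not (p k) A B))))"

lemma shuffle_avg_append:
  "shuffle_avg p V (rs @ rs') h = shuffle_avg p V rs (\<lambda>\<sigma>. shuffle_avg p V rs' (\<lambda>\<tau>. h (\<tau> \<circ> \<sigma>)))"
  by (induction rs arbitrary: h) (auto simp: comp_assoc)

lemma shuffle_avg_avg:
  "shuffle_avg p V rs (\<lambda>\<sigma>. avg I (\<lambda>i. h i \<sigma>)) = avg I (\<lambda>i. shuffle_avg p V rs (h i))"
proof (induction rs arbitrary: h)
  case (Cons r rs)
  obtain A Ks where r: "r = (A, Ks)" by force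
  have "shuffle_avg p V (r # rs) (\<lambda>\<sigma>. avg I (\<lambda>i. h i \<sigma>)) =
    avg Ks (\<lambda>k. avg (Pow V) (\<lambda>B. avg I (\<lambda>i. shuffle_avg p V rs (\<lambda>\<sigma>. h i (\<sigma> \<circ> swap_or_not (p k) A B)))))"
    by (simp add: r Cons.IH)
  also have "\<dots> = avg Ks (\<lambda>k. avg I (\<lambda>i. avg (Pow V) (\<lambda>B. shuffle_avg p V rs (\<lambda>\<sigma>. h i (\<sigma> \<circ> swap_or_not (p k) A B)))))"
    by (intro avg_cong refl) (rule avg_swap)
  also have "\<dots> = avg I (\<lambda>i. avg Ks (\<lambda>k. avg (Pow V) (\<lambda>B. shuffle_avg p V rs (\<lambda>\<sigma>. h i (\<sigma> \<circ> swap_or_not (p k) A B)))))"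
    by (rule avg_swap)
  finally show ?case by (simp add: r)
qed simp

text \<open>A property of all rounds that is closed under composition may be assumed of the shuffled
  permutation.\<close>

lemma shuffle_avg_cong:
  assumes "P id" "\<And>\<sigma> \<tau>. P \<sigma> \<Longrightarrow> P \<tau> \<Longrightarrow> P (\<sigma> \<circ> \<tau>)"
    and "\<And>A Ks k B. (A, Ks) \<in> set rs \<Longrightarrow> k \<in> Ks \<Longrightarrow> B \<subseteq> V \<Longrightarrow> P (swap_or_not (p k) A B)"
    and "\<And>\<sigma>. P \<sigma> \<Longrightarrow> h \<sigma> = h' \<sigma>"
  shows "shuffle_avg p V rs h = shuffle_avg p V rs h'"
  using assms(3,4)
proof (induction rs arbitrary: h h')
  case Nil
  then show ?case using assms(1) by simp
next
  case (Cons r rs)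
  obtain A Ks where r: "r = (A, Ks)" by force
  show ?case unfolding r shuffle_avg.simps
  proof (intro avg_cong refl Cons.IH)
    fix k B assume kB: "k \<in> Ks" "B \<in> Pow V"
    show "h (\<sigma> \<circ> swap_or_not (p k) A B) = h' (\<sigma> \<circ> swap_or_not (p k) A B)" if "P \<sigma>" for \<sigma>
      using kB by (intro Cons.prems(2) assms(2) that Cons.prems(1)) (auto simp: r)
  qed (rule Cons.prems(1), auto)
qed

lemma swap_or_not_involution:
  assumes "p (p x) = x"
  shows "swap_or_not p A B (swap_or_not p A B x) = x"
  using assms by (auto simp: swap_or_not_def)

section \<open>Young subgroups: permutations that preserve blocks\<close>

definition block_perms :: "('v \<Rightarrow> 'b) \<Rightarrow> 'v set \<Rightarrow> ('v \<Rightarrow> 'v) set" where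
  "block_perms blk D = {\<sigma>. \<sigma> permutes D \<and> (\<forall>x. blk (\<sigma> x) = blk x)}"

lemma finite_block_perms: "finite D \<Longrightarrow> finite (block_perms blk D)"
  by (rule finite_subset[OF _ finite_permutations]) (auto simp: block_perms_def)

lemma id_block_perms [simp]: "id \<in> block_perms blk D"
  by (auto simp: block_perms_def permutes_id)

lemma block_perms_ne [simp]: "block_perms blk D \<noteq> {}"
  using id_block_perms by blast

lemma comp_block_perms:
  "\<sigma> \<in> block_perms blk D \<Longrightarrow> \<tau> \<in> block_perms blk D \<Longrightarrow> \<sigma> \<circ> \<tau> \<in> block_perms blk D"
  by (auto simp: block_perms_def permutes_compose)

lemma block_perms_mono: "D \<subseteq> D' \<Longrightarrow> block_perms blk D \<subseteq> block_perms blk D'"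
  by (auto simp: block_perms_def intro: permutes_subset)

lemma inv_block_perms: "\<sigma> \<in> block_perms blk D \<Longrightarrow> inv \<sigma> \<in> block_perms blk D"
  unfolding block_perms_def by (auto intro: permutes_inv) (metis permutes_inverses(1))

lemma transpose_block_perms:
  "x \<in> D \<Longrightarrow> a \<in> D \<Longrightarrow> blk x = blk a \<Longrightarrow> tr x a \<in> block_perms blk D"
  by (auto simp: block_perms_def permutes_swap_id Transposition.transpose_def)

lemma block_perms_left_bij:
  assumes "\<sigma> \<in> block_perms blk D"
  shows "bij_betw (\<lambda>\<pi>. \<sigma> \<circ> \<pi>) (block_perms blk D) (block_perms blk D)"
proof (rule bij_betw_byWitness[where f' = "\<lambda>\<pi>. inv \<sigma> \<circ> \<pi>"])
  have "\<sigma> permutes D" using assms by (simp add: block_perms_def)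
  then show "\<forall>\<pi>\<in>block_perms blk D. inv \<sigma> \<circ> (\<sigma> \<circ> \<pi>) = \<pi>" "\<forall>\<pi>\<in>block_perms blk D. \<sigma> \<circ> (inv \<sigma> \<circ> \<pi>) = \<pi>"
    by (simp_all add: comp_assoc[symmetric] permutes_inv_o)
qed (use comp_block_perms[OF assms] comp_block_perms[OF inv_block_perms[OF assms]] in auto)

text \<open>One step of a Fisher-Yates shuffle: the transpositions of \<open>x\<close> with the
  points of its block represent the cosets of the stabilizer of \<open>x\<close>, the coset of a
  permutation being determined by the image of \<open>x\<close>.\<close>

lemma block_perms_insert_bij:
  fixes x :: 'v
  assumes x: "x \<notin> D" and S: "S = {a \<in> insert x D. blk a = blk x}"
  shows "bij_betw (\<lambda>(a, \<pi>). tr x a \<circ> \<pi>) (S \<times> block_perms blk D) (block_perms blk (insert x D))"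
proof (rule bij_betw_byWitness[where f' = "\<lambda>\<pi>. (\<pi> x, tr x (\<pi> x) \<circ> \<pi>)"])
  have px: "\<pi> x = x" if "\<pi> \<in> block_perms blk D" for \<pi>
    using that x permutes_not_in by (fastforce simp: block_perms_def)
  show "\<forall>q\<in>S \<times> block_perms blk D. (\<lambda>\<pi>. (\<pi> x, tr x (\<pi> x) \<circ> \<pi>)) ((\<lambda>(a, \<pi>). tr x a \<circ> \<pi>) q) = q"
  proof
    fix q assume "q \<in> S \<times> block_perms blk D"
    then obtain a \<pi> where q: "q = (a, \<pi>)" and "\<pi> \<in> block_perms blk D" by auto
    from px[OF this(2)]
    show "(\<lambda>\<pi>. (\<pi> x, tr x (\<pi> x) \<circ> \<pi>)) ((\<lambda>(a, \<pi>). tr x a \<circ> \<pi>) q) = q"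
      by (simp add: q fun_eq_iff)
  qed
  show "(\<lambda>(a, \<pi>). tr x a \<circ> \<pi>) ` (S \<times> block_perms blk D) \<subseteq> block_perms blk (insert x D)"
    using block_perms_mono[of D "insert x D" blk] S
    by (auto intro!: comp_block_perms transpose_block_perms)
  show "(\<lambda>\<pi>. (\<pi> x, tr x (\<pi> x) \<circ> \<pi>)) ` block_perms blk (insert x D) \<subseteq> S \<times> block_perms blk D"
  proof clarify
    fix \<pi> assume \<pi>: "\<pi> \<in> block_perms blk (insert x D)"
    then have pi: "\<pi> permutes insert x D" "\<And>y. blk (\<pi> y) = blk y" by (auto simp: block_perms_def)
    have "\<pi> x \<in> insert x D" using permutes_in_image[OF pi(1)] by blast
    then have 1: "\<pi> x \<in> S" using S pi(2) by auto
    then have "tr x (\<pi> x) \<circ> \<pi> \<in> block_perms blk (insert x D)"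
      using \<pi> S by (intro comp_block_perms transpose_block_perms) auto
    moreover have "(tr x (\<pi> x) \<circ> \<pi>) x = x" by simp
    moreover have "\<sigma> permutes D" if "\<sigma> permutes insert x D" "\<sigma> x = x" for \<sigma>
      using that unfolding permutes_def by (metis insert_iff)
    ultimately have "tr x (\<pi> x) \<circ> \<pi> \<in> block_perms blk D"
      unfolding block_perms_def by blast
    with 1 show "\<pi> x \<in> S \<and> tr x (\<pi> x) \<circ> \<pi> \<in> block_perms blk D" by simp
  qed
qed (auto simp: comp_assoc[symmetric])

text \<open>Every key acts as an involution, and exactly one key joins two given active points of a
  block, so a random key hits all possible partners equally often. \<open>H k\<close> contains one
  point of every two-element orbit of the key; it serves to choose the coin to be
  complemented.\<close>

locale shuffle =
  fixes p :: "'k \<Rightarrow> 'v \<Rightarrow> 'v" and V A :: "'v set" and Ks :: "'k set" and blk :: "'v \<Rightarrow> 'b"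
    and H :: "'k \<Rightarrow> 'v set"
  assumes V: "finite V" and A: "A \<subseteq> V" and Ks: "finite Ks" "Ks \<noteq> {}"
    and inv: "\<And>k x. p k (p k x) = x"
    and blk: "\<And>k x. k \<in> Ks \<Longrightarrow> blk (p k x) = blk x"
    and pivot: "\<And>k z. p k z \<noteq> z \<Longrightarrow> (z \<in> H k) \<noteq> (p k z \<in> H k)"
    and trans: "\<And>x y. x \<in> A \<Longrightarrow> y \<in> A \<Longrightarrow> blk x = blk y \<Longrightarrow> \<exists>!k. k \<in> Ks \<and> p k x = y"
begin

abbreviation "R k B \<equiv> swap_or_not (p k) A B"

lemma R_R [simp]: "R k B (R k B x) = x"
  by (rule swap_or_not_involution) (rule inv)

lemma bij_R: "bij (R k B)"
  by (rule o_bij[of "R k B"]) auto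

lemma R_in_A: "x \<in> A \<Longrightarrow> R k B x \<in> A"
  by (simp add: swap_or_not_def)

lemma R_not_A: "x \<notin> A \<Longrightarrow> R k B x = x"
  by (simp add: swap_or_not_def)

lemma R_blk: "k \<in> Ks \<Longrightarrow> blk (R k B x) = blk x"
  by (simp add: swap_or_not_def blk)

lemma R_permutes: "R k B permutes A"
  unfolding permutes_def using R_not_A R_R by metis

lemma transpose_comp:
  assumes "bij f" shows "f \<circ> tr x a = tr (f x) (f a) \<circ> f"
  using assms by (auto simp: fun_eq_iff Transposition.transpose_def bij_def inj_eq)

definition flip :: "'v set \<Rightarrow> 'k \<Rightarrow> 'v \<Rightarrow> 'v" where
  "flip S k z = (if z \<in> S \<and> p k z \<in> S then p k z else z)"

lemma flip_flip [simp]: "flip S k (flip S k z) = z"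
  by (auto simp: flip_def inv)

lemma flip_in [simp]: "flip S k z \<in> S \<longleftrightarrow> z \<in> S"
  by (auto simp: flip_def)

lemma flip_bij: "bij_betw (flip S k) S S"
  by (rule bij_betw_byWitness[where f' = "flip S k"]) auto

text \<open>For a fixed point \<open>a\<close>, each partner in \<open>S\<close> is reached by one
  key, and all other keys leave the weight of \<open>a\<close> as it is. Averaging the weights over
  all pairs in \<open>S\<close> halves the squared norm, since the mixed terms cancel by
  \<open>sum w S = 0\<close>. So the fraction \<open>card S / card Ks\<close> of the norm is
  halved.\<close>

lemma key_norm:
  assumes S: "S \<subseteq> A" "\<And>a. a \<in> S \<Longrightarrow> blk a = \<beta>" and w: "sum w S = 0" and ne: "S \<noteq> {}"
  shows "avg Ks (\<lambda>k. \<Sum>a\<in>S. ((w a + w (flip S k a)) / 2)\<^sup>2) =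
    (1 - card S / (2 * real (card Ks))) * (\<Sum>a\<in>S. (w a)\<^sup>2)"
proof -
  have fS: "finite S" using S A V finite_subset by metis
  have per: "(\<Sum>k\<in>Ks. ((w a + w (flip S k a)) / 2)\<^sup>2) =
      (real (card Ks) - card S) * (w a)\<^sup>2 + (\<Sum>a'\<in>S. ((w a + w a') / 2)\<^sup>2)" if a: "a \<in> S" for a
  proof -
    define K1 where "K1 = {k \<in> Ks. p k a \<in> S}"
    have bij: "bij_betw (\<lambda>k. p k a) K1 S"
    proof (rule bij_betw_imageI)
      show "inj_on (\<lambda>k. p k a) K1"
        using trans[of a] S a unfolding K1_def inj_on_def by (metis (mono_tags, lifting) mem_Collect_eq subsetD)
      show "(\<lambda>k. p k a) ` K1 = S"
      proof
        show "S \<subseteq> (\<lambda>k. p k a) ` K1"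
        proof
          fix y assume "y \<in> S"
          then obtain k where "k \<in> Ks" "p k a = y" using trans[of a y] S a by (metis subsetD)
          with \<open>y \<in> S\<close> show "y \<in> (\<lambda>k. p k a) ` K1" by (auto simp: K1_def)
        qed
      qed (auto simp: K1_def)
    qed
    have K1: "K1 \<subseteq> Ks" "finite K1" using Ks by (auto simp: K1_def)
    have "(\<Sum>k\<in>Ks. ((w a + w (flip S k a)) / 2)\<^sup>2) =
        (\<Sum>k\<in>Ks - K1. ((w a + w (flip S k a)) / 2)\<^sup>2) + (\<Sum>k\<in>K1. ((w a + w (flip S k a)) / 2)\<^sup>2)"
      using K1 Ks by (intro sum.subset_diff) auto
    also have "(\<Sum>k\<in>Ks - K1. ((w a + w (flip S k a)) / 2)\<^sup>2) = (\<Sum>k\<in>Ks - K1. (w a)\<^sup>2)"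
      by (intro sum.cong) (auto simp: flip_def K1_def)
    also have "\<dots> = (real (card Ks) - card S) * (w a)\<^sup>2"
      using K1 bij_betw_same_card[OF bij] card_mono[OF Ks(1) K1(1)] by (simp add: card_Diff_subset of_nat_diff)
    also have "(\<Sum>k\<in>K1. ((w a + w (flip S k a)) / 2)\<^sup>2) = (\<Sum>k\<in>K1. ((w a + w (p k a)) / 2)\<^sup>2)"
      using a by (intro sum.cong) (auto simp: flip_def K1_def)
    also have "\<dots> = (\<Sum>a'\<in>S. ((w a + w a') / 2)\<^sup>2)"
      using bij by (rule sum.reindex_bij_betw)
    finally show ?thesis .
  qed
  define W where "W = (\<Sum>a\<in>S. (w a)\<^sup>2)"
  have "(\<Sum>a\<in>S. \<Sum>a'\<in>S. ((w a + w a') / 2)\<^sup>2) =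
      (\<Sum>a\<in>S. \<Sum>a'\<in>S. (w a)\<^sup>2 / 4 + (w a')\<^sup>2 / 4 + w a * w a' / 2)"
    by (intro sum.cong refl) (simp add: power2_eq_square field_simps)
  also have "\<dots> = card S * W / 2"
    using w by (simp add: sum.distrib W_def sum_distrib_left[symmetric] sum_divide_distrib[symmetric] mult.commute)
  finally have pairs: "(\<Sum>a\<in>S. \<Sum>a'\<in>S. ((w a + w a') / 2)\<^sup>2) = card S * W / 2" .
  have "(\<Sum>k\<in>Ks. \<Sum>a\<in>S. ((w a + w (flip S k a)) / 2)\<^sup>2) =
      (\<Sum>a\<in>S. \<Sum>k\<in>Ks. ((w a + w (flip S k a)) / 2)\<^sup>2)"
    by (rule sum.swap)
  also have "\<dots> = (real (card Ks) - card S) * W + card S * W / 2"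
    by (simp add: per sum.distrib pairs W_def flip: sum_distrib_left)
  also have "\<dots> = real (card Ks) * W - card S * W / 2"
    by (simp add: algebra_simps)
  finally have "(\<Sum>k\<in>Ks. \<Sum>a\<in>S. ((w a + w (flip S k a)) / 2)\<^sup>2) = \<dots>" .
  moreover have "card Ks > 0"
    using Ks by (simp add: card_gt_0_iff)
  ultimately show ?thesis
    unfolding avg_def W_def[symmetric] by (simp add: field_simps)
qed

lemma card_block_le:
  assumes S: "S \<subseteq> A" "\<And>a. a \<in> S \<Longrightarrow> blk a = \<beta>" and x: "x \<in> S"
  shows "card S \<le> card Ks"
proof -
  define f where "f c = (THE k. k \<in> Ks \<and> p k x = c)" for c
  have f: "f c \<in> Ks" "p (f c) x = c" if "c \<in> S" for c
    using theI'[OF trans[of x c]] that assms unfolding f_def by auto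
  have "inj_on f S" by (rule inj_onI) (metis f(2))
  then have "card S = card (f ` S)" by (simp add: card_image)
  also have "\<dots> \<le> card Ks"
    using f Ks by (intro card_mono) auto
  finally show ?thesis .
qed

text \<open>
  Complementing one coin of every pair inside \<open>S\<close> composes the round with the exchange of these
  pairs, and it preserves the uniform distribution of the coins.
\<close>

lemma avg_coins_flip:
  assumes S: "S \<subseteq> A"
  shows "avg (Pow V) (\<lambda>B. h (R k B)) = avg (Pow V) (\<lambda>B. h (R k B \<circ> flip S k))"
proof -
  define M where "M = {z \<in> S. p k z \<in> S \<and> p k z \<noteq> z \<and> z \<in> H k}"
  have M: "M \<subseteq> V" using S A by (auto simp: M_def)
  have "bij_betw (\<lambda>B. (B - M) \<union> (M - B)) (Pow V) (Pow V)"
    by (rule bij_betw_byWitness[where f' = "\<lambda>B. (B - M) \<union> (M - B)"]) (use M in auto)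
  then have "avg (Pow V) (\<lambda>B. h (R k B)) = avg (Pow V) (\<lambda>B. h (R k ((B - M) \<union> (M - B))))"
    by (rule avg_bij_betw)
  also have "\<dots> = avg (Pow V) (\<lambda>B. h (R k B \<circ> flip S k))"
  proof (intro avg_cong refl arg_cong[where f = h] ext)
    fix B z
    have 1: "z \<in> M \<longleftrightarrow> p k z \<notin> M" if "z \<in> S" "p k z \<in> S" "p k z \<noteq> z"
      using that pivot[of k z] inv by (auto simp: M_def)
    have 2: "z \<notin> M" "p k z \<notin> M" if "\<not> (z \<in> S \<and> p k z \<in> S \<and> p k z \<noteq> z)"
      using that inv by (auto simp: M_def)
    show "R k ((B - M) \<union> (M - B)) z = (R k B \<circ> flip S k) z"
    proof (cases "z \<in> S \<and> p k z \<in> S \<and> p k z \<noteq> z")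
      case True
      with 1 S inv show ?thesis
        by (auto simp: swap_or_not_def flip_def)
    next
      case False
      then have "flip S k z = z" by (auto simp: flip_def)
      with 2[OF False] show ?thesis by (simp add: swap_or_not_def)
    qed
  qed
  finally show ?thesis .
qed

text \<open>Both permutations agree at \<open>x\<close>, where they take the value of
  \<open>\<sigma>\<close> at \<open>flip S k a\<close>, and outside \<open>S\<close>. Hence they
  differ by a permutation of \<open>S - {x}\<close> acting first, to which \<open>h\<close> is
  blind.\<close>

lemma flip_transpose_invariant:
  assumes h: "\<And>\<sigma> \<pi>. \<pi> permutes S - {x} \<Longrightarrow> h (\<sigma> \<circ> \<pi>) = (h \<sigma> :: real)" and x: "x \<in> S" and a: "a \<in> S"
  shows "h (\<sigma> \<circ> flip S k \<circ> tr x a) = h (\<sigma> \<circ> tr x (flip S k a))"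
proof -
  define \<pi> where "\<pi> = tr x (flip S k a) \<circ> flip S k \<circ> tr x a"
  have "\<pi> permutes S"
    unfolding \<pi>_def
  proof (intro permutes_compose permutes_swap_id x a)
    show "flip S k permutes S"
      unfolding permutes_def by (metis flip_flip flip_def)
  qed (simp add: a)
  moreover have "\<pi> x = x" by (simp add: \<pi>_def)
  ultimately have "\<pi> permutes S - {x}"
    by (auto simp: permutes_def)
  moreover have "\<sigma> \<circ> flip S k \<circ> tr x a = (\<sigma> \<circ> tr x (flip S k a)) \<circ> \<pi>"
    by (simp add: \<pi>_def fun_eq_iff)
  ultimately show ?thesis using h by metis
qed

text \<open>
  The point \<open>x\<close> is the next one to be placed, and \<open>S\<close> holds \<open>x\<close> and the points about whose images
  nothing is known. By \<open>avg_coins_flip\<close>, one round replaces the weights \<open>w\<close> by their means over the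
  pairs inside \<open>S\<close>, and by \<open>key_norm\<close> this contracts the expected square norm by the factor \<open>\<rho>\<close>.
\<close>

lemma shuffle_contraction:
  fixes m :: nat
  defines "\<rho> \<equiv> 1 - real m / (2 * real (card Ks))"
  assumes "S \<subseteq> A" "\<And>a. a \<in> S \<Longrightarrow> blk a = \<beta>" "card S = m" "x \<in> S" "sum w S = 0"
    and "\<And>\<sigma>. \<bar>h \<sigma>\<bar> \<le> 1" "\<And>\<sigma> \<pi>. \<pi> permutes S - {x} \<Longrightarrow> h (\<sigma> \<circ> \<pi>) = h \<sigma>"
  shows "\<bar>\<Sum>a\<in>S. w a * shuffle_avg p V (replicate t (A, Ks)) (\<lambda>\<sigma>. h (\<sigma> \<circ> tr x a))\<bar>
    \<le> sqrt m * sqrt \<rho> ^ t * sqrt (\<Sum>a\<in>S. (w a)\<^sup>2)"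
  using assms(2-)
proof (induction t arbitrary: S x w h)
  case 0
  have fS: "finite S" using 0 A V finite_subset by metis
  have "\<bar>\<Sum>a\<in>S. w a * h (tr x a)\<bar> \<le> (\<Sum>a\<in>S. \<bar>w a * h (tr x a)\<bar>)" by (rule sum_abs)
  also have "\<dots> \<le> (\<Sum>a\<in>S. \<bar>w a\<bar>)"
    using 0 by (intro sum_mono) (simp add: abs_mult mult_left_le)
  \<comment> \<open>Cauchy-Schwarz over the \<open>m\<close> weights is the origin of the factor
    \<open>sqrt m\<close>.\<close>
  also have "\<dots> \<le> sqrt (real m * (\<Sum>a\<in>S. (w a)\<^sup>2))"
    using sum_squared_le_sum_of_squares[of "\<lambda>a. \<bar>w a\<bar>" S] 0(3) fS
    by (intro real_le_rsqrt) (auto simp: mult.commute)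
  finally show ?case by (simp add: real_sqrt_mult)
next
  case (Suc t)
  let ?E = "shuffle_avg p V (replicate t (A, Ks))"
  define w' where "w' k a = (w a + w (flip S k a)) / 2" for k a
  have ne: "S \<noteq> {}" using Suc by auto
  have fS: "finite S" using Suc A V finite_subset by metis
  \<comment> \<open>Moving the first round past the transposition carries \<open>S\<close>,
    \<open>x\<close>, the weights and the invariance of \<open>h\<close> to their images under the
    round. The induction hypothesis is applied there, which is why it has to be general in all of
    them.\<close>
  have conj: "\<bar>\<Sum>a\<in>S. u a * ?E (\<lambda>\<sigma>. h (\<sigma> \<circ> R k B \<circ> tr x a))\<bar>
      \<le> sqrt m * sqrt \<rho> ^ t * sqrt (\<Sum>a\<in>S. (u a)\<^sup>2)" if k: "k \<in> Ks" and u: "sum u S = 0" for k B u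
  proof -
    let ?R = "R k B"
    have bR: "bij_betw ?R S (?R ` S)" by (intro bij_betw_imageI inj_onI) (auto dest: arg_cong[of _ _ ?R])
    have re: "(\<Sum>a\<in>?R ` S. g (?R a)) = (\<Sum>a\<in>S. g a)" for g :: "'v \<Rightarrow> real"
      using sum.reindex_bij_betw[OF bR, of "\<lambda>a. g (?R a)"] by simp
    have *: "\<bar>\<Sum>a\<in>?R ` S. u (?R a) * ?E (\<lambda>\<sigma>. h (\<sigma> \<circ> tr (?R x) a \<circ> ?R))\<bar>
      \<le> sqrt m * sqrt \<rho> ^ t * sqrt (\<Sum>a\<in>?R ` S. (u (?R a))\<^sup>2)"
    proof (rule Suc.IH)
      show "?R ` S \<subseteq> A" using Suc.prems(1) R_in_A by auto
      show "blk a = \<beta>" if "a \<in> ?R ` S" for a using that Suc.prems(2) R_blk[OF k] by auto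
      show "card (?R ` S) = m" using Suc.prems(3) bij_betw_same_card[OF bR] by simp
      show "?R x \<in> ?R ` S" using Suc.prems by simp
      show "(\<Sum>a\<in>?R ` S. u (?R a)) = 0" using re[of u] u by simp
      fix \<sigma> \<pi> assume \<pi>: "\<pi> permutes ?R ` S - {?R x}"
      have "?R \<circ> \<pi> \<circ> ?R permutes S - {x}"
        unfolding permutes_def
      proof (intro conjI allI impI)
        fix z assume "z \<notin> S - {x}"
        then have "?R z \<notin> ?R ` S - {?R x}" using bij_is_inj[OF bij_R[of k B]] by (auto simp: inj_eq)
        then have "\<pi> (?R z) = ?R z" by (rule permutes_not_in[OF \<pi>])
        then show "(?R \<circ> \<pi> \<circ> ?R) z = z" by simp
      next
        fix y
        have "bij (?R \<circ> \<pi> \<circ> ?R)" using bij_R permutes_bij[OF \<pi>] by (intro bij_comp)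
        then show "\<exists>!z. (?R \<circ> \<pi> \<circ> ?R) z = y" unfolding bij_iff by blast
      qed
      then have "h ((\<sigma> \<circ> ?R) \<circ> (?R \<circ> \<pi> \<circ> ?R)) = h (\<sigma> \<circ> ?R)" by (rule Suc.prems(7))
      then show "h (\<sigma> \<circ> \<pi> \<circ> ?R) = h (\<sigma> \<circ> ?R)" by (simp add: comp_def)
    qed (rule Suc.prems(6))
    have "tr (?R x) (?R a) \<circ> ?R = ?R \<circ> tr x a" for a
      by (rule transpose_comp[symmetric]) (rule bij_R)
    then have eq: "h (\<sigma> \<circ> tr (?R x) (?R a) \<circ> ?R) = h (\<sigma> \<circ> ?R \<circ> tr x a)" for \<sigma> a
      by (metis comp_assoc)
    show ?thesis
      using * re[of "\<lambda>a. u a * ?E (\<lambda>\<sigma>. h (\<sigma> \<circ> tr (?R x) (?R a) \<circ> ?R))"] re[of "\<lambda>a. (u a)\<^sup>2"]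
      by (simp add: eq)
  qed
  \<comment> \<open>The sum is written once as it stands and once with the pairs inside
    \<open>S\<close> exchanged; the mean of both forms has the averaged weights.\<close>
  have per: "(\<Sum>a\<in>S. w a * avg (Pow V) (\<lambda>B. ?E (\<lambda>\<sigma>. h (\<sigma> \<circ> R k B \<circ> tr x a)))) =
      avg (Pow V) (\<lambda>B. \<Sum>a\<in>S. w' k a * ?E (\<lambda>\<sigma>. h (\<sigma> \<circ> R k B \<circ> tr x a)))" for k
  proof -
    define g where "g \<rho> a = ?E (\<lambda>\<sigma>. h (\<sigma> \<circ> \<rho> \<circ> tr x a))" for \<rho> a
    have "(\<Sum>a\<in>S. w a * avg (Pow V) (\<lambda>B. g (R k B) a)) = avg (Pow V) (\<lambda>B. \<Sum>a\<in>S. w a * g (R k B) a)"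
      by (simp add: avg_sum flip: avg_mult_left)
    moreover have "(\<Sum>a\<in>S. w a * avg (Pow V) (\<lambda>B. g (R k B) a)) =
      avg (Pow V) (\<lambda>B. \<Sum>a\<in>S. w (flip S k a) * g (R k B) a)"
    proof -
      have "(\<Sum>a\<in>S. w a * avg (Pow V) (\<lambda>B. g (R k B) a)) =
          (\<Sum>a\<in>S. w a * avg (Pow V) (\<lambda>B. g (R k B \<circ> flip S k) a))"
        using avg_coins_flip[OF Suc.prems(1), of "\<lambda>\<rho>. g \<rho> a" for a] by simp
      also have "\<dots> = (\<Sum>a\<in>S. w a * avg (Pow V) (\<lambda>B. g (R k B) (flip S k a)))"
      proof (rule sum.cong[OF refl])
        fix a assume "a \<in> S"
        then have "h (\<sigma> \<circ> R k B \<circ> flip S k \<circ> tr x a) = h (\<sigma> \<circ> R k B \<circ> tr x (flip S k a))" for \<sigma> B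
          by (intro flip_transpose_invariant Suc.prems(4,7))
        then show "w a * avg (Pow V) (\<lambda>B. g (R k B \<circ> flip S k) a) =
            w a * avg (Pow V) (\<lambda>B. g (R k B) (flip S k a))"
          by (simp add: g_def comp_assoc)
      qed
      also have "\<dots> = (\<Sum>a\<in>S. w (flip S k a) * avg (Pow V) (\<lambda>B. g (R k B) a))"
        using sum.reindex_bij_betw[OF flip_bij[of S k], of "\<lambda>a. w (flip S k a) * avg (Pow V) (\<lambda>B. g (R k B) a)"]
        by simp
      also have "\<dots> = avg (Pow V) (\<lambda>B. \<Sum>a\<in>S. w (flip S k a) * g (R k B) a)"
        by (simp add: avg_sum flip: avg_mult_left)
      finally show ?thesis .
    qed
    ultimately have "2 * (\<Sum>a\<in>S. w a * avg (Pow V) (\<lambda>B. g (R k B) a)) =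
       avg (Pow V) (\<lambda>B. \<Sum>a\<in>S. (w a + w (flip S k a)) * g (R k B) a)"
      by (simp add: distrib_right sum.distrib avg_add)
    also have "\<dots> = 2 * avg (Pow V) (\<lambda>B. \<Sum>a\<in>S. w' k a * g (R k B) a)"
      by (simp add: w'_def sum_distrib_left flip: avg_mult_left)
    finally show ?thesis by (simp add: g_def)
  qed
  have w'0: "sum (w' k) S = 0" for k
    using sum.reindex_bij_betw[OF flip_bij[of S k], of w] Suc.prems(5)
    by (simp add: w'_def sum.distrib flip: sum_divide_distrib)
  have unf: "(\<Sum>a\<in>S. w a * shuffle_avg p V (replicate (Suc t) (A, Ks)) (\<lambda>\<sigma>. h (\<sigma> \<circ> tr x a))) =
     avg Ks (\<lambda>k. \<Sum>a\<in>S. w a * avg (Pow V) (\<lambda>B. ?E (\<lambda>\<sigma>. h (\<sigma> \<circ> R k B \<circ> tr x a))))"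
    by (simp add: avg_sum flip: avg_mult_left)
  have "\<bar>\<Sum>a\<in>S. w a * shuffle_avg p V (replicate (Suc t) (A, Ks)) (\<lambda>\<sigma>. h (\<sigma> \<circ> tr x a))\<bar> \<le>
      avg Ks (\<lambda>k. \<bar>\<Sum>a\<in>S. w a * avg (Pow V) (\<lambda>B. ?E (\<lambda>\<sigma>. h (\<sigma> \<circ> R k B \<circ> tr x a)))\<bar>)"
    unfolding unf by (rule avg_abs_le)
  also have "\<dots> \<le> avg Ks (\<lambda>k. sqrt m * sqrt \<rho> ^ t * sqrt (\<Sum>a\<in>S. (w' k a)\<^sup>2))"
    unfolding per
  proof (intro avg_mono avg_abs_le_bound conj w'0)
    show "0 \<le> sqrt m * sqrt \<rho> ^ t * sqrt (\<Sum>a\<in>S. (w' k a)\<^sup>2)" if "k \<in> Ks" for k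
      using order_trans[OF abs_ge_zero conj[OF that w'0]] .
  qed
  also have "\<dots> = sqrt m * sqrt \<rho> ^ t * avg Ks (\<lambda>k. sqrt (\<Sum>a\<in>S. (w' k a)\<^sup>2))"
    by (rule avg_mult_left)
  also have "\<dots> \<le> sqrt m * sqrt \<rho> ^ t * sqrt (\<rho> * (\<Sum>a\<in>S. (w a)\<^sup>2))"
  proof (rule mult_left_mono)
    have "avg Ks (\<lambda>k. (sqrt (\<Sum>a\<in>S. (w' k a)\<^sup>2))\<^sup>2) = \<rho> * (\<Sum>a\<in>S. (w a)\<^sup>2)"
      using key_norm[OF Suc.prems(1,2,5) ne] Suc.prems(3) by (simp add: w'_def \<rho>_def sum_nonneg)
    then show "avg Ks (\<lambda>k. sqrt (\<Sum>a\<in>S. (w' k a)\<^sup>2)) \<le> sqrt (\<rho> * (\<Sum>a\<in>S. (w a)\<^sup>2))"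
      using avg_le_sqrt by metis
    have "m \<le> card Ks"
      using card_block_le[OF Suc.prems(1,2)] Suc.prems(3,4) by blast
    then have "\<rho> \<ge> 0" by (cases "card Ks = 0") (auto simp: \<rho>_def field_simps)
    then show "0 \<le> sqrt m * sqrt \<rho> ^ t" by simp
  qed
  also have "\<dots> = sqrt m * sqrt \<rho> ^ Suc t * sqrt (\<Sum>a\<in>S. (w a)\<^sup>2)"
    by (simp add: real_sqrt_mult)
  finally show ?case .
qed

abbreviation "Av D h \<sigma> \<equiv> avg (block_perms blk D) (\<lambda>\<pi>. h (\<sigma> \<circ> \<pi>))"

text \<open>With \<open>D\<close> already uniform, only the image of \<open>x\<close> is missing.
  Full uniformity on \<open>insert x D\<close> is the mean over \<open>a\<close> in the block of
  \<open>x\<close> of \<open>D\<close>-uniformity after \<open>tr x a\<close>, so the difference has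
  the weights \<open>w\<close>, the point mass at \<open>x\<close> minus the uniform distribution:
  their sum is 0 and their norm at most 1. By \<open>big\<close>, the factor of one round is at most
  \<open>sqrt (1 - 1 / 8)\<close>.\<close>

lemma shuffle_insert:
  assumes D: "D \<subseteq> A" and x: "x \<in> A" "x \<notin> D" and h: "\<And>\<sigma>. \<bar>h \<sigma>\<bar> \<le> 1"
    and big: "card Ks \<le> 4 * card {a \<in> insert x D. blk a = blk x}"
  shows "\<bar>shuffle_avg p V (replicate t (A, Ks)) (Av D h) - shuffle_avg p V (replicate t (A, Ks)) (Av (insert x D) h)\<bar>
    \<le> sqrt (card V) * sqrt (7 / 8) ^ t"
proof -
  let ?E = "shuffle_avg p V (replicate t (A, Ks))"
  define S where "S = {a \<in> insert x D. blk a = blk x}"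
  define m where "m = card S"
  have SA: "S \<subseteq> A" using D x by (auto simp: S_def)
  have fS: "finite S" using SA A V finite_subset by metis
  have xS: "x \<in> S" by (simp add: S_def)
  have m0: "m > 0" using fS xS by (auto simp: m_def card_gt_0_iff)
  have Av1: "\<bar>Av D h \<sigma>\<bar> \<le> 1" for \<sigma>
    using h by (intro avg_abs_le_bound) auto
  \<comment> \<open>A permutation of \<open>S - {x}\<close> moves only points of \<open>D\<close>
    within a single block, and the average over all such permutations of \<open>D\<close> absorbs
    it.\<close>
  have Av_inv: "Av D h (\<sigma> \<circ> \<pi>) = Av D h \<sigma>" if "\<pi> permutes S - {x}" for \<sigma> \<pi>
  proof -
    have sub: "S - {x} \<subseteq> D" by (auto simp: S_def)
    have "blk (\<pi> y) = blk y" for y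
    proof (cases "y \<in> S - {x}")
      case True
      then have "\<pi> y \<in> S - {x}" using permutes_in_image[OF that] by blast
      with True show ?thesis by (auto simp: S_def)
    next
      case False
      then show ?thesis using permutes_not_in[OF that] by simp
    qed
    then have "\<pi> \<in> block_perms blk D"
      using permutes_subset[OF that sub] by (simp add: block_perms_def)
    from avg_bij_betw[OF block_perms_left_bij[OF this], of "\<lambda>\<pi>'. h (\<sigma> \<circ> \<pi>')"]
    show ?thesis by (simp add: comp_assoc)
  qed
  have AvI: "Av (insert x D) h = (\<lambda>\<sigma>. avg S (\<lambda>a. Av D h (\<sigma> \<circ> tr x a)))"
    using avg_bij_betw[OF block_perms_insert_bij[OF x(2) S_def]] by (simp add: avg_Times comp_assoc fun_eq_iff)
  define w where "w a = of_bool (a = x) - 1 / real m" for a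
  have w0: "sum w S = 0"
    using fS xS m0 by (simp add: w_def sum_subtractf m_def[symmetric])
  have "(\<Sum>a\<in>S. (w a)\<^sup>2) = (\<Sum>a\<in>S. of_bool (a = x) * (1 - 2 / m) + (1 / m)\<^sup>2)"
    by (intro sum.cong) (auto simp: w_def power2_eq_square algebra_simps)
  also have "\<dots> = 1 - 1 / m"
    using fS xS m0 by (simp add: sum.distrib m_def[symmetric] power2_eq_square flip: sum_distrib_right)
  also have "\<dots> \<le> 1" by simp
  finally have w2: "sqrt (\<Sum>a\<in>S. (w a)\<^sup>2) \<le> 1" by simp
  have mKs: "m / (2 * real (card Ks)) \<ge> 1 / 8"
  proof -
    have "card Ks > 0" using Ks by (simp add: card_gt_0_iff)
    moreover have "real (card Ks) \<le> 4 * real m" using big by (simp add: S_def m_def)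
    ultimately show ?thesis by (simp add: field_simps)
  qed
  have "?E (Av D h) - ?E (Av (insert x D) h) = (\<Sum>a\<in>S. w a * ?E (\<lambda>\<sigma>. Av D h (\<sigma> \<circ> tr x a)))"
  proof -
    have "(\<Sum>a\<in>S. w a * ?E (\<lambda>\<sigma>. Av D h (\<sigma> \<circ> tr x a))) =
       (\<Sum>a\<in>S. (if a = x then ?E (\<lambda>\<sigma>. Av D h (\<sigma> \<circ> tr x a)) else 0) - ?E (\<lambda>\<sigma>. Av D h (\<sigma> \<circ> tr x a)) / m)"
      by (intro sum.cong) (auto simp: w_def left_diff_distrib)
    also have "\<dots> = ?E (Av D h) - avg S (\<lambda>a. ?E (\<lambda>\<sigma>. Av D h (\<sigma> \<circ> tr x a)))"
      using fS xS by (simp add: sum_subtractf avg_def[of S] m_def sum_divide_distrib)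
    also have "avg S (\<lambda>a. ?E (\<lambda>\<sigma>. Av D h (\<sigma> \<circ> tr x a))) = ?E (Av (insert x D) h)"
      unfolding AvI by (rule shuffle_avg_avg[symmetric])
    finally show ?thesis by linarith
  qed
  moreover have "\<bar>\<Sum>a\<in>S. w a * ?E (\<lambda>\<sigma>. Av D h (\<sigma> \<circ> tr x a))\<bar>
      \<le> sqrt m * sqrt (1 - m / (2 * real (card Ks))) ^ t * sqrt (\<Sum>a\<in>S. (w a)\<^sup>2)"
  proof (rule shuffle_contraction[where \<beta> = "blk x"])
    show "blk a = blk x" if "a \<in> S" for a using that by (simp add: S_def)
  qed (fact SA m_def[symmetric] xS w0 Av1 Av_inv)+
  moreover have "\<dots> \<le> sqrt (card V) * sqrt (7 / 8) ^ t * 1"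
  proof -
    have "m \<le> card V" unfolding m_def using SA A V by (intro card_mono) auto
    moreover have "m / (2 * real (card Ks)) \<le> 1"
    proof -
      have "m \<le> card Ks" using card_block_le[OF SA _ xS, of "blk x"] by (auto simp: S_def m_def)
      then show ?thesis by (cases "card Ks = 0") (auto simp: field_simps)
    qed
    ultimately show ?thesis
      using w2 mKs by (intro mult_mono power_mono) (auto simp: sum_nonneg)
  qed
  ultimately show ?thesis by linarith
qed

lemma shuffle_avg_const: "shuffle_avg p V (replicate t (A, Ks)) (\<lambda>_. c) = c"
  using Ks V by (induction t) (auto simp: Pow_not_empty)

text \<open>The points of \<open>A - D\<close> are added one by one, each at the cost of
  \<open>shuffle_insert\<close>. Once all of \<open>A\<close> is uniform, the rounds change nothing,
  as they permute \<open>A\<close> within its blocks.\<close>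

lemma shuffle_level:
  assumes D: "D \<subseteq> A" and h: "\<And>\<sigma>. \<bar>h \<sigma>\<bar> \<le> 1"
    and big: "\<And>x. x \<in> A \<Longrightarrow> card Ks \<le> 4 * card {a \<in> D. blk a = blk x}"
  shows "\<bar>shuffle_avg p V (replicate t (A, Ks)) (Av D h) - avg (block_perms blk A) h\<bar>
    \<le> card V * (sqrt (card V) * sqrt (7 / 8) ^ t)"
proof -
  let ?E = "shuffle_avg p V (replicate t (A, Ks))"
  define e where "e = sqrt (card V) * sqrt (7 / 8) ^ t"
  have fA: "finite A" using A V finite_subset by metis
  have "\<bar>?E (Av D h) - ?E (Av (D \<union> F) h)\<bar> \<le> card F * e" if "finite F" "F \<subseteq> A - D" for F
    using that
  proof (induction F)
    case (insert x F)
    have "card {a \<in> D. blk a = blk x} \<le> card {a \<in> insert x (D \<union> F). blk a = blk x}"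
      using insert D fA by (intro card_mono) (auto intro: finite_subset[of _ A])
    then have "card Ks \<le> 4 * card {a \<in> insert x (D \<union> F). blk a = blk x}"
      using big[of x] insert.prems by simp
    then have "\<bar>?E (Av (D \<union> F) h) - ?E (Av (insert x (D \<union> F)) h)\<bar> \<le> e"
      unfolding e_def using insert D h by (intro shuffle_insert) auto
    moreover have "card (insert x F) * e = card F * e + e"
      using insert by (simp add: algebra_simps)
    moreover have "\<bar>?E (Av D h) - ?E (Av (D \<union> F) h)\<bar> \<le> card F * e"
      using insert by blast
    ultimately show ?case unfolding Un_insert_right by linarith
  qed simp
  from this[of "A - D"] have "\<bar>?E (Av D h) - ?E (Av A h)\<bar> \<le> card (A - D) * e"
    using fA D by (simp add: Un_absorb1)
  also have "\<dots> \<le> card V * e"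
    using A V card_mono[of V "A - D"] by (intro mult_right_mono) (auto simp: e_def)
  finally have "\<bar>?E (Av D h) - ?E (Av A h)\<bar> \<le> card V * e" .
  moreover have "?E (Av A h) = ?E (\<lambda>_. avg (block_perms blk A) h)"
  proof (rule shuffle_avg_cong[where P = "\<lambda>\<sigma>. \<sigma> \<in> block_perms blk A"])
    show "Av A h \<sigma> = avg (block_perms blk A) h" if "\<sigma> \<in> block_perms blk A" for \<sigma>
      using avg_bij_betw[OF block_perms_left_bij[OF that], of h] by simp
    show "swap_or_not (p k) A' B \<in> block_perms blk A"
      if "(A', Ks') \<in> set (replicate t (A, Ks))" "k \<in> Ks'" for k A' Ks' B
      using that R_permutes R_blk by (auto simp: block_perms_def split: if_splits)
  qed (auto intro: comp_block_perms)
  ultimately show ?thesis by (simp add: e_def shuffle_avg_const)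
qed

end

section \<open>Near-uniform permutations of bit strings\<close>

lemma card_bitstrings: "card (bitstrings k) = 2 ^ k"
  using card_lists_length_eq[of "UNIV :: bool set" k] by (simp add: bitstrings_def)

lemma finite_bitstrings [simp]: "finite (bitstrings k)"
  by (rule card_ge_0_finite) (simp add: card_bitstrings)

lemma bitstrings_ne [simp]: "bitstrings k \<noteq> {}"
  using card_bitstrings[of k] by auto

definition xor_mask :: "nat set \<Rightarrow> bits \<Rightarrow> bits" where
  "xor_mask P x = map (\<lambda>i. x ! i \<noteq> (i \<in> P)) [0..<length x]"

lemma length_xor_mask [simp]: "length (xor_mask P x) = length x"
  by (simp add: xor_mask_def)

lemma nth_xor_mask [simp]: "i < length x \<Longrightarrow> xor_mask P x ! i \<longleftrightarrow> x ! i \<noteq> (i \<in> P)"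
  by (simp add: xor_mask_def)

lemma xor_mask_xor_mask [simp]: "xor_mask P (xor_mask P x) = x"
  by (rule nth_equalityI) auto

text \<open>
  The permutation is built in levels: level \<open>j\<close> moves the strings in which the \<open>j\<close> bits from \<open>w\<close> on
  vanish and which do not lie in \<open>Z\<close>, and its keys are masks on the bits after those.
\<close>

definition active :: "nat \<Rightarrow> nat \<Rightarrow> bits set \<Rightarrow> nat \<Rightarrow> bits set" where
  "active n w Z j = {x \<in> bitstrings n. \<forall>i\<in>{w..<w + j}. \<not> x ! i} - Z"

definition level :: "nat \<Rightarrow> nat \<Rightarrow> bits set \<Rightarrow> nat \<Rightarrow> bits set \<times> nat set set" where
  "level n w Z j = (active n w Z j, Pow {w + j..<n})"

definition levels :: "nat \<Rightarrow> nat \<Rightarrow> bits set \<Rightarrow> nat \<Rightarrow> nat \<Rightarrow> (bits set \<times> nat set set) list" where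
  "levels n w Z t J = concat (map (\<lambda>j. replicate t (level n w Z j)) (rev [0..<J]))"

lemma active_antimono: "j \<le> k \<Longrightarrow> active n w Z k \<subseteq> active n w Z j"
  by (auto simp: active_def)

text \<open>The key that joins two strings is the set of positions where they differ; it avoids the
  first \<open>w + j\<close> positions, where both agree. Partners are told apart by their bit at
  the least position of the mask.\<close>

lemma shuffle_active:
  "shuffle xor_mask (bitstrings n) (active n w Z j) (Pow {w + j..<n}) (take w)
     (\<lambda>P. {z. z ! (LEAST i. i < length z \<and> i \<in> P)})"
proof
  show "active n w Z j \<subseteq> bitstrings n" by (auto simp: active_def)
  show "take w (xor_mask k x) = take w x" if "k \<in> Pow {w + j..<n}" for k x
    using that by (intro nth_equalityI) auto
  show "(z \<in> {z. z ! (LEAST i. i < length z \<and> i \<in> k)}) \<noteq> (xor_mask k z \<in> {z. z ! (LEAST i. i < length z \<and> i \<in> k)})"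
    if "xor_mask k z \<noteq> z" for k z
  proof -
    from that obtain i where "i < length z" "i \<in> k" by (auto simp: list_eq_iff_nth_eq)
    then have "(LEAST i. i < length z \<and> i \<in> k) < length z \<and> (LEAST i. i < length z \<and> i \<in> k) \<in> k"
      by (metis (mono_tags, lifting) LeastI)
    then show ?thesis by auto
  qed
  show "\<exists>!k. k \<in> Pow {w + j..<n} \<and> xor_mask k x = y"
    if "x \<in> active n w Z j" "y \<in> active n w Z j" "take w x = take w y" for x y
  proof (rule ex1I[of _ "{i. i < n \<and> x ! i \<noteq> y ! i}"])
    have len: "length x = n" "length y = n" using that by (auto simp: active_def bitstrings_def)
    have eq: "x ! i = y ! i" if "i < w + j" "i < n" for i
    proof (cases "i < w")
      case True
      then show ?thesis using \<open>take w x = take w y\<close> by (metis nth_take)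
    next
      case False
      then show ?thesis
        using \<open>x \<in> active n w Z j\<close> \<open>y \<in> active n w Z j\<close> that by (auto simp: active_def)
    qed
    then show "{i. i < n \<and> x ! i \<noteq> y ! i} \<in> Pow {w + j..<n} \<and> xor_mask {i. i < n \<and> x ! i \<noteq> y ! i} x = y"
      using len by (auto simp: list_eq_iff_nth_eq) (meson not_le)
    show "k = {i. i < n \<and> x ! i \<noteq> y ! i}" if "k \<in> Pow {w + j..<n} \<and> xor_mask k x = y" for k
    proof -
      have "y ! i \<longleftrightarrow> x ! i \<noteq> (i \<in> k)" if "i < n" for i
        using \<open>k \<in> _ \<and> _\<close> len that by auto
      then show ?thesis using that by auto
    qed
  qed
qed auto

lemma shuffle_avg_abs_le:
  "(\<And>\<sigma>. \<bar>h \<sigma>\<bar> \<le> 1) \<Longrightarrow> \<bar>shuffle_avg p V rs h\<bar> \<le> 1"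
proof (induction rs arbitrary: h)
  case (Cons r rs)
  obtain A Ks where "r = (A, Ks)" by force
  then show ?case using Cons by (auto intro!: avg_abs_le_bound)
qed simp

text \<open>Hybrid argument from level \<open>J\<close> down to 0. By \<open>last\<close>, the
  smallest active set admits only the identity, which is therefore exactly uniform. Each level
  enlarges the set on which the permutation is nearly uniform and adds one error term; in
  \<open>big\<close>, the left-hand side is the number of its keys.\<close>

lemma levels_near_uniform:
  assumes h: "\<And>\<sigma>. \<bar>h \<sigma>\<bar> \<le> 1"
    and big: "\<And>j x. j < J \<Longrightarrow> x \<in> active n w Z j \<Longrightarrow>
      2 ^ (n - w - j) \<le> 4 * card {a \<in> active n w Z (Suc j). take w a = take w x}"
    and last: "block_perms (take w) (active n w Z J) = {id}"
  shows "\<bar>shuffle_avg xor_mask (bitstrings n) (levels n w Z t J) h - avg (block_perms (take w) (active n w Z 0)) h\<bar>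
    \<le> J * (2 ^ n * (sqrt (2 ^ n) * sqrt (7 / 8) ^ t))"
proof -
  define e where "e = 2 ^ n * (sqrt (2 ^ n) * sqrt (7 / 8) ^ t)"
  let ?S = "shuffle_avg xor_mask (bitstrings n)"
  let ?G = "\<lambda>j. block_perms (take w) (active n w Z j)"
  have "\<bar>?S (concat (map (\<lambda>j. replicate t (level n w Z j)) (rev [j..<J]))) h - avg (?G j) h\<bar> \<le> (J - j) * e"
    if "j \<le> J" for j
    using that h
  proof (induction j arbitrary: h rule: inc_induct)
    case base
    then show ?case by (simp add: last)
  next
    case (step j)
    let ?rs = "concat (map (\<lambda>j. replicate t (level n w Z j)) (rev [Suc j..<J]))"
    let ?E = "?S (replicate t (level n w Z j))"
    interpret shuffle xor_mask "bitstrings n" "active n w Z j" "Pow {w + j..<n}" "take w"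
      "\<lambda>P. {z. z ! (LEAST i. i < length z \<and> i \<in> P)}"
      by (rule shuffle_active)
    \<comment> \<open>The levels run downwards, so level \<open>j\<close> is appended at the end and
      acts on what the smaller active sets have produced.\<close>
    have "[j..<J] = j # [Suc j..<J]" using step.hyps by (simp add: upt_conv_Cons)
    then have "?S (concat (map (\<lambda>j. replicate t (level n w Z j)) (rev [j..<J]))) h =
        ?S ?rs (\<lambda>\<sigma>. ?E (\<lambda>\<tau>. h (\<tau> \<circ> \<sigma>)))"
      by (simp add: shuffle_avg_append)
    moreover have "\<bar>?S ?rs (\<lambda>\<sigma>. ?E (\<lambda>\<tau>. h (\<tau> \<circ> \<sigma>))) - avg (?G (Suc j)) (\<lambda>\<sigma>. ?E (\<lambda>\<tau>. h (\<tau> \<circ> \<sigma>)))\<bar> \<le> (J - Suc j) * e"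
      by (rule step.IH) (rule shuffle_avg_abs_le, rule step.prems)
    moreover have "avg (?G (Suc j)) (\<lambda>\<sigma>. ?E (\<lambda>\<tau>. h (\<tau> \<circ> \<sigma>))) = ?E (Av (active n w Z (Suc j)) h)"
      by (rule shuffle_avg_avg[symmetric])
    moreover have "\<bar>?E (Av (active n w Z (Suc j)) h) - avg (?G j) h\<bar> \<le> e"
    proof -
      have "card (Pow {w + j..<n}) \<le> 4 * card {a \<in> active n w Z (Suc j). take w a = take w x}"
        if "x \<in> active n w Z j" for x
        using big[OF step.hyps(2) that] by (simp add: card_Pow)
      then have "\<bar>?E (Av (active n w Z (Suc j)) h) - avg (?G j) h\<bar> \<le>
          card (bitstrings n) * (sqrt (card (bitstrings n)) * sqrt (7 / 8) ^ t)"
        unfolding level_def using step.hyps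
        by (intro shuffle_level active_antimono step.prems) auto
      then show ?thesis by (simp add: e_def card_bitstrings)
    qed
    moreover have "real (J - j) * e = real (J - Suc j) * e + e"
      using step.hyps by (simp add: Suc_diff_Suc[symmetric] algebra_simps)
    ultimately show ?case by linarith
  qed
  from this[of 0] show ?thesis by (simp add: levels_def e_def)
qed

lemma card_bitstrings_le:
  fixes a b :: bits
  assumes "\<And>u. length u = k \<Longrightarrow> a @ u @ b \<in> X" "finite X"
  shows "2 ^ k \<le> card X"
proof -
  have "2 ^ k = card ((\<lambda>u. a @ u @ b) ` bitstrings k)"
    by (subst card_image) (auto simp: inj_on_def card_bitstrings)
  also have "\<dots> \<le> card X"
    using assms by (intro card_mono) (auto simp: bitstrings_def)
  finally show ?thesis .
qed

lemma block_perms_trivial: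
  assumes "\<And>x y. x \<in> D \<Longrightarrow> y \<in> D \<Longrightarrow> blk x = blk y \<Longrightarrow> x = y"
  shows "block_perms blk D = {id}"
proof -
  have "\<sigma> = id" if "\<sigma> \<in> block_perms blk D" for \<sigma>
  proof
    fix x
    from that have "\<sigma> permutes D" "blk (\<sigma> x) = blk x" by (auto simp: block_perms_def)
    then show "\<sigma> x = id x"
      using assms[of "\<sigma> x" x] permutes_in_image[of \<sigma> D x] permutes_not_in[of \<sigma> D x] by auto
  qed
  then show ?thesis using id_block_perms by blast
qed

text \<open>Each of \<open>J\<close>, the number of points and its square root is at most
  \<open>2 ^ n\<close>. Since \<open>(7 / 8) ^ 24 \<le> 1 / 16\<close>, the \<open>48 * n\<close>
  rounds contribute \<open>(1 / 16) ^ n\<close>, and \<open>2 * 2 * 2 / 16\<close> leaves 1/2 per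
  bit.\<close>

lemma levels_error:
  assumes "J \<le> n"
  shows "real J * (2 ^ n * (sqrt (2 ^ n) * sqrt (7 / 8) ^ (48 * n))) \<le> 1 / 2 ^ n"
proof -
  have "48 * n = 2 * (24 * n)" by simp
  then have "sqrt (7 / 8) ^ (48 * n) = ((sqrt (7 / 8))\<^sup>2) ^ (24 * n)"
    by (simp only: power_mult)
  also have "\<dots> = ((7 / 8) ^ 24) ^ n" by (simp add: power_mult)
  also have "\<dots> \<le> (1 / 16 :: real) ^ n" by (intro power_mono) (simp_all add: power_divide)
  finally have 1: "sqrt (7 / 8) ^ (48 * n) \<le> (1 / 16 :: real) ^ n" .
  have "sqrt (2 ^ n) \<le> (2::real) ^ n"
    by (rule real_le_lsqrt) (auto simp: power2_eq_square mult_le_cancel_left1)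
  moreover have "real J \<le> 2 ^ n"
  proof -
    have "J \<le> 2 ^ n" using assms less_exp[of n] by linarith
    then have "real J \<le> real (2 ^ n)" by (simp only: of_nat_le_iff)
    then show ?thesis by simp
  qed
  ultimately have "real J * (2 ^ n * (sqrt (2 ^ n) * sqrt (7 / 8) ^ (48 * n))) \<le>
      2 ^ n * (2 ^ n * (2 ^ n * (1 / 16) ^ n))"
    using 1 by (intro mult_mono) auto
  also have "\<dots> = (2 * 2 * 2 * (1 / 16)) ^ n" unfolding power_mult_distrib by (simp only: mult.assoc)
  also have "\<dots> = 1 / 2 ^ n" by (simp add: power_divide)
  finally show ?thesis .
qed

text \<open>This shuffle approximates \<open>T\<close>. Within a block, demanding one more zero
  keeps half of the active strings, and after \<open>c\<close> zeros a block has a single string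
  left.\<close>

lemma levels_near_uniform_outer:
  assumes h: "\<And>\<sigma>. \<bar>h \<sigma>\<bar> \<le> 1" and n: "n = r + c"
  shows "\<bar>shuffle_avg xor_mask (bitstrings n) (levels n r {} (48 * n) c) h
    - avg (block_perms (take r) (bitstrings n)) h\<bar> \<le> 1 / 2 ^ n"
proof -
  have "\<bar>shuffle_avg xor_mask (bitstrings n) (levels n r {} (48 * n) c) h
    - avg (block_perms (take r) (active n r {} 0)) h\<bar> \<le> c * (2 ^ n * (sqrt (2 ^ n) * sqrt (7 / 8) ^ (48 * n)))"
  proof (rule levels_near_uniform[OF h])
    fix j x assume j: "j < c" and x: "x \<in> active n r {} j"
    have "2 ^ (c - Suc j) \<le> card {a \<in> active n r {} (Suc j). take r a = take r x}"
    proof (rule card_bitstrings_le[where a = "take r x @ replicate (Suc j) False" and b = "[]"])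
      show "(take r x @ replicate (Suc j) False) @ u @ [] \<in> {a \<in> active n r {} (Suc j). take r a = take r x}"
        if "length u = c - Suc j" for u
        using that x j n by (auto simp: active_def bitstrings_def nth_append simp del: replicate_Suc)
    qed (auto simp: active_def)
    moreover have "2 ^ (n - r - j) = 2 * (2 :: nat) ^ (c - Suc j)"
      using j n by (simp flip: power_Suc add: Suc_diff_Suc)
    ultimately show "2 ^ (n - r - j) \<le> 4 * card {a \<in> active n r {} (Suc j). take r a = take r x}"
      by linarith
  next
    show "block_perms (take r) (active n r {} c) = {id}"
    proof (rule block_perms_trivial)
      fix x y assume xy: "x \<in> active n r {} c" "y \<in> active n r {} c" "take r x = take r y"
      show "x = y"
      proof (rule nth_equalityI)
        show "length x = length y" using xy by (auto simp: active_def bitstrings_def)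
        fix i assume "i < length x"
        then show "x ! i = y ! i"
          using xy n by (cases "i < r") (auto simp: active_def bitstrings_def, (metis nth_take)+)
      qed
    qed
  qed
  also have "\<dots> \<le> 1 / 2 ^ n" using n by (intro levels_error) simp
  finally show ?thesis by (simp add: active_def)
qed

definition padded :: "nat \<Rightarrow> nat \<Rightarrow> bits set" where
  "padded r c = (\<lambda>x. x @ replicate c False) ` bitstrings r"

lemma padded_iff: "x \<in> padded r c \<longleftrightarrow> length x = r + c \<and> (\<forall>i\<in>{r..<r + c}. \<not> x ! i)"
proof
  assume *: "length x = r + c \<and> (\<forall>i\<in>{r..<r + c}. \<not> x ! i)"
  then have "x = take r x @ replicate c False"
    by (intro nth_equalityI) (auto simp: nth_append)
  with * show "x \<in> padded r c"
    unfolding padded_def bitstrings_def by (intro image_eqI[of _ _ "take r x"]) auto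
qed (auto simp: padded_def bitstrings_def nth_append)

text \<open>This shuffle approximates \<open>K\<close>, with a single block. The strings that end in
  1 are never padded because \<open>c > 0\<close>; together with one more leading zero they provide
  a quarter of the number of keys, which is where the factor 4 comes from. With \<open>n - 1\<close>
  leading zeros, \<open>0...01\<close> is the only active string, so the levels stop there.\<close>

lemma levels_near_uniform_inner:
  assumes h: "\<And>\<sigma>. \<bar>h \<sigma>\<bar> \<le> 1" and n: "n = r + c" and c: "c > 0"
  shows "\<bar>shuffle_avg xor_mask (bitstrings n) (levels n 0 (padded r c) (48 * n) (n - 1)) h
    - avg {\<pi>. \<pi> permutes bitstrings n - padded r c} h\<bar> \<le> 1 / 2 ^ n"
proof -
  let ?Z = "padded r c"
  have nZ: "x @ [True] \<notin> ?Z" for x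
    using c unfolding padded_iff by (auto simp: nth_append intro!: bexI[of _ "r + c - 1"])
  have "\<bar>shuffle_avg xor_mask (bitstrings n) (levels n 0 ?Z (48 * n) (n - 1)) h
    - avg (block_perms (take 0) (active n 0 ?Z 0)) h\<bar> \<le> (n - 1) * (2 ^ n * (sqrt (2 ^ n) * sqrt (7 / 8) ^ (48 * n)))"
  proof (rule levels_near_uniform[OF h])
    fix j x assume j: "j < n - 1" and x: "x \<in> active n 0 ?Z j"
    have "2 ^ (n - 2 - j) \<le> card {a \<in> active n 0 ?Z (Suc j). take 0 a = take 0 x}"
    proof (rule card_bitstrings_le[where a = "replicate (Suc j) False" and b = "[True]"])
      show "replicate (Suc j) False @ u @ [True] \<in> {a \<in> active n 0 ?Z (Suc j). take 0 a = take 0 x}"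
        if "length u = n - 2 - j" for u
        using that x j n nZ[of "replicate (Suc j) False @ u"] by (auto simp: active_def bitstrings_def nth_append simp del: replicate_Suc)
    qed (auto simp: active_def)
    moreover have "2 ^ (n - 0 - j) = 4 * (2 :: nat) ^ (n - 2 - j)"
    proof -
      have "n - 0 - j = Suc (Suc (n - 2 - j))" using j by linarith
      then show ?thesis by simp
    qed
    ultimately show "2 ^ (n - 0 - j) \<le> 4 * card {a \<in> active n 0 ?Z (Suc j). take 0 a = take 0 x}"
      by linarith
  next
    show "block_perms (take 0) (active n 0 ?Z (n - 1)) = {id}"
    proof (rule block_perms_trivial)
      have "x = replicate (n - 1) False @ [True]" if "x \<in> active n 0 ?Z (n - 1)" for x
      proof (rule nth_equalityI)
        show "length x = length (replicate (n - 1) False @ [True])"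
          using that n c by (auto simp: active_def bitstrings_def)
        fix i assume "i < length x"
        moreover have "x ! (n - 1)"
        proof (rule ccontr)
          assume "\<not> x ! (n - 1)"
          moreover have "\<forall>i<n - 1. \<not> x ! i" using that by (auto simp: active_def)
          moreover have "i < n - 1 \<or> i = n - 1" if "i < n" for i using that by linarith
          ultimately have "\<forall>i<n. \<not> x ! i" by metis
          then have "x \<in> ?Z" using that n unfolding padded_iff by (auto simp: active_def bitstrings_def)
          then show False using that by (simp add: active_def)
        qed
        ultimately show "x ! i = (replicate (n - 1) False @ [True]) ! i"
          using that by (cases "i = n - 1") (auto simp: active_def bitstrings_def nth_append)
      qed
      then show "x = y" if "x \<in> active n 0 ?Z (n - 1)" "y \<in> active n 0 ?Z (n - 1)" for x y
        using that by metis
    qed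
  qed
  also have "\<dots> \<le> 1 / 2 ^ n" by (rule levels_error) simp
  finally show ?thesis by (simp add: active_def block_perms_def)
qed

section \<open>Random permutations with a prescribed sponge function\<close>

text \<open>Block-preserving partial injections extend to permutations: the prescribed values are
  enforced one at a time by a transposition that leaves the earlier ones in place.\<close>

lemma block_perms_extend:
  assumes V: "finite D" "a ` D \<subseteq> V" "b ` D \<subseteq> V" and inj: "inj_on a D" "inj_on b D"
    and blk: "\<And>d. d \<in> D \<Longrightarrow> blk (a d) = blk (b d)"
  shows "\<exists>T\<in>block_perms blk V. \<forall>d\<in>D. T (a d) = b d"
  using assms
proof (induction D)
  case empty
  then show ?case using id_block_perms by blast
next
  case (insert d D)
  then obtain T where T: "T \<in> block_perms blk V" "\<And>d. d \<in> D \<Longrightarrow> T (a d) = b d"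
    by auto
  have perm: "T permutes V" and blkT: "\<And>x. blk (T x) = blk x" using T(1) by (auto simp: block_perms_def)
  let ?T = "tr (T (a d)) (b d) \<circ> T"
  have "?T \<in> block_perms blk V"
    using insert.prems permutes_in_image[OF perm] blkT
    by (intro comp_block_perms transpose_block_perms T) auto
  moreover have "?T (a d') = b d'" if "d' \<in> D" for d'
  proof -
    have "a d' \<noteq> a d" "b d' \<noteq> b d" using insert that by (auto simp: inj_on_def)
    moreover have "T (a d') \<noteq> T (a d)" using \<open>a d' \<noteq> a d\<close> permutes_inj[OF perm] by (auto simp: inj_eq)
    ultimately show ?thesis using T(2)[OF that] by (simp add: Transposition.transpose_def)
  qed
  moreover have "?T (a d) = b d" by simp
  ultimately show ?case by blast
qed

definition prescribed :: "nat \<Rightarrow> nat \<Rightarrow> func \<Rightarrow> func set" where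
  "prescribed r c f = {\<phi>. \<phi> permutes bitstrings (r + c) \<and> (\<forall>x\<in>bitstrings r. Sp r c \<phi> x = f x)}"

text \<open>The set \<open>prescribed r c f\<close> is the double coset of \<open>g\<close>, and all
  its elements have equally many factorizations. Indeed, \<open>\<phi>\<close> and \<open>g\<close>
  agree in the first \<open>r\<close> bits on padded strings, so some \<open>T1\<close> corrects
  \<open>g\<close> to \<open>\<phi>\<close> there; the remaining factor \<open>K1\<close> fixes all
  padded strings, and translation by \<open>T1\<close> and \<open>K1\<close> matches the fibre over
  \<open>g\<close> with that over \<open>\<phi>\<close>.\<close>

lemma avg_double_coset:
  assumes g: "g permutes bitstrings (r + c)" "\<And>x. x \<in> bitstrings r \<Longrightarrow> Sp r c g x = f x"
  shows "avg (block_perms (take r) (bitstrings (r + c)))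
      (\<lambda>T. avg {\<pi>. \<pi> permutes bitstrings (r + c) - padded r c} (\<lambda>K. h (T \<circ> g \<circ> K))) = avg (prescribed r c f) h"
proof -
  let ?V = "bitstrings (r + c)" and ?Z = "padded r c"
  let ?G = "block_perms (take r) ?V" and ?H = "{\<pi>. \<pi> permutes ?V - ?Z}"
  have ZV: "?Z \<subseteq> ?V" by (auto simp: padded_def bitstrings_def)
  have Hc: "K \<circ> K' \<in> ?H" if "K \<in> ?H" "K' \<in> ?H" for K K' using that by (simp add: permutes_compose)
  have Hi: "inv K \<in> ?H" if "K \<in> ?H" for K using that by (simp add: permutes_inv)
  have HV: "K permutes ?V" if "K \<in> ?H" for K using that by (auto intro: permutes_subset)
  have GV: "T permutes ?V" if "T \<in> ?G" for T using that by (simp add: block_perms_def)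
  have HZ: "K z = z" if "K \<in> ?H" "z \<in> ?Z" for K z using that by (auto intro: permutes_not_in)
  have mem: "T \<circ> g \<circ> K \<in> prescribed r c f" if "T \<in> ?G" "K \<in> ?H" for T K
  proof -
    have "Sp r c (T \<circ> g \<circ> K) x = f x" if x: "x \<in> bitstrings r" for x
    proof -
      have "K (x @ replicate c False) = x @ replicate c False"
        using HZ[OF \<open>K \<in> ?H\<close>] x by (auto simp: padded_def)
      then show ?thesis using g(2)[OF x] \<open>T \<in> ?G\<close> by (simp add: Sp_def block_perms_def)
    qed
    then show ?thesis
      using that GV HV g(1) by (auto simp: prescribed_def intro!: permutes_compose)
  qed
  define fib where "fib \<phi> = {q \<in> ?G \<times> ?H. (\<lambda>(T, K). T \<circ> g \<circ> K) q = \<phi>}" for \<phi>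
  have fin: "finite (?G \<times> ?H)" by (intro finite_cartesian_product finite_block_perms finite_permutations) auto
  have finfib: "finite (fib \<phi>)" for \<phi> unfolding fib_def using fin by (rule rev_finite_subset) auto
  have "(id, id) \<in> fib g" by (auto simp: fib_def permutes_id)
  then have pos: "card (fib g) > 0" using finfib by (auto simp: card_gt_0_iff)
  have "card (fib \<phi>) = card (fib g)" if "\<phi> \<in> prescribed r c f" for \<phi>
  proof -
    have phi: "\<phi> permutes ?V" using that by (simp add: prescribed_def)
    have sp: "take r (\<phi> z) = take r (g z)" if "z \<in> ?Z" for z
      using that g(2) \<open>\<phi> \<in> _\<close> by (auto simp: prescribed_def padded_def Sp_def)
    have "\<exists>T\<in>?G. \<forall>z\<in>?Z. T (g z) = \<phi> z"
    proof (rule block_perms_extend)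
      show "finite ?Z" by (rule finite_subset[OF ZV finite_bitstrings])
      show "g ` ?Z \<subseteq> ?V" "\<phi> ` ?Z \<subseteq> ?V"
        using ZV permutes_in_image[OF g(1)] permutes_in_image[OF phi] by auto
      show "inj_on g ?Z" "inj_on \<phi> ?Z"
        using permutes_inj[OF g(1)] permutes_inj[OF phi] by (auto intro: inj_on_subset)
    qed (simp add: sp)
    then obtain T1 where T1: "T1 \<in> ?G" "\<And>z. z \<in> ?Z \<Longrightarrow> T1 (g z) = \<phi> z" by auto
    define K1 where "K1 = inv g \<circ> inv T1 \<circ> \<phi>"
    have "K1 permutes ?V"
      unfolding K1_def using g(1) GV[OF T1(1)] phi by (intro permutes_compose permutes_inv)
    moreover have "K1 z = z" if "z \<in> ?Z" for z
      using T1(2)[OF that] permutes_inverses(2)[OF g(1)] permutes_inverses(2)[OF GV[OF T1(1)]]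
      unfolding K1_def by (simp flip: T1(2)[OF that])
    ultimately have K1: "K1 \<in> ?H" by (auto simp: permutes_def)
    have phi_eq: "\<phi> = T1 \<circ> g \<circ> K1"
      unfolding K1_def using permutes_inverses(1)[OF g(1)] permutes_inverses(1)[OF GV[OF T1(1)]] by (simp add: fun_eq_iff)
    have "bij_betw (\<lambda>(T, K). (T1 \<circ> T, K \<circ> K1)) (fib g) (fib \<phi>)"
    proof (rule bij_betw_byWitness[where f' = "\<lambda>(T, K). (inv T1 \<circ> T, K \<circ> inv K1)"])
      note invs = permutes_inverses[OF GV[OF T1(1)]] permutes_inverses[OF HV[OF K1]]
      show "\<forall>a\<in>fib g. (\<lambda>(T, K). (inv T1 \<circ> T, K \<circ> inv K1)) ((\<lambda>(T, K). (T1 \<circ> T, K \<circ> K1)) a) = a"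
        using invs by (auto simp: fun_eq_iff)
      show "\<forall>a\<in>fib \<phi>. (\<lambda>(T, K). (T1 \<circ> T, K \<circ> K1)) ((\<lambda>(T, K). (inv T1 \<circ> T, K \<circ> inv K1)) a) = a"
        using invs by (auto simp: fun_eq_iff)
      show "(\<lambda>(T, K). (T1 \<circ> T, K \<circ> K1)) ` fib g \<subseteq> fib \<phi>"
      proof clarify
        fix T K assume "(T, K) \<in> fib g"
        then have "T \<in> ?G" "K \<in> ?H" "T \<circ> g \<circ> K = g" by (auto simp: fib_def)
        then show "(T1 \<circ> T, K \<circ> K1) \<in> fib \<phi>"
          unfolding fib_def using comp_block_perms[OF T1(1)] Hc[OF _ K1] phi_eq by (auto simp: fun_eq_iff)
      qed
      show "(\<lambda>(T, K). (inv T1 \<circ> T, K \<circ> inv K1)) ` fib \<phi> \<subseteq> fib g"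
      proof clarify
        fix T K assume "(T, K) \<in> fib \<phi>"
        then have TK: "T \<in> ?G" "K \<in> ?H" "T \<circ> g \<circ> K = T1 \<circ> g \<circ> K1" using phi_eq by (auto simp: fib_def)
        have "inv T1 \<circ> T \<circ> g \<circ> (K \<circ> inv K1) = inv T1 \<circ> (T \<circ> g \<circ> K) \<circ> inv K1" by (simp add: comp_assoc)
        also have "\<dots> = g" unfolding TK(3) using invs by (simp add: fun_eq_iff)
        finally show "(inv T1 \<circ> T, K \<circ> inv K1) \<in> fib g"
          unfolding fib_def using TK comp_block_perms[OF inv_block_perms[OF T1(1)]] Hc[OF _ Hi[OF K1]] by auto
      qed
    qed
    then show ?thesis by (rule bij_betw_same_card[symmetric])
  qed
  then have "avg (?G \<times> ?H) (\<lambda>q. h ((\<lambda>(T, K). T \<circ> g \<circ> K) q)) = avg (prescribed r c f) h"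
    using fin mem pos
    by (intro avg_equal_fibres[where k = "card (fib g)"])
       (auto simp: fib_def prescribed_def intro: finite_subset[OF _ finite_permutations[of ?V]])
  then show ?thesis by (simp add: avg_Times)
qed

text \<open>The values of a uniform permutation at fixed distinct points are a sample without
  replacement: composing with a permutation that carries one list of values to another matches the
  fibres.\<close>

lemma avg_permutations_map:
  assumes V: "finite V" and zs: "zs \<in> dwords V q"
  shows "avg {\<phi>. \<phi> permutes V} (\<lambda>\<phi>. G (map \<phi> zs)) = avg (dwords V q) G"
proof (rule avg_equal_fibres)
  let ?P = "{\<phi>. \<phi> permutes V}"
  have z: "set zs \<subseteq> V" "length zs = q" "distinct zs" using zs by (auto simp: dwords_def)
  show "finite ?P" using V by (rule finite_permutations)
  show "finite (dwords V q)" using V by (rule finite_dwords)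
  show "map \<phi> zs \<in> dwords V q" if "\<phi> \<in> ?P" for \<phi>
    using that z by (auto simp: dwords_def distinct_map permutes_in_image intro: inj_on_subset[OF permutes_inj])
  have "id \<in> {\<phi> \<in> ?P. map \<phi> zs = zs}" by (simp add: permutes_id)
  moreover have "finite {\<phi> \<in> ?P. map \<phi> zs = zs}" using finite_permutations[OF V] by simp
  ultimately show "card {\<phi> \<in> ?P. map \<phi> zs = zs} > 0"
    unfolding card_gt_0_iff by blast
  fix ys assume "ys \<in> dwords V q"
  then have y: "set ys \<subseteq> V" "length ys = q" "distinct ys" by (auto simp: dwords_def)
  \<comment> \<open>A constant block map puts all of \<open>V\<close> into one block, so that every
    permutation of \<open>V\<close> qualifies.\<close>
  have "\<exists>T\<in>block_perms (\<lambda>_. ()) V. \<forall>i\<in>{..<q}. T (zs ! i) = ys ! i"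
    using y z by (intro block_perms_extend) (auto simp: inj_on_def nth_eq_iff_index_eq subset_iff)
  then obtain T where T: "T permutes V" "\<And>i. i < q \<Longrightarrow> T (zs ! i) = ys ! i"
    by (auto simp: block_perms_def)
  then have Tz: "map T zs = ys" using y z by (auto intro!: nth_equalityI)
  have "bij_betw (\<lambda>\<phi>. T \<circ> \<phi>) {\<phi> \<in> ?P. map \<phi> zs = zs} {\<phi> \<in> ?P. map \<phi> zs = ys}"
  proof (rule bij_betw_byWitness[where f' = "\<lambda>\<phi>. inv T \<circ> \<phi>"])
    have m: "map (inv T) ys = zs"
      using T(1) by (simp add: Tz[symmetric] permutes_inv_o)
    show "(\<lambda>\<phi>. T \<circ> \<phi>) ` {\<phi> \<in> ?P. map \<phi> zs = zs} \<subseteq> {\<phi> \<in> ?P. map \<phi> zs = ys}"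
      using T(1) Tz by (auto intro: permutes_compose simp flip: map_map)
    show "(\<lambda>\<phi>. inv T \<circ> \<phi>) ` {\<phi> \<in> ?P. map \<phi> zs = ys} \<subseteq> {\<phi> \<in> ?P. map \<phi> zs = zs}"
      using T(1) m by (auto intro: permutes_compose permutes_inv simp flip: map_map)
  qed (use permutes_inverses[OF T(1)] in \<open>auto simp: fun_eq_iff\<close>)
  then show "card {\<phi> \<in> ?P. map \<phi> zs = ys} = card {\<phi> \<in> ?P. map \<phi> zs = zs}"
    by (rule bij_betw_same_card[symmetric])
qed

text \<open>In both worlds the permutation is uniform on \<open>prescribed r c f\<close> once its
  sponge function \<open>f\<close> is given. So \<open>h\<close> can be replaced by the conditional
  expectation \<open>H\<close>, and only the law of the table of \<open>f\<close> differs: prefixes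
  of draws without replacement against independent draws.\<close>

lemma sponge_function_near_uniform:
  fixes h :: "func \<Rightarrow> func \<Rightarrow> real"
  assumes r: "0 < r" "r \<le> c" and h: "\<And>f \<phi>. 0 \<le> h f \<phi> \<and> h f \<phi> \<le> 1"
  shows "\<bar>avg {\<phi>. \<phi> permutes bitstrings (r + c)} (\<lambda>\<phi>. h (restrict (Sp r c \<phi>) (bitstrings r)) \<phi>)
     - avg (bitstrings r \<rightarrow>\<^sub>E bitstrings r) (\<lambda>f. avg (prescribed r c f) (h f))\<bar> \<le> 4 / sqrt (2 ^ r)"
proof -
  let ?V = "bitstrings (r + c)" and ?Y = "bitstrings r"
  let ?P = "{\<phi>. \<phi> permutes ?V}" and ?F = "?Y \<rightarrow>\<^sub>E ?Y"
  define S where "S \<phi> = restrict (Sp r c \<phi>) ?Y" for \<phi>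
  define H where "H f = avg (prescribed r c f) (h f)" for f
  have H01: "0 \<le> H f" "H f \<le> 1" for f
    unfolding H_def using h by (auto intro!: avg_ge_0 avg_le)
  have SF: "S \<phi> \<in> ?F" if "\<phi> \<in> ?P" for \<phi>
  proof -
    have "\<phi> (x @ replicate c False) \<in> ?V" if "x \<in> ?Y" for x
      using \<open>\<phi> \<in> ?P\<close> that permutes_in_image[of \<phi> ?V "x @ replicate c False"] by (simp add: bitstrings_def)
    then show ?thesis by (auto simp: S_def Sp_def bitstrings_def)
  qed
  have fib: "{\<phi> \<in> ?P. S \<phi> = f} = prescribed r c f" if "f \<in> ?F" for f
    using that by (auto simp: S_def prescribed_def fun_eq_iff restrict_def PiE_def extensional_def)
  obtain zs where zs: "set zs = ?Y" "distinct zs" using finite_distinct_list[of ?Y] by auto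
  define q where "q = length zs"
  have q: "q = 2 ^ r" using distinct_card[OF zs(2)] zs(1) by (simp add: q_def card_bitstrings)
  define pz where "pz = map (\<lambda>x. x @ replicate c False) zs"
  have pz: "pz \<in> dwords ?V q"
    using zs by (auto simp: pz_def dwords_def q_def distinct_map inj_on_def bitstrings_def)
  \<comment> \<open>\<open>F\<close> reads a function off its table of values along
    \<open>zs\<close>.\<close>
  define F where "F ws = restrict (\<lambda>x. the (map_of (zip zs ws) x)) ?Y" for ws :: "bits list"
  have Fmap: "F (map f zs) = f" if "f \<in> ?F" for f
  proof
    fix x
    show "F (map f zs) x = f x"
    proof (cases "x \<in> ?Y")
      case True
      then obtain i where i: "i < length zs" "zs ! i = x" using zs by (metis in_set_conv_nth)
      then have "map_of (zip zs (map f zs)) (zs ! i) = Some (map f zs ! i)"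
        using zs by (intro map_of_zip_nth) auto
      then show ?thesis using i True by (simp add: F_def)
    next
      case False
      then show ?thesis using that by (auto simp: F_def PiE_def extensional_def)
    qed
  qed
  have mapF: "map (F ws) zs = ws" if "length ws = q" for ws
  proof (rule nth_equalityI)
    fix i assume "i < length (map (F ws) zs)"
    then have i: "i < length zs" by simp
    then have "zs ! i \<in> ?Y" using nth_mem zs(1) by blast
    moreover have "map_of (zip zs ws) (zs ! i) = Some (ws ! i)"
      using i zs that by (intro map_of_zip_nth) (auto simp: q_def)
    ultimately show "map (F ws) zs ! i = ws ! i" using i by (simp add: F_def)
  qed (simp add: that q_def)
  have "bij_betw (\<lambda>f. map f zs) ?F (words ?Y q)"
  proof (rule bij_betw_byWitness[where f' = F])
    show "F ` words ?Y q \<subseteq> ?F"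
    proof clarify
      fix ws assume ws: "ws \<in> words ?Y q"
      have "F ws x \<in> ?Y" if "x \<in> ?Y" for x
      proof -
        have "F ws x \<in> set (map (F ws) zs)" using that zs by auto
        moreover have "map (F ws) zs = ws" using mapF ws by (simp add: words_def)
        ultimately have "F ws x \<in> set ws" by (simp only:)
        then show ?thesis using ws by (auto simp: words_def)
      qed
      then show "F ws \<in> ?F" by (auto simp: F_def)
    qed
  qed (use Fmap mapF zs in \<open>auto simp: words_def q_def\<close>)
  from avg_bij_betw[OF this, of "\<lambda>ws. H (F ws)"]
  have ideal: "avg ?F H = avg (words ?Y q) (\<lambda>ws. H (F ws))"
    using Fmap by (simp cong: avg_cong)
  have "avg ?P (\<lambda>\<phi>. h (S \<phi>) \<phi>) = avg ?P (\<lambda>\<phi>. avg {\<phi>' \<in> ?P. S \<phi>' = S \<phi>} (\<lambda>\<phi>'. h (S \<phi>') \<phi>'))"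
    by (rule avg_tower) (simp add: finite_permutations)
  also have "\<dots> = avg ?P (\<lambda>\<phi>. H (S \<phi>))"
  proof (intro avg_cong refl)
    fix \<phi> assume "\<phi> \<in> ?P"
    have "avg {\<phi>' \<in> ?P. S \<phi>' = S \<phi>} (\<lambda>\<phi>'. h (S \<phi>') \<phi>') = avg {\<phi>' \<in> ?P. S \<phi>' = S \<phi>} (h (S \<phi>))"
      by (intro avg_cong refl) auto
    then show "avg {\<phi>' \<in> ?P. S \<phi>' = S \<phi>} (\<lambda>\<phi>'. h (S \<phi>') \<phi>') = H (S \<phi>)"
      unfolding H_def fib[OF SF[OF \<open>\<phi> \<in> ?P\<close>]] .
  qed
  also have "\<dots> = avg ?P (\<lambda>\<phi>. H (F (map (take r) (map \<phi> pz))))"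
  proof (intro avg_cong refl)
    fix \<phi> assume "\<phi> \<in> ?P"
    then have "S \<phi> = F (map (S \<phi>) zs)" using SF Fmap by simp
    also have "map (S \<phi>) zs = map (take r) (map \<phi> pz)"
      using zs by (auto simp: S_def pz_def Sp_def)
    finally show "H (S \<phi>) = H (F (map (take r) (map \<phi> pz)))" by simp
  qed
  also have "\<dots> = avg (dwords ?V q) (\<lambda>xs. H (F (map (take r) xs)))"
    by (rule avg_permutations_map[OF finite_bitstrings pz])
  also have "\<dots> = avg (words ?Y q) (\<lambda>ws. ratio (2 ^ r) (2 ^ c) ws * H (F ws))"
  proof -
    have "card {v \<in> ?V. take r v = y} = 2 ^ c" if "y \<in> ?Y" for y
    proof -
      have "bij_betw (\<lambda>u. y @ u) (bitstrings c) {v \<in> ?V. take r v = y}"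
        using that by (intro bij_betw_byWitness[where f' = "drop r"])
          (auto simp: bitstrings_def, metis append_take_drop_id)
      from bij_betw_same_card[OF this] show ?thesis by (simp add: card_bitstrings)
    qed
    moreover have "take r ` ?V \<subseteq> ?Y" by (auto simp: bitstrings_def)
    ultimately show ?thesis
      using avg_dwords_map[of ?V ?Y "take r" "2 ^ c" "2 ^ r" q "\<lambda>ws. H (F ws)"] q r(2)
      by (simp add: card_bitstrings)
  qed
  finally have "\<bar>avg ?P (\<lambda>\<phi>. h (S \<phi>) \<phi>) - avg ?F H\<bar> =
      \<bar>avg (words ?Y q) (\<lambda>ws. (ratio (2 ^ r) (2 ^ c) ws - 1) * H (F ws))\<bar>"
    unfolding ideal by (simp add: left_diff_distrib avg_diff)
  also have "\<dots> \<le> avg (words ?Y q) (\<lambda>ws. \<bar>ratio (2 ^ r) (2 ^ c) ws - 1\<bar>)"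
    by (rule order_trans[OF avg_abs_le], rule avg_mono)
       (use H01 in \<open>simp add: abs_mult mult_left_le\<close>)
  also have "\<dots> \<le> sqrt (2 ^ r * (16 * 2 ^ r * 2 ^ r / (2 ^ r * 2 ^ c)\<^sup>2))"
  proof -
    have "(2::nat) ^ r \<le> 2 ^ c" using r by (intro power_increasing) auto
    moreover have "(2::nat) ^ 1 \<le> 2 ^ c" using r by (intro power_increasing) auto
    ultimately have "q \<le> 2 ^ c" "q\<^sup>2 \<le> 2 ^ r * 2 ^ c" "2 * q \<le> 2 ^ r * 2 ^ c"
      unfolding q power2_eq_square by (auto intro: mult_le_mono simp: mult.commute)
    from avg_abs_ratio_minus_1[OF finite_bitstrings card_bitstrings _ this] show ?thesis
      by (simp add: q)
  qed
  \<comment> \<open>The variance \<open>16 * 2 ^ r / 2 ^ (2 * c)\<close> falls below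
    \<open>16 / 2 ^ r\<close> exactly by \<open>r \<le> c\<close>.\<close>
  also have "\<dots> \<le> sqrt (16 / 2 ^ r)"
  proof (rule real_sqrt_le_mono)
    have "(2::real) ^ r * 2 ^ r \<le> 2 ^ c * 2 ^ c" using r by (intro mult_mono power_increasing) auto
    then show "2 ^ r * (16 * 2 ^ r * 2 ^ r / (2 ^ r * 2 ^ c)\<^sup>2) \<le> (16 / 2 ^ r :: real)"
      by (simp add: field_simps power2_eq_square)
  qed
  also have "\<dots> = 4 / sqrt (2 ^ r)" by (simp add: real_sqrt_divide)
  finally show ?thesis by (simp add: S_def H_def[abs_def])
qed

section \<open>Classical circuits\<close>

text \<open>Total functions on the wires avoid the length conditions of bit strings in all register
  computations; \<open>gate_map_mgate\<close> translates back.\<close>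

type_synonym mem = "nat \<Rightarrow> bool"

fun mgate :: "nat \<Rightarrow> func \<Rightarrow> bits \<Rightarrow> nat gate \<Rightarrow> mem \<Rightarrow> mem" where
  "mgate r f sr (Flip t) m = m(t := \<not> m t)"
| "mgate r f sr (CNot i t) m = m(t := (m t \<noteq> m i))"
| "mgate r f sr (Toffoli i j t) m = m(t := (m t \<noteq> (m i \<and> m j)))"
| "mgate r f sr (Pub i t) m =
     (\<lambda>k. if t \<le> k \<and> k < t + r then m k \<noteq> f (map m [i..<i + r]) ! (k - t) else m k)"
| "mgate r f sr (Coin a l t) m = m(t := (m t \<noteq> coin_at sr (map m [a..<a + l])))"
| "mgate r f sr (Hadamard i) m = m"
| "mgate r f sr (Phase i) m = m"

definition run :: "nat \<Rightarrow> func \<Rightarrow> bits \<Rightarrow> nat gate list \<Rightarrow> mem \<Rightarrow> mem" where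
  "run r f sr C m = fold (mgate r f sr) C m"

lemma run_simps [simp]:
  "run r f sr [] m = m"
  "run r f sr (g # C) m = run r f sr C (mgate r f sr g m)"
  "run r f sr (C @ D) m = run r f sr D (run r f sr C m)"
  by (simp_all add: run_def)

lemma slice_map: "i + k \<le> N \<Longrightarrow> slice i k (map m [0..<N]) = map m [i..<i + k]"
  by (auto simp: slice_def intro!: nth_equalityI)

lemma xor_into_map:
  "t + length v \<le> N \<Longrightarrow> xor_into t v (map m [0..<N]) =
     map (\<lambda>k. if t \<le> k \<and> k < t + length v then m k \<noteq> v ! (k - t) else m k) [0..<N]"
  by (auto simp: xor_into_def)

lemma gate_map_mgate:
  assumes "wf_gate r N g" "\<And>x. length x = r \<Longrightarrow> length (f x) = r"
  shows "gate_map r f sr g (map m [0..<N]) = map (mgate r f sr g m) [0..<N]"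
  using assms by (cases g) (auto simp: xor_into_map slice_map)

lemma fold_gate_map:
  assumes "\<And>g. g \<in> set C \<Longrightarrow> wf_gate r N g" "\<And>x. length x = r \<Longrightarrow> length (f x) = r"
  shows "fold (gate_map r f sr) C (map m [0..<N]) = map (run r f sr C m) [0..<N]"
  using assms by (induction C arbitrary: m) (auto simp: gate_map_mgate)

text \<open>The sources of a well-formed gate are disjoint from its targets, so the second
  application XORs the same value again.\<close>

lemma mgate_mgate:
  assumes "wf_gate r N g"
  shows "mgate r f sr g (mgate r f sr g m) = m"
proof (cases g)
  case (Pub i t)
  define m' where "m' = mgate r f sr g m"
  have "map m' [i..<i + r] = map m [i..<i + r]" using assms Pub by (auto simp: m'_def)
  then have "mgate r f sr g m' = (\<lambda>k. if t \<le> k \<and> k < t + r then m' k \<noteq> f (map m [i..<i + r]) ! (k - t) else m' k)"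
    using Pub by (simp only: mgate.simps)
  then show ?thesis using Pub by (auto simp: m'_def fun_eq_iff)
next
  case (Coin a l t)
  define m' where "m' = mgate r f sr g m"
  have "map m' [a..<a + l] = map m [a..<a + l]" using assms Coin by (auto simp: m'_def)
  then have "mgate r f sr g m' = m'(t := (m' t \<noteq> coin_at sr (map m [a..<a + l])))"
    using Coin by (simp only: mgate.simps)
  then show ?thesis using Coin by (auto simp: m'_def fun_eq_iff)
qed (use assms in \<open>auto simp: fun_eq_iff\<close>)

lemma run_rev_run:
  assumes "\<And>g. g \<in> set C \<Longrightarrow> wf_gate r N g"
  shows "run r f sr (rev C) (run r f sr C m) = m"
  using assms by (induction C arbitrary: m) (auto simp: mgate_mgate[where N = N])

text \<open>Compute, use, uncompute: if \<open>D\<close> turns what \<open>C\<close> computes from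
  \<open>m\<close> into what \<open>C\<close> computes from \<open>m'\<close>, no intermediate value
  survives.\<close>

lemma run_conjugate:
  assumes "\<And>g. g \<in> set C \<Longrightarrow> wf_gate r N g" "run r f sr D (run r f sr C m) = run r f sr C m'"
  shows "run r f sr (rev C) (run r f sr D (run r f sr C m)) = m'"
  unfolding assms(2) by (rule run_rev_run[OF assms(1)])

definition cnots :: "nat \<Rightarrow> nat \<Rightarrow> nat \<Rightarrow> nat gate list" where
  "cnots a b k = map (\<lambda>i. CNot (a + i) (b + i)) [0..<k]"

lemma run_cnots:
  assumes "a + k \<le> b \<or> b + k \<le> a"
  shows "run r f sr (cnots a b k) m = (\<lambda>i. if b \<le> i \<and> i < b + k then m i \<noteq> m (a + (i - b)) else m i)"
  using assms
proof (induction k)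
  case (Suc k)
  then have "run r f sr (cnots a b (Suc k)) m = mgate r f sr (CNot (a + k) (b + k)) (run r f sr (cnots a b k) m)"
    by (simp add: cnots_def)
  with Suc show ?case by (auto simp: fun_eq_iff less_Suc_eq)
qed (auto simp: cnots_def fun_eq_iff)

definition toffolis :: "nat \<Rightarrow> nat \<Rightarrow> nat \<Rightarrow> nat \<Rightarrow> nat gate list" where
  "toffolis s a b k = map (\<lambda>i. Toffoli s (a + i) (b + i)) [0..<k]"

lemma run_toffolis:
  assumes "a + k \<le> b \<or> b + k \<le> a" "s < b \<or> b + k \<le> s"
  shows "run r f sr (toffolis s a b k) m =
    (\<lambda>i. if b \<le> i \<and> i < b + k then m i \<noteq> (m s \<and> m (a + (i - b))) else m i)"
  using assms
proof (induction k)
  case (Suc k)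
  then have "run r f sr (toffolis s a b (Suc k)) m =
      mgate r f sr (Toffoli s (a + k) (b + k)) (run r f sr (toffolis s a b k) m)"
    by (simp add: toffolis_def)
  with Suc show ?case by (auto simp: fun_eq_iff less_Suc_eq)
qed (auto simp: toffolis_def fun_eq_iff)

text \<open>Wire \<open>q + i\<close> receives the conjunction of wire \<open>q\<close> and of the negations of the first \<open>i\<close> wires from \<open>a\<close> on.\<close>

definition zero_chain :: "nat \<Rightarrow> nat \<Rightarrow> nat \<Rightarrow> nat gate list" where
  "zero_chain q a k =
     concat (map (\<lambda>i. [Flip (a + i), Toffoli (q + i) (a + i) (q + i + 1), Flip (a + i)]) [0..<k])"

lemma run_zero_chain:
  assumes "\<And>i. q < i \<Longrightarrow> i \<le> q + k \<Longrightarrow> \<not> m i" "a + k \<le> q"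
  shows "run r f sr (zero_chain q a k) m =
    (\<lambda>i. if q < i \<and> i \<le> q + k then m q \<and> (\<forall>j<i - q. \<not> m (a + j)) else m i)"
  using assms
proof (induction k)
  case (Suc k)
  have "run r f sr (zero_chain q a (Suc k)) m =
      run r f sr [Flip (a + k), Toffoli (q + k) (a + k) (q + k + 1), Flip (a + k)] (run r f sr (zero_chain q a k) m)"
    by (simp add: zero_chain_def)
  moreover have "run r f sr (zero_chain q a k) m =
    (\<lambda>i. if q < i \<and> i \<le> q + k then m q \<and> (\<forall>j<i - q. \<not> m (a + j)) else m i)"
    using Suc by auto
  ultimately show ?case
    using Suc.prems by (auto simp: fun_eq_iff less_Suc_eq le_Suc_eq)
qed (auto simp: zero_chain_def)

text \<open>The address wires are zero at rest and carry their two unary marks only for the duration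
  of the read, so they are clean again afterwards.\<close>

lemma run_flip_coin:
  assumes "a \<noteq> b" "a \<noteq> t" "b \<noteq> t" "\<not> m a" "\<not> m b" "\<not> m t"
    and "map (m(a := True, b := True)) [w..<w + l] = y"
  shows "run r f sr [Flip a, Flip b, Coin w l t, Flip b, Flip a] m = m(t := coin_at sr y)"
proof -
  define m' where "m' = m(a := True, b := True)"
  have 1: "mgate r f sr (Flip b) (mgate r f sr (Flip a) m) = m'"
    using assms by (auto simp: m'_def)
  have 2: "mgate r f sr (Coin w l t) m' = m'(t := coin_at sr y)"
    using assms by (auto simp: m'_def)
  show ?thesis
    unfolding run_simps 1 2 using assms by (auto simp: m'_def fun_eq_iff)
qed

text \<open>With unary indices an address is prepared by flipping single wires, without arithmetic
  on counters. The price is the length \<open>2 ^ (n + R)\<close> of the shared random string, which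
  may be arbitrary.\<close>

definition onehot :: "nat \<Rightarrow> nat \<Rightarrow> bits" where
  "onehot k i = map (\<lambda>j. j = i) [0..<k]"

lemma length_onehot [simp]: "length (onehot k i) = k"
  by (simp add: onehot_def)

lemma nth_onehot [simp]: "j < k \<Longrightarrow> onehot k i ! j \<longleftrightarrow> j = i"
  by (simp add: onehot_def)

lemma onehot_inject: "i < k \<Longrightarrow> onehot k i = onehot k j \<longleftrightarrow> i = j"
  by (metis nth_onehot)

text \<open>
  Round \<open>i\<close> reads its coins at addresses that end in the unary index \<open>2 * i\<close>, and its key at addresses
  that end in \<open>2 * i + 1\<close>.
\<close>

definition key_set :: "nat \<Rightarrow> nat \<Rightarrow> (bits \<Rightarrow> bool) \<Rightarrow> nat \<Rightarrow> nat \<Rightarrow> nat set" where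
  "key_set n R \<omega> i lo = {k \<in> {lo..<n}. \<omega> (onehot n k @ onehot R (2 * i + 1))}"

definition coin_set :: "nat \<Rightarrow> nat \<Rightarrow> (bits \<Rightarrow> bool) \<Rightarrow> nat \<Rightarrow> bits set" where
  "coin_set n R \<omega> i = {x \<in> bitstrings n. \<omega> (x @ onehot R (2 * i))}"

section \<open>One round of the shuffle as a circuit\<close>

text \<open>
  \<open>wAR\<close> is the first wire of the register that holds the permuted string; together with the unary
  register at \<open>wO1\<close> it forms the address window for the coins. The registers at \<open>wKA\<close> and \<open>wO2\<close> form
  the address window for the key, which is read into the register at \<open>wKR\<close>. The conjunctions that
  decide whether a string is active are computed in the wires from \<open>wQ\<close> on.
\<close>

locale layout =
  fixes r c R :: nat and f :: func and sr :: bits and m0 :: mem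
  assumes m0: "\<And>i. 2 * (r + c) \<le> i \<Longrightarrow> \<not> m0 i"
begin

abbreviation "n \<equiv> r + c"
abbreviation "wAR \<equiv> 2 * (r + c)"
abbreviation "wO1 \<equiv> 3 * (r + c)"
abbreviation "wKA \<equiv> 3 * (r + c) + R"
abbreviation "wO2 \<equiv> 4 * (r + c) + R"
abbreviation "wKR \<equiv> 4 * (r + c) + 2 * R"
definition "wD1 = 5 * (r + c) + 2 * R"
definition "wD2 = 5 * (r + c) + 2 * R + 1"
definition "wD3 = 5 * (r + c) + 2 * R + 2"
definition "wE = 5 * (r + c) + 2 * R + 3"
definition "wS = 5 * (r + c) + 2 * R + 4"
lemmas flag_wires = wD1_def wD2_def wD3_def wE_def wS_def

abbreviation "wQ \<equiv> 5 * (r + c) + 2 * R + 5"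
abbreviation "exec \<equiv> run r f sr"
abbreviation "wfg \<equiv> wf_gate r (7 * (r + c) + 2 * R + 6)"

text \<open>During a round, \<open>d1\<close> and \<open>d2\<close> tell whether the string and its
  partner are active, \<open>d3\<close> is their conjunction, \<open>e\<close> the XOR of their
  coins and \<open>s\<close> the decision to swap. The address and chain wires are clean.\<close>

definition st :: "bits \<Rightarrow> nat set \<Rightarrow> bool \<Rightarrow> bool \<Rightarrow> bool \<Rightarrow> bool \<Rightarrow> bool \<Rightarrow> mem" where
  "st x P d1 d2 d3 e s = (\<lambda>i.
     if i < wAR then m0 i
     else if i < wO1 then x ! (i - wAR)
     else if wKR \<le> i \<and> i < wD1 then i - wKR \<in> P
     else if i = wD1 then d1 else if i = wD2 then d2 else if i = wD3 then d3
     else if i = wE then e else if i = wS then s else False)"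

lemma st_upd [simp]:
  "(st x P d1 d2 d3 e s)(wD1 := v) = st x P v d2 d3 e s"
  "(st x P d1 d2 d3 e s)(wD2 := v) = st x P d1 v d3 e s"
  "(st x P d1 d2 d3 e s)(wD3 := v) = st x P d1 d2 v e s"
  "(st x P d1 d2 d3 e s)(wE := v) = st x P d1 d2 d3 v s"
  "(st x P d1 d2 d3 e s)(wS := v) = st x P d1 d2 d3 e v"
  by (auto simp: st_def fun_eq_iff flag_wires)

lemma st_at [simp]:
  "st x P d1 d2 d3 e s wD1 = d1"
  "st x P d1 d2 d3 e s wD2 = d2"
  "st x P d1 d2 d3 e s wD3 = d3"
  "st x P d1 d2 d3 e s wE = e"
  "st x P d1 d2 d3 e s wS = s"
  by (auto simp: st_def flag_wires)

definition read_coin :: "nat \<Rightarrow> nat gate list" where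
  "read_coin i = [Flip (wO1 + i), Coin wAR (r + c + R) wE, Flip (wO1 + i)]"

lemma run_read_coin:
  assumes "i < R" "length x = n"
  shows "exec (read_coin i) (st x P d1 d2 d3 e s) = st x P d1 d2 d3 (e \<noteq> coin_at sr (x @ onehot R i)) s"
proof -
  let ?m = "(st x P d1 d2 d3 e s)(wO1 + i := True)"
  have "map ?m [wAR..<wAR + (n + R)] = x @ onehot R i"
    using assms by (intro nth_equalityI) (auto simp: nth_append st_def flag_wires)
  moreover have "\<not> st x P d1 d2 d3 e s (wO1 + i)" using assms by (simp add: st_def flag_wires)
  ultimately show ?thesis
    using assms by (auto simp: read_coin_def fun_eq_iff st_def flag_wires add.assoc)
qed

definition xor_key :: "nat gate list" where
  "xor_key = cnots wKR wAR (r + c)"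

lemma run_xor_key:
  assumes "length x = n"
  shows "exec xor_key (st x P d1 d2 d3 e s) = st (xor_mask P x) P d1 d2 d3 e s"
  using assms by (auto simp: xor_key_def run_cnots fun_eq_iff st_def flag_wires)

definition read_key :: "nat \<Rightarrow> nat \<Rightarrow> nat gate list" where
  "read_key lo i = concat (map (\<lambda>k. [Flip (wKA + (lo + k)), Flip (wO2 + i), Coin wKA (r + c + R) (wKR + (lo + k)),
     Flip (wO2 + i), Flip (wKA + (lo + k))]) [0..<r + c - lo])"

lemma run_read_key:
  assumes i: "i < R"
  shows "exec (read_key lo i) (st x {} d1 d2 d3 e s) =
    st x {k \<in> {lo..<n}. coin_at sr (onehot n k @ onehot R i)} d1 d2 d3 e s"
proof -
  let ?K = "\<lambda>k. {l \<in> {lo..<lo + k}. coin_at sr (onehot n l @ onehot R i)}"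
  have "lo + k \<le> n \<Longrightarrow> exec (concat (map (\<lambda>k. [Flip (wKA + (lo + k)), Flip (wO2 + i), Coin wKA (r + c + R) (wKR + (lo + k)),
     Flip (wO2 + i), Flip (wKA + (lo + k))]) [0..<k])) (st x {} d1 d2 d3 e s) = st x (?K k) d1 d2 d3 e s" for k
  proof (induction k)
    case (Suc k)
    let ?s = "st x (?K k) d1 d2 d3 e s"
    let ?m = "?s(wKA + (lo + k) := True, wO2 + i := True)"
    have w: "map ?m [wKA..<wKA + (r + c + R)] = onehot n (lo + k) @ onehot R i"
      using i Suc.prems by (intro nth_equalityI) (auto simp: nth_append st_def flag_wires)
    have z: "\<not> ?s (wKA + (lo + k))" "\<not> ?s (wO2 + i)" "\<not> ?s (wKR + (lo + k))"
      using i Suc.prems by (auto simp: st_def flag_wires)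
    have d: "wKA + (lo + k) \<noteq> wO2 + i" "wKA + (lo + k) \<noteq> wKR + (lo + k)" "wO2 + i \<noteq> wKR + (lo + k)"
      using i Suc.prems by auto
    have "exec [Flip (wKA + (lo + k)), Flip (wO2 + i), Coin wKA (r + c + R) (wKR + (lo + k)),
       Flip (wO2 + i), Flip (wKA + (lo + k))] ?s =
       ?s(wKR + (lo + k) := coin_at sr (onehot n (lo + k) @ onehot R i))"
      by (rule run_flip_coin[OF d z w])
    also have "\<dots> = st x (?K (Suc k)) d1 d2 d3 e s"
      using i Suc.prems by (auto simp: st_def flag_wires fun_eq_iff less_Suc_eq)
    finally have *: "exec [Flip (wKA + (lo + k)), Flip (wO2 + i), Coin wKA (r + c + R) (wKR + (lo + k)),
       Flip (wO2 + i), Flip (wKA + (lo + k))] ?s = st x (?K (Suc k)) d1 d2 d3 e s" .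
    have IH: "exec (concat (map (\<lambda>k. [Flip (wKA + (lo + k)), Flip (wO2 + i), Coin wKA (r + c + R) (wKR + (lo + k)),
     Flip (wO2 + i), Flip (wKA + (lo + k))]) [0..<k])) (st x {} d1 d2 d3 e s) = ?s"
      using Suc by simp
    show ?case
      unfolding upt_Suc map_append concat_append run_simps(3) if_P[OF le0] IH by (simp only: list.map concat.simps append_Nil2 *)
  qed simp
  from this[of "n - lo"] show ?thesis
    by (cases "lo \<le> n") (auto simp: read_key_def)
qed

text \<open>A test of the address register: the wires \<open>outs\<close> of the chain computed by \<open>C\<close> are XORed into \<open>d\<close>.\<close>

definition test :: "nat gate list \<Rightarrow> nat list \<Rightarrow> nat \<Rightarrow> nat gate list" where
  "test C outs d = C @ map (\<lambda>q. CNot q d) outs @ rev C"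

definition tests :: "nat gate list \<Rightarrow> nat list \<Rightarrow> bits set \<Rightarrow> bool" where
  "tests C outs A \<longleftrightarrow> (\<forall>x P d1 d2 d3 e s. length x = n \<longrightarrow>
     exec (test C outs wD1) (st x P d1 d2 d3 e s) = st x P (d1 \<noteq> (x \<in> A)) d2 d3 e s \<and>
     exec (test C outs wD2) (st x P d1 d2 d3 e s) = st x P d1 (d2 \<noteq> (x \<in> A)) d3 e s)"

text \<open>The partner is left in the register of the string, and both coins are XORed into the
  same flag; running the gates backwards in \<open>decide\<close> restores everything but the
  decision.\<close>

definition compare :: "nat gate list \<Rightarrow> nat list \<Rightarrow> nat \<Rightarrow> nat gate list" where
  "compare C outs i = test C outs wD1 @ read_coin (2 * i) @ xor_key @ test C outs wD2 @ read_coin (2 * i) @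
     [Toffoli wD1 wD2 wD3]"

text \<open>
  The decision is symmetric in the two strings that a round may exchange, so the same gates uncompute
  it after the exchange.
\<close>

definition decide :: "nat gate list \<Rightarrow> nat list \<Rightarrow> nat \<Rightarrow> nat gate list" where
  "decide C outs i = compare C outs i @ [Toffoli wD3 wE wS] @ rev (compare C outs i)"

definition round_gates :: "nat gate list \<Rightarrow> nat list \<Rightarrow> nat \<Rightarrow> nat \<Rightarrow> nat gate list" where
  "round_gates C outs lo i = read_key lo (2 * i + 1) @ decide C outs i @ toffolis wS wKR wAR (r + c) @
     decide C outs i @ rev (read_key lo (2 * i + 1))"

abbreviation "st0 x \<equiv> st x {} False False False False False"

context
  fixes C :: "nat gate list" and outs :: "nat list" and A :: "bits set" and i lo :: nat
  assumes tests: "tests C outs A" and i: "2 * i + 1 < R"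
    and wfC: "\<And>g. g \<in> set C \<Longrightarrow> wfg g" "\<And>q. q \<in> set outs \<Longrightarrow> wQ \<le> q \<and> q \<le> wQ + 2 * n"
begin

lemma wf_test: "g \<in> set (test C outs d) \<Longrightarrow> wD1 \<le> d \<Longrightarrow> d < wQ \<Longrightarrow> wfg g"
  using wfC by (fastforce simp: test_def flag_wires)

lemma wf_compare: "g \<in> set (compare C outs i) \<Longrightarrow> wfg g"
  using wf_test[of g wD1] wf_test[of g wD2] i by (auto simp: flag_wires compare_def read_coin_def xor_key_def cnots_def)

lemma wf_read_key: "g \<in> set (read_key lo (2 * i + 1)) \<Longrightarrow> wfg g"
  using i by (auto simp: read_key_def flag_wires)

lemma wf_round_gates: "g \<in> set (round_gates C outs lo i) \<Longrightarrow> wfg g"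
  using wf_compare[of g] wf_read_key[of g] by (auto simp: flag_wires round_gates_def decide_def toffolis_def)

lemma run_compare:
  assumes "length x = n"
  shows "exec (compare C outs i) (st x P False False False False s) =
    st (xor_mask P x) P (x \<in> A) (xor_mask P x \<in> A) (x \<in> A \<and> xor_mask P x \<in> A)
      (coin_at sr (x @ onehot R (2 * i)) \<noteq> coin_at sr (xor_mask P x @ onehot R (2 * i))) s"
  using assms tests i
  by (simp add: compare_def run_read_coin run_xor_key tests_def)

lemma run_decide:
  assumes "length x = n"
  shows "exec (decide C outs i) (st x P False False False False s) =
    st x P False False False False (s \<noteq> (x \<in> A \<and> xor_mask P x \<in> A \<and>
      coin_at sr (x @ onehot R (2 * i)) \<noteq> coin_at sr (xor_mask P x @ onehot R (2 * i))))"
  unfolding decide_def run_simps(3)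
  by (rule run_conjugate[OF wf_compare], assumption) (simp add: run_compare[OF assms] conj_ac)

lemma run_round_gates:
  assumes x: "length x = n"
  shows "exec (round_gates C outs lo i) (st0 x) =
    st0 (swap_or_not (xor_mask (key_set n R (coin_at sr) i lo)) A (coin_set n R (coin_at sr) i) x)"
proof -
  let ?P = "key_set n R (coin_at sr) i lo" and ?B = "coin_set n R (coin_at sr) i"
  let ?y = "swap_or_not (xor_mask ?P) A ?B x"
  define s where "s \<longleftrightarrow> x \<in> A \<and> xor_mask ?P x \<in> A \<and>
      coin_at sr (x @ onehot R (2 * i)) \<noteq> coin_at sr (xor_mask ?P x @ onehot R (2 * i))"
  have y: "?y = (if s then xor_mask ?P x else x)"
    using x by (auto simp: s_def swap_or_not_def coin_set_def bitstrings_def)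
  have ly: "length ?y = n" using x y by auto
  have key: "exec (read_key lo (2 * i + 1)) (st0 z) = st z ?P False False False False False" for z
    using i by (subst run_read_key) (auto simp: key_set_def)
  have d1: "exec (decide C outs i) (st x ?P False False False False False) = st x ?P False False False False s"
    unfolding run_decide[OF x] s_def by (simp add: conj_ac)
  have t: "exec (toffolis wS wKR wAR (r + c)) (st x ?P False False False False s) = st ?y ?P False False False False s"
    using x y by (subst run_toffolis) (auto simp: st_def flag_wires fun_eq_iff)
  have d2: "exec (decide C outs i) (st ?y ?P False False False False s) = st ?y ?P False False False False False"
    using run_decide[OF ly, of ?P s] y by (cases s) (auto simp: s_def)
  have "exec (round_gates C outs lo i) (st0 x) =
      exec (rev (read_key lo (2 * i + 1))) (exec (decide C outs i @ toffolis wS wKR wAR (r + c) @ decide C outs i)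
        (exec (read_key lo (2 * i + 1)) (st0 x)))"
    by (simp add: round_gates_def)
  also have "\<dots> = st0 ?y"
    by (rule run_conjugate[OF wf_read_key]) (simp_all only: run_simps key d1 t d2)
  finally show ?thesis .
qed

end

end

section \<open>The simulated permutation as a circuit\<close>

lemma ball_shift: "(\<forall>i\<in>{a..<a + k}. Q i) \<longleftrightarrow> (\<forall>l<k. Q (a + l))" for a k :: nat
proof
  show "\<forall>i\<in>{a..<a + k}. Q i" if Q: "\<forall>l<k. Q (a + l)"
  proof
    fix i assume "i \<in> {a..<a + k}"
    then show "Q i" using Q[rule_format, of "i - a"] by auto
  qed
qed auto

context layout
begin

definition outer_chain :: "nat \<Rightarrow> nat gate list" where
  "outer_chain j = Flip wQ # zero_chain wQ (wAR + r) j"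

text \<open>The second chain continues the first. Wire \<open>wQ + j\<close> says that the first
  \<open>j\<close> bits vanish, wire \<open>wQ + j + c\<close> that the last \<open>c\<close> bits
  vanish as well; the XOR of these nested conditions singles out the strings that are not
  padded.\<close>

definition inner_chain :: "nat \<Rightarrow> nat gate list" where
  "inner_chain j = Flip wQ # zero_chain wQ wAR j @ zero_chain (wQ + j) (wAR + r) c"

lemma run_outer_chain:
  assumes "length x = n" "j \<le> c"
  shows "exec (outer_chain j) (st x P d1 d2 d3 e s) =
    (\<lambda>i. if wQ \<le> i \<and> i \<le> wQ + j then \<forall>l<i - wQ. \<not> x ! (r + l) else st x P d1 d2 d3 e s i)"
proof -
  let ?s = "st x P d1 d2 d3 e s"
  have z: "\<not> ?s i" if "wQ \<le> i" for i using that by (simp add: st_def flag_wires)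
  have a: "?s (wAR + i) = x ! i" if "i < n" for i using that by (simp add: st_def)
  have "exec (outer_chain j) ?s = exec (zero_chain wQ (wAR + r) j) (?s(wQ := True))"
    using z[of wQ] by (simp add: outer_chain_def)
  also have "\<dots> = (\<lambda>i. if wQ < i \<and> i \<le> wQ + j then (?s(wQ := True)) wQ \<and> (\<forall>l<i - wQ. \<not> (?s(wQ := True)) (wAR + r + l))
      else (?s(wQ := True)) i)"
    using assms z by (intro run_zero_chain) auto
  also have "\<dots> = (\<lambda>i. if wQ \<le> i \<and> i \<le> wQ + j then \<forall>l<i - wQ. \<not> x ! (r + l) else ?s i)"
  proof
    fix i
    have "?s (wAR + r + l) = x ! (r + l)" if "l < c" for l using a[of "r + l"] that by (simp add: add.assoc)
    then show "(if wQ < i \<and> i \<le> wQ + j then (?s(wQ := True)) wQ \<and> (\<forall>l<i - wQ. \<not> (?s(wQ := True)) (wAR + r + l))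
      else (?s(wQ := True)) i) = (if wQ \<le> i \<and> i \<le> wQ + j then \<forall>l<i - wQ. \<not> x ! (r + l) else ?s i)"
      using assms by auto
  qed
  finally show ?thesis .
qed

lemma run_inner_chain:
  assumes "length x = n" "j \<le> n"
  shows "exec (inner_chain j) (st x P d1 d2 d3 e s) =
    (\<lambda>i. if wQ \<le> i \<and> i \<le> wQ + j then \<forall>l<i - wQ. \<not> x ! l
      else if wQ + j < i \<and> i \<le> wQ + j + c then (\<forall>l<j. \<not> x ! l) \<and> (\<forall>l<i - (wQ + j). \<not> x ! (r + l))
      else st x P d1 d2 d3 e s i)"
proof -
  let ?s = "st x P d1 d2 d3 e s"
  have z: "\<not> ?s i" if "wQ \<le> i" for i using that by (simp add: st_def flag_wires)
  have a: "?s (wAR + i) = x ! i" if "i < n" for i using that by (simp add: st_def)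
  define m where "m = (\<lambda>i. if wQ \<le> i \<and> i \<le> wQ + j then \<forall>l<i - wQ. \<not> x ! l else ?s i)"
  have "exec (zero_chain wQ wAR j) (?s(wQ := True)) =
      (\<lambda>i. if wQ < i \<and> i \<le> wQ + j then (?s(wQ := True)) wQ \<and> (\<forall>l<i - wQ. \<not> (?s(wQ := True)) (wAR + l))
      else (?s(wQ := True)) i)"
    using assms z by (intro run_zero_chain) auto
  also have "\<dots> = m"
  proof
    fix i
    show "(if wQ < i \<and> i \<le> wQ + j then (?s(wQ := True)) wQ \<and> (\<forall>l<i - wQ. \<not> (?s(wQ := True)) (wAR + l))
      else (?s(wQ := True)) i) = m i"
      using assms a by (auto simp: m_def)
  qed
  finally have 1: "exec (zero_chain wQ wAR j) (?s(wQ := True)) = m" .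
  have "exec (inner_chain j) ?s = exec (zero_chain (wQ + j) (wAR + r) c) m"
    using z[of wQ] 1 by (simp add: inner_chain_def)
  also have "\<dots> = (\<lambda>i. if wQ + j < i \<and> i \<le> wQ + j + c then m (wQ + j) \<and> (\<forall>l<i - (wQ + j). \<not> m (wAR + r + l)) else m i)"
    using z by (intro run_zero_chain) (auto simp: m_def)
  also have "\<dots> = (\<lambda>i. if wQ \<le> i \<and> i \<le> wQ + j then \<forall>l<i - wQ. \<not> x ! l
      else if wQ + j < i \<and> i \<le> wQ + j + c then (\<forall>l<j. \<not> x ! l) \<and> (\<forall>l<i - (wQ + j). \<not> x ! (r + l))
      else ?s i)"
  proof
    fix i
    have "m (wAR + r + l) = x ! (r + l)" if "l < c" for l
      using a[of "r + l"] that by (simp add: add.assoc m_def)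
    moreover have "m (wQ + j) \<longleftrightarrow> (\<forall>l<j. \<not> x ! l)" by (simp add: m_def)
    ultimately show "(if wQ + j < i \<and> i \<le> wQ + j + c then m (wQ + j) \<and> (\<forall>l<i - (wQ + j). \<not> m (wAR + r + l)) else m i) =
      (if wQ \<le> i \<and> i \<le> wQ + j then \<forall>l<i - wQ. \<not> x ! l
      else if wQ + j < i \<and> i \<le> wQ + j + c then (\<forall>l<j. \<not> x ! l) \<and> (\<forall>l<i - (wQ + j). \<not> x ! (r + l)) else ?s i)"
      by (auto simp: m_def)
  qed
  finally show ?thesis .
qed

lemma wf_zero_chain: "g \<in> set (zero_chain q a k) \<Longrightarrow> a + k \<le> q \<Longrightarrow> q + k \<le> wQ + 2 * n \<Longrightarrow> wfg g"
  by (auto simp: zero_chain_def)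

lemma wf_outer_chain: "j \<le> c \<Longrightarrow> g \<in> set (outer_chain j) \<Longrightarrow> wfg g"
  using wf_zero_chain[of g wQ "wAR + r" j] by (auto simp: outer_chain_def)

lemma wf_inner_chain: "j \<le> n \<Longrightarrow> g \<in> set (inner_chain j) \<Longrightarrow> wfg g"
  using wf_zero_chain[of g wQ wAR j] wf_zero_chain[of g "wQ + j" "wAR + r" c] by (auto simp: inner_chain_def)

lemma tests_outer:
  assumes j: "j \<le> c"
  shows "tests (outer_chain j) [wQ + j] (active n r {} j)"
proof -
  have *: "exec (test (outer_chain j) [wQ + j] d) m = m'"
    if "length x = n" "m = st x P d1 d2 d3 e s" "m' = st x P d1' d2' d3 e s"
      "wD1 \<le> d" "d < wQ" "m' = m(d := (m d \<noteq> (x \<in> active n r {} j)))" for x P d1 d2 d3 e s d m m' d1' d2'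
    unfolding test_def run_simps(3)
  proof (rule run_conjugate)
    have "x \<in> active n r {} j \<longleftrightarrow> (\<forall>l<j. \<not> x ! (r + l))"
      using that(1) by (auto simp: active_def bitstrings_def ball_shift)
    then show "exec (map (\<lambda>q. CNot q d) [wQ + j]) (exec (outer_chain j) m) = exec (outer_chain j) m'"
      using that(4-6) unfolding that(2,3) run_outer_chain[OF that(1) j] by (auto simp: fun_eq_iff)
  qed (use j wf_outer_chain in auto)
  show ?thesis unfolding tests_def
    by (intro allI impI conjI; rule *[OF _ refl refl]) (simp_all, simp_all add: flag_wires)
qed

lemma tests_inner:
  assumes j: "j \<le> n"
  shows "tests (inner_chain j) [wQ + j, wQ + j + c] (active n 0 (padded r c) j)"
proof -
  have *: "exec (test (inner_chain j) [wQ + j, wQ + j + c] d) m = m'"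
    if "length x = n" "m = st x P d1 d2 d3 e s" "m' = st x P d1' d2' d3 e s"
      "wD1 \<le> d" "d < wQ" "m' = m(d := (m d \<noteq> (x \<in> active n 0 (padded r c) j)))" for x P d1 d2 d3 e s d m m' d1' d2'
    unfolding test_def run_simps(3)
  proof (rule run_conjugate)
    have "x \<in> padded r c \<longleftrightarrow> (\<forall>l<c. \<not> x ! (r + l))"
      using that(1) unfolding padded_iff by (simp add: ball_shift)
    then have "x \<in> active n 0 (padded r c) j \<longleftrightarrow> (\<forall>l<j. \<not> x ! l) \<and> \<not> (\<forall>l<c. \<not> x ! (r + l))"
      using that(1) by (auto simp: active_def bitstrings_def)
    moreover define a where "a i \<longleftrightarrow> (\<forall>l<i - wQ. \<not> x ! l)" for i
    moreover define b where "b i \<longleftrightarrow> (\<forall>l<j. \<not> x ! l) \<and> (\<forall>l<i - (wQ + j). \<not> x ! (r + l))" for i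
    \<comment> \<open>For \<open>c = 0\<close> the two output wires coincide and cancel, in
      accordance with all strings being padded.\<close>
    ultimately have act: "x \<in> active n 0 (padded r c) j \<longleftrightarrow> (a (wQ + j) \<noteq> (if c = 0 then a (wQ + j) else b (wQ + j + c)))"
      by (auto simp: a_def b_def)
    define G where "G mm = (\<lambda>i. if wQ \<le> i \<and> i \<le> wQ + j then a i
      else if wQ + j < i \<and> i \<le> wQ + j + c then b i else mm i)" for mm :: mem
    have G: "exec (inner_chain j) m = G m" "exec (inner_chain j) m' = G m'"
      unfolding that(2,3) run_inner_chain[OF that(1) j] G_def a_def b_def by simp_all
    have "G m' = (G m)(d := (m d \<noteq> (x \<in> active n 0 (padded r c) j)))"
      unfolding that(6) using that(5) by (auto simp: G_def fun_eq_iff)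
    moreover have "G m d = m d" using that(5) by (auto simp: G_def)
    moreover have "x \<in> active n 0 (padded r c) j \<longleftrightarrow> (G m (wQ + j) \<noteq> G m (wQ + j + c))"
      unfolding act by (simp add: G_def add.assoc)
    moreover have "exec (map (\<lambda>q. CNot q d) [wQ + j, wQ + j + c]) (G m) =
        (G m)(d := (G m d \<noteq> (G m (wQ + j) \<noteq> G m (wQ + j + c))))"
    proof -
      have "exec (map (\<lambda>q. CNot q d) [q, q']) M = M(d := (M d \<noteq> (M q \<noteq> M q')))"
        if "d \<noteq> q" "d \<noteq> q'" for q q' M
        using that by (auto simp: fun_eq_iff)
      moreover have "d \<noteq> wQ + j" "d \<noteq> wQ + j + c" using that(5) by auto
      ultimately show ?thesis by blast
    qed
    ultimately show "exec (map (\<lambda>q. CNot q d) [wQ + j, wQ + j + c]) (exec (inner_chain j) m) = exec (inner_chain j) m'"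
      by (simp only: G)
  qed (use j wf_inner_chain in auto)
  show ?thesis unfolding tests_def
    by (intro allI impI conjI; rule *[OF _ refl refl]) (simp_all, simp_all add: flag_wires)
qed

end

section \<open>A Feistel-type permutation with sponge function \<open>f\<close>\<close>

text \<open>The string \<open>x @ 0\<close> goes to \<open>(f x, x, 0)\<close>.\<close>

definition feistel :: "nat \<Rightarrow> func \<Rightarrow> bits \<Rightarrow> bits" where
  "feistel r f x = (let y = map (\<lambda>k. x ! (r + k) \<noteq> x ! k) [0..<r]
     in map (\<lambda>k. x ! (r + k) \<noteq> f y ! k) [0..<r] @ y @ drop (2 * r) x)"

definition feistel_perm :: "nat \<Rightarrow> nat \<Rightarrow> func \<Rightarrow> bits \<Rightarrow> bits" where
  "feistel_perm r c f x = (if x \<in> bitstrings (r + c) then feistel r f x else x)"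

lemma length_feistel: "r \<le> c \<Longrightarrow> length x = r + c \<Longrightarrow> length (feistel r f x) = r + c"
  by (simp add: feistel_def Let_def)

text \<open>The argument \<open>y\<close> of \<open>f\<close> is part of the output, so
  \<open>f y\<close> can be removed from the first \<open>r\<close> bits; this recovers the middle
  part, and then \<open>y\<close> yields the first one.\<close>

lemma feistel_perm_permutes:
  assumes "r \<le> c"
  shows "feistel_perm r c f permutes bitstrings (r + c)"
proof (rule bij_imp_permutes)
  have "inj_on (feistel_perm r c f) (bitstrings (r + c))"
  proof (rule inj_onI)
    fix x x' assume x: "x \<in> bitstrings (r + c)" "x' \<in> bitstrings (r + c)" "feistel_perm r c f x = feistel_perm r c f x'"
    define y where "y z = map (\<lambda>k. z ! (r + k) \<noteq> z ! k) [0..<r]" for z :: bits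
    have len: "length x = r + c" "length x' = r + c" using x by (auto simp: bitstrings_def)
    have "feistel r f x = feistel r f x'" using x by (simp add: feistel_perm_def)
    then have eq: "map (\<lambda>k. x ! (r + k) \<noteq> f (y x) ! k) [0..<r] = map (\<lambda>k. x' ! (r + k) \<noteq> f (y x') ! k) [0..<r]"
        "y x = y x'" "drop (2 * r) x = drop (2 * r) x'"
      by (auto simp: feistel_def Let_def y_def)
    have mid: "x ! (r + k) = x' ! (r + k)" if "k < r" for k
      using eq(1) that unfolding eq(2) by (auto simp: map_eq_conv)
    have low: "x ! k = x' ! k" if "k < r" for k
      using eq(2) mid[OF that] that by (auto simp: y_def)
    show "x = x'"
    proof (rule nth_equalityI)
      fix i assume i: "i < length x"
      consider "i < r" | "i = r + (i - r)" "i - r < r" | "i = 2 * r + (i - 2 * r)" by linarith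
      then show "x ! i = x' ! i"
      proof cases
        case 2
        then show ?thesis using mid[of "i - r"] by simp
      next
        case 3
        have "drop (2 * r) x ! (i - 2 * r) = drop (2 * r) x' ! (i - 2 * r)" using eq(3) by simp
        then show ?thesis using 3 i len assms by (simp add: nth_drop)
      qed (use low in auto)
    qed (use len in simp)
  qed
  moreover have "feistel_perm r c f ` bitstrings (r + c) \<subseteq> bitstrings (r + c)"
    using length_feistel[OF assms] by (auto simp: feistel_perm_def bitstrings_def)
  ultimately show "bij_betw (feistel_perm r c f) (bitstrings (r + c)) (bitstrings (r + c))"
    by (simp add: bij_betw_def endo_inj_surj)
qed (simp add: feistel_perm_def)

lemma Sp_feistel_perm:
  assumes rc: "r \<le> c" and f: "f \<in> bitstrings r \<rightarrow>\<^sub>E bitstrings r" and x: "x \<in> bitstrings r"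
  shows "Sp r c (feistel_perm r c f) x = f x"
proof -
  have len: "length x = r" "length (f x) = r" using f x by (auto simp: bitstrings_def PiE_def Pi_def)
  have "map (\<lambda>k. (x @ replicate c False) ! (r + k) \<noteq> (x @ replicate c False) ! k) [0..<r] = x"
    using len rc by (intro nth_equalityI) (auto simp: nth_append)
  then show ?thesis
    using len rc by (auto simp: Sp_def feistel_perm_def bitstrings_def feistel_def Let_def nth_append intro!: nth_equalityI)
qed

context layout
begin

text \<open>On the first two parts \<open>(a, b)\<close>, the first copy turns \<open>b\<close> into
  \<open>y\<close>, the XOR of both, and the second turns \<open>a\<close> into the old
  \<open>b\<close>; the query then adds \<open>f y\<close> to it.\<close>

definition feistel_gates :: "nat gate list" where
  "feistel_gates = cnots wAR (wAR + r) r @ cnots (wAR + r) wAR r @ [Pub (wAR + r) wAR]"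

lemma run_feistel_gates:
  assumes "r \<le> c" "length x = n"
  shows "exec feistel_gates (st0 x) = st0 (feistel_perm r c f x)"
proof -
  let ?s = "st0 x"
  define y where "y = map (\<lambda>k. x ! (r + k) \<noteq> x ! k) [0..<r]"
  define m where "m = (\<lambda>i. if wAR \<le> i \<and> i < wAR + r then x ! (r + (i - wAR))
      else if wAR + r \<le> i \<and> i < wAR + 2 * r then y ! (i - (wAR + r)) else ?s i)"
  have a: "?s (wAR + i) = x ! i" if "i < n" for i using that by (simp add: st_def)
  have a': "?s i = x ! (i - wAR)" if "wAR \<le> i" "i < wAR + n" for i using that by (simp add: st_def)
  have 1: "exec (cnots wAR (wAR + r) r @ cnots (wAR + r) wAR r) ?s = m"
    using assms by (auto simp: run_cnots m_def fun_eq_iff y_def a' add.assoc)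
  have 2: "map m [wAR + r..<wAR + r + r] = y"
    by (intro nth_equalityI) (auto simp: m_def y_def)
  have 3: "mgate r f sr (Pub (wAR + r) wAR) m = st0 (feistel r f x)"
  proof
    fix i
    consider "i < wAR" | k where "i = wAR + k" "k < r" | k where "i = wAR + r + k" "k < r" | k where "i = wAR + 2 * r + k"
    proof -
      have "i < wAR \<or> (i = wAR + (i - wAR) \<and> i - wAR < r) \<or> (i = wAR + r + (i - (wAR + r)) \<and> i - (wAR + r) < r) \<or>
          i = wAR + 2 * r + (i - (wAR + 2 * r))" by linarith
      then show ?thesis using that by metis
    qed
    then show "mgate r f sr (Pub (wAR + r) wAR) m i = st0 (feistel r f x) i"
      unfolding mgate.simps 2
      using assms by cases (auto simp: m_def st_def feistel_def Let_def y_def[symmetric] nth_append, auto simp: y_def flag_wires nth_append)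
  qed
  have "exec feistel_gates ?s = mgate r f sr (Pub (wAR + r) wAR) m"
    unfolding feistel_gates_def 1[symmetric] by simp
  then show ?thesis using 3 assms by (simp add: feistel_perm_def bitstrings_def)
qed

lemma wf_feistel_gates: "r \<le> c \<Longrightarrow> g \<in> set feistel_gates \<Longrightarrow> wfg g"
  by (auto simp: feistel_gates_def cnots_def)

end

section \<open>Composition of the rounds\<close>

text \<open>A round is given by its index, its active set and the least position of its mask.\<close>

definition shuffle_perm ::
    "nat \<Rightarrow> nat \<Rightarrow> (bits \<Rightarrow> bool) \<Rightarrow> (nat \<times> bits set \<times> nat) list \<Rightarrow> bits \<Rightarrow> bits" where
  "shuffle_perm n R \<omega> rs x =
     fold (\<lambda>(i, A, lo). swap_or_not (xor_mask (key_set n R \<omega> i lo)) A (coin_set n R \<omega> i)) rs x"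

definition rounds :: "nat \<Rightarrow> nat \<Rightarrow> bits set \<Rightarrow> nat \<Rightarrow> nat \<Rightarrow> nat \<Rightarrow> (nat \<times> bits set \<times> nat) list" where
  "rounds n w Z b t J =
     concat (map (\<lambda>j. map (\<lambda>s. ((b + j) * t + s, active n w Z j, w + j)) [0..<t]) (rev [0..<J]))"

lemma shuffle_perm_simps [simp]:
  "shuffle_perm n R \<omega> [] x = x"
  "shuffle_perm n R \<omega> ((i, A, lo) # rs) x =
     shuffle_perm n R \<omega> rs (swap_or_not (xor_mask (key_set n R \<omega> i lo)) A (coin_set n R \<omega> i) x)"
  "shuffle_perm n R \<omega> (rs @ rs') x = shuffle_perm n R \<omega> rs' (shuffle_perm n R \<omega> rs x)"
  by (simp_all add: shuffle_perm_def)

lemma shuffle_perm_permutes: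
  assumes "\<And>i A lo. (i, A, lo) \<in> set rs \<Longrightarrow> A \<subseteq> V"
  shows "shuffle_perm n R \<omega> rs permutes V"
  using assms
proof (induction rs)
  case Nil
  then show ?case by (simp add: permutes_def)
next
  case (Cons a rs)
  obtain i A lo where a: "a = (i, A, lo)" by (cases a)
  have "swap_or_not (xor_mask (key_set n R \<omega> i lo)) A (coin_set n R \<omega> i) permutes V"
    (is "?f permutes V")
  proof -
    have "?f (?f x) = x" for x by (rule swap_or_not_involution) simp
    moreover have "?f x = x" if "x \<notin> V" for x
      using that Cons.prems[of i A lo] a by (auto simp: swap_or_not_def)
    ultimately show ?thesis unfolding permutes_def by metis
  qed
  moreover have "shuffle_perm n R \<omega> rs permutes V" using Cons by (meson list.set_intros(2))
  ultimately have "shuffle_perm n R \<omega> rs \<circ> ?f permutes V" by (rule permutes_compose)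
  then show ?case by (simp add: a comp_def)
qed

lemma rounds_permutes: "shuffle_perm n R \<omega> (rounds n w Z b t J) permutes bitstrings n - Z"
  by (rule shuffle_perm_permutes) (auto simp: rounds_def active_def)

lemma double_less: "a + 1 \<le> b \<Longrightarrow> 2 * b \<le> k \<Longrightarrow> 2 * a + 1 < k" for a b k :: nat
  by linarith

context layout
begin

lemma run_rounds:
  assumes wfC: "\<And>j g. j < J \<Longrightarrow> g \<in> set (C j) \<Longrightarrow> wfg g"
    and wfo: "\<And>j q. j < J \<Longrightarrow> q \<in> set (outs j) \<Longrightarrow> wQ \<le> q \<and> q \<le> wQ + 2 * n"
    and tests: "\<And>j. j < J \<Longrightarrow> tests (C j) (outs j) (active n w Z j)"
    and R: "2 * ((b + J) * t) \<le> R" and x: "length x = n"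
  shows "exec (concat (map (\<lambda>j. concat (map (\<lambda>s. round_gates (C j) (outs j) (w + j) ((b + j) * t + s)) [0..<t])) (rev [0..<J])))
      (st0 x) = st0 (shuffle_perm n R (coin_at sr) (rounds n w Z b t J) x)"
proof -
  have len: "length (swap_or_not (xor_mask P) A B y) = length y" for P A B y
    by (simp add: swap_or_not_def)
  have lens: "length (shuffle_perm n R (coin_at sr) rs y) = length y" for rs y
    by (induction rs arbitrary: y) (auto simp: len)
  have one: "exec (round_gates (C j) (outs j) (w + j) ((b + j) * t + s)) (st0 y) =
      st0 (shuffle_perm n R (coin_at sr) [((b + j) * t + s, active n w Z j, w + j)] y)"
    if "j < J" "s < t" "length y = n" for j s y
  proof -
    have "(b + j) * t + s + 1 \<le> (b + j + 1) * t" using that by simp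
    also have "\<dots> \<le> (b + J) * t" using that by (intro mult_le_mono1) simp
    finally have "2 * ((b + j) * t + s) + 1 < R" using R by (rule double_less)
    then show ?thesis
      using that wfC wfo tests by (simp add: run_round_gates)
  qed
  have inner: "exec (concat (map (\<lambda>s. round_gates (C j) (outs j) (w + j) ((b + j) * t + s)) ss)) (st0 y) =
      st0 (shuffle_perm n R (coin_at sr) (map (\<lambda>s. ((b + j) * t + s, active n w Z j, w + j)) ss) y)"
    if "j < J" "set ss \<subseteq> {..<t}" "length y = n" for j ss y
    using that(2,3)
  proof (induction ss arbitrary: y)
    case (Cons s ss)
    then show ?case using one[OF that(1), of s y] by (simp add: len)
  qed simp
  have "exec (concat (map (\<lambda>j. concat (map (\<lambda>s. round_gates (C j) (outs j) (w + j) ((b + j) * t + s)) [0..<t])) js)) (st0 y) =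
      st0 (shuffle_perm n R (coin_at sr) (concat (map (\<lambda>j. map (\<lambda>s. ((b + j) * t + s, active n w Z j, w + j)) [0..<t]) js)) y)"
    if "set js \<subseteq> {..<J}" "length y = n" for js y
    using that
  proof (induction js arbitrary: y)
    case (Cons j js)
    have "set [0..<t] \<subseteq> {..<t}" by auto
    with Cons show ?case using inner[of j "[0..<t]" y] by (simp add: lens)
  qed simp
  from this[of "rev [0..<J]" x] show ?thesis unfolding rounds_def using x by (simp add: lessThan_atLeast0)
qed

text \<open>The summands \<open>0\<close> make this an instance of \<open>run_rounds\<close> with
  \<open>w = 0\<close> and \<open>b = 0\<close>.\<close>

definition inner_gates :: "nat \<Rightarrow> nat gate list" where
  "inner_gates t = concat (map (\<lambda>j. concat (map (\<lambda>s.
     round_gates (inner_chain j) [wQ + j, wQ + j + c] (0 + j) ((0 + j) * t + s)) [0..<t])) (rev [0..<r + c - 1]))"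

definition outer_gates :: "nat \<Rightarrow> nat gate list" where
  "outer_gates t = concat (map (\<lambda>j. concat (map (\<lambda>s.
     round_gates (outer_chain j) [wQ + j] (r + j) ((r + c + j) * t + s)) [0..<t])) (rev [0..<c]))"

definition perm_gates :: "nat \<Rightarrow> nat gate list" where
  "perm_gates t = inner_gates t @ feistel_gates @ outer_gates t"

end

definition sim_perm :: "nat \<Rightarrow> nat \<Rightarrow> nat \<Rightarrow> nat \<Rightarrow> func \<Rightarrow> (bits \<Rightarrow> bool) \<Rightarrow> bits \<Rightarrow> bits" where
  "sim_perm r c R t f \<omega> =
     shuffle_perm (r + c) R \<omega> (rounds (r + c) r {} (r + c) t c) \<circ> feistel_perm r c f \<circ>
     shuffle_perm (r + c) R \<omega> (rounds (r + c) 0 (padded r c) 0 t (r + c - 1))"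

lemma sim_perm_permutes: "r \<le> c \<Longrightarrow> sim_perm r c R t f \<omega> permutes bitstrings (r + c)"
  unfolding sim_perm_def
  using rounds_permutes[of "r + c" R \<omega> r "{}" "r + c" t c]
    permutes_subset[OF rounds_permutes[of "r + c" R \<omega> 0 "padded r c" 0 t "r + c - 1"], of "bitstrings (r + c)"]
    feistel_perm_permutes[of r c f]
  by (auto intro!: permutes_compose)

context layout
begin

lemma run_perm_gates:
  assumes rc: "r \<le> c" and R: "R = 2 * (2 * (r + c) * t)" and x: "length x = n"
  shows "exec (perm_gates t) (st0 x) = st0 (sim_perm r c R t f (coin_at sr) x)"
proof -
  let ?K = "shuffle_perm n R (coin_at sr) (rounds n 0 (padded r c) 0 t (r + c - 1))"
  have K: "exec (inner_gates t) (st0 x) = st0 (?K x)"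
    unfolding inner_gates_def
  proof (rule run_rounds)
    show "wfg g" if "j < r + c - 1" "g \<in> set (inner_chain j)" for j g
      using that by (intro wf_inner_chain[of j]) auto
    show "tests (inner_chain j) [wQ + j, wQ + j + c] (active n 0 (padded r c) j)" if "j < r + c - 1" for j
      using that by (intro tests_inner) simp
    have "(0 + (r + c - 1)) * t \<le> 2 * (r + c) * t" by (intro mult_le_mono1) simp
    then show "2 * ((0 + (r + c - 1)) * t) \<le> R" unfolding R by (rule mult_le_mono2)
  qed (use x in auto)
  have "?K permutes bitstrings n"
    by (rule permutes_subset[OF rounds_permutes]) auto
  then have lK: "length (?K x) = n"
    using x permutes_in_image[of ?K "bitstrings n" x] by (simp add: bitstrings_def)
  have lg: "length (feistel_perm r c f (?K x)) = n"
    using lK length_feistel[OF rc lK] by (simp add: feistel_perm_def)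
  have T: "exec (outer_gates t) (st0 y) = st0 (shuffle_perm n R (coin_at sr) (rounds n r {} (r + c) t c) y)"
    if "length y = n" for y
    unfolding outer_gates_def
  proof (rule run_rounds)
    show "wfg g" if "j < c" "g \<in> set (outer_chain j)" for j g
      using that by (intro wf_outer_chain[of j]) auto
    show "tests (outer_chain j) [wQ + j] (active n r {} j)" if "j < c" for j
      using that by (intro tests_outer) simp
    have "(r + c + c) * t \<le> 2 * (r + c) * t" by (intro mult_le_mono1) simp
    then show "2 * ((r + c + c) * t) \<le> R" unfolding R by (rule mult_le_mono2)
  qed (use that in auto)
  show ?thesis
    using K run_feistel_gates[OF rc lK] T[OF lg] by (simp add: perm_gates_def sim_perm_def)
qed

lemma wf_perm_gates:
  assumes rc: "r \<le> c" and R: "R = 2 * (2 * (r + c) * t)" and g: "g \<in> set (perm_gates t)"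
  shows "wfg g"
proof -
  have bound: "2 * (j * t + s) + 1 < R" if "j < 2 * (r + c)" "s < t" for j s
  proof -
    have "j * t + s + 1 \<le> (j + 1) * t" using that by simp
    also have "\<dots> \<le> 2 * (r + c) * t" using that by (intro mult_le_mono1) simp
    finally show ?thesis using R by (intro double_less) simp_all
  qed
  consider "g \<in> set (inner_gates t)" | "g \<in> set feistel_gates" | "g \<in> set (outer_gates t)"
    using g by (auto simp: perm_gates_def)
  then show ?thesis
  proof cases
    case 1
    then obtain j s where j: "j < r + c - 1" and s: "s < t"
      and g: "g \<in> set (round_gates (inner_chain j) [wQ + j, wQ + j + c] (0 + j) ((0 + j) * t + s))"
      by (auto simp: inner_gates_def)
    have "j \<le> n" using j by simp
    show ?thesis
      by (rule wf_round_gates[OF tests_inner[OF \<open>j \<le> n\<close>] _ _ _ g])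
        (use j s bound[of j s] wf_inner_chain[OF \<open>j \<le> n\<close>] in auto)
  next
    case 2
    then show ?thesis by (rule wf_feistel_gates[OF rc])
  next
    case 3
    then obtain j s where j: "j < c" and s: "s < t"
      and g: "g \<in> set (round_gates (outer_chain j) [wQ + j] (r + j) ((r + c + j) * t + s))"
      by (auto simp: outer_gates_def)
    have "j \<le> c" using j by simp
    show ?thesis
      by (rule wf_round_gates[OF tests_outer[OF \<open>j \<le> c\<close>] _ _ _ g])
        (use j s bound[of "r + c + j" s] wf_outer_chain[OF \<open>j \<le> c\<close>] in auto)
  qed
qed

text \<open>Bennett's scheme: the permutation is computed on a copy of the query, its value is
  copied to the answer, and \<open>G'\<close> followed by a second copy of the query erases the work
  register.\<close>

definition query_gates :: "nat gate list \<Rightarrow> nat gate list \<Rightarrow> nat gate list" where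
  "query_gates G G' = cnots 0 wAR (r + c) @ G @ cnots wAR (r + c) (r + c) @ G' @ cnots 0 wAR (r + c)"

end

text \<open>\<open>G\<close> and \<open>G'\<close> have to be correct over every content of the
  query and answer wires, because the answer changes between their runs.\<close>

lemma run_query_gates:
  fixes m :: mem
  assumes m: "\<And>i. 2 * (r + c) \<le> i \<Longrightarrow> \<not> m i"
    and G: "\<And>m x. (\<And>i. 2 * (r + c) \<le> i \<Longrightarrow> \<not> m i) \<Longrightarrow> length x = r + c \<Longrightarrow>
      run r f sr G (layout.st r c R m x {} False False False False False) =
      layout.st r c R m (\<psi> x) {} False False False False False"
    and G': "\<And>m x. (\<And>i. 2 * (r + c) \<le> i \<Longrightarrow> \<not> m i) \<Longrightarrow> length x = r + c \<Longrightarrow>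
      run r f sr G' (layout.st r c R m (\<psi> x) {} False False False False False) =
      layout.st r c R m x {} False False False False False"
  shows "run r f sr (layout.query_gates r c G G') m =
    (\<lambda>i. if r + c \<le> i \<and> i < 2 * (r + c) then m i \<noteq> \<psi> (map m [0..<r + c]) ! (i - (r + c)) else m i)"
proof -
  interpret L: layout r c R f sr m by unfold_locales (rule m)
  define m' where "m' = (\<lambda>i. if r + c \<le> i \<and> i < 2 * (r + c) then m i \<noteq> \<psi> (map m [0..<r + c]) ! (i - (r + c)) else m i)"
  have m': "\<And>i. 2 * (r + c) \<le> i \<Longrightarrow> \<not> m' i" using m by (simp add: m'_def)
  interpret L': layout r c R f sr m' by unfold_locales (rule m')
  let ?x = "map m [0..<r + c]"
  have x: "length ?x = r + c" by simp
  have 1: "run r f sr (cnots 0 (2 * (r + c)) (r + c)) m = L.st0 ?x"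
  proof
    fix i
    show "run r f sr (cnots 0 (2 * (r + c)) (r + c)) m i = L.st0 ?x i"
      using m[of i] by (subst run_cnots) (auto simp: L.st_def L.flag_wires)
  qed
  have 2: "run r f sr (cnots (2 * (r + c)) (r + c) (r + c)) (L.st0 (\<psi> ?x)) = L'.st0 (\<psi> ?x)"
  proof
    fix i
    define y where "y = L.st0 (\<psi> ?x)"
    have y: "L'.st0 (\<psi> ?x) = (\<lambda>i. if i < 2 * (r + c) then m' i else y i)"
      by (simp add: y_def L.st_def L'.st_def fun_eq_iff)
    have lo: "y i = m i" if "i < 2 * (r + c)" for i using that by (simp add: y_def L.st_def)
    have hi: "y (2 * (r + c) + k) = \<psi> ?x ! k" if "k < r + c" for k
      using that by (simp add: y_def L.st_def)
    have copy: "run r f sr (cnots (2 * (r + c)) (r + c) (r + c)) (L.st0 (\<psi> ?x)) =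
        (\<lambda>i. if r + c \<le> i \<and> i < r + c + (r + c) then y i \<noteq> y (2 * (r + c) + (i - (r + c))) else y i)"
      unfolding y_def by (rule run_cnots) simp
    show "run r f sr (cnots (2 * (r + c)) (r + c) (r + c)) (L.st0 (\<psi> ?x)) i = L'.st0 (\<psi> ?x) i"
    proof (cases "r + c \<le> i \<and> i < r + c + (r + c)")
      case True
      then have i: "i < 2 * (r + c)" by auto
      moreover have "y (2 * (r + c) + (i - (r + c))) = \<psi> ?x ! (i - (r + c))"
        using True by (intro hi) auto
      moreover have "y i = m i" by (rule lo[OF i])
      moreover have m': "m' i \<longleftrightarrow> (m i \<noteq> \<psi> ?x ! (i - (r + c)))" using True by (auto simp: m'_def)
      ultimately show ?thesis using True
        unfolding y copy by (simp only: m' if_True simp_thms)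
    next
      case False
      with lo show ?thesis
        unfolding y copy by (auto simp: m'_def)
    qed
  qed
  have lo: "m' i = m i" if "i < r + c" for i using that by (simp add: m'_def)
  have 3: "run r f sr (cnots 0 (2 * (r + c)) (r + c)) (L'.st0 ?x) = m'"
  proof
    fix i
    show "run r f sr (cnots 0 (2 * (r + c)) (r + c)) (L'.st0 ?x) i = m' i"
      using m'[of i] lo[of "i - 2 * (r + c)"] by (subst run_cnots) (auto simp: L'.st_def L'.flag_wires)
  qed
  have g: "run r f sr G (L.st0 ?x) = L.st0 (\<psi> ?x)"
    by (rule G) (use m in auto)
  have g': "run r f sr G' (L'.st0 (\<psi> ?x)) = L'.st0 ?x"
    by (rule G') (use m' in auto)
  show ?thesis
    unfolding m'_def[symmetric] L.query_gates_def by (simp only: run_simps 1 g 2 g' 3)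
qed

section \<open>Independence of the coins\<close>

lemma avg_Pow_Un:
  assumes "A \<inter> X = {}"
  shows "avg (Pow (A \<union> X)) G = avg (Pow A) (\<lambda>a. avg (Pow X) (\<lambda>x. G (a \<union> x)))"
proof -
  have "bij_betw (\<lambda>(a, x). a \<union> x) (Pow A \<times> Pow X) (Pow (A \<union> X))"
    by (rule bij_betw_byWitness[where f' = "\<lambda>w. (w \<inter> A, w \<inter> X)"]) (use assms in auto)
  from avg_bij_betw[OF this, of G] show ?thesis by (simp add: avg_Times)
qed

text \<open>A uniform random set inspected at distinct places is again a uniform random set; the
  places not inspected average out.\<close>

lemma avg_Pow_select:
  assumes Q: "finite Q" and e: "inj_on e D" "e ` D \<subseteq> Q"
  shows "avg (Pow Q) (\<lambda>y. G {k \<in> D. e k \<in> y}) = avg (Pow D) G"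
proof -
  let ?I = "e ` D" and ?R = "Q - e ` D"
  have "Q = ?I \<union> ?R" using e by auto
  then have "avg (Pow Q) (\<lambda>y. G {k \<in> D. e k \<in> y}) =
      avg (Pow ?I) (\<lambda>y. avg (Pow ?R) (\<lambda>z. G {k \<in> D. e k \<in> y \<union> z}))"
    using avg_Pow_Un[of ?I ?R "\<lambda>y. G {k \<in> D. e k \<in> y}"] by auto
  also have "\<dots> = avg (Pow ?I) (\<lambda>y. avg (Pow ?R) (\<lambda>z. G {k \<in> D. e k \<in> y}))"
    by (intro avg_cong refl arg_cong[where f = G]) auto
  also have "\<dots> = avg (Pow ?I) (\<lambda>y. G {k \<in> D. e k \<in> y})"
    using Q by (simp add: Pow_not_empty)
  also have "\<dots> = avg (Pow D) (\<lambda>K. G {k \<in> D. e k \<in> e ` K})"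
    by (rule avg_bij_betw) (rule bij_betw_Pow, simp add: bij_betw_def e)
  also have "\<dots> = avg (Pow D) G"
    using e(1) by (intro avg_cong refl arg_cong[where f = G]) (auto dest: inj_onD)
  finally show ?thesis .
qed

definition addresses :: "nat \<Rightarrow> nat \<Rightarrow> nat \<Rightarrow> bits set" where
  "addresses n R j = (\<lambda>a. a @ onehot R j) ` bitstrings n"

definition round_addresses :: "nat \<Rightarrow> nat \<Rightarrow> nat \<Rightarrow> bits set" where
  "round_addresses n R i = addresses n R (2 * i) \<union> addresses n R (2 * i + 1)"

lemma finite_addresses [simp]: "finite (addresses n R j)"
  by (simp add: addresses_def)

lemma addresses_disjoint: "i < R \<Longrightarrow> i \<noteq> j \<Longrightarrow> addresses n R i \<inter> addresses n R j = {}"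
  by (auto simp: addresses_def bitstrings_def onehot_inject)

lemma round_addresses_disjoint:
  assumes "2 * i + 1 < R" "i \<noteq> j"
  shows "round_addresses n R i \<inter> round_addresses n R j = {}"
proof -
  have "addresses n R k \<inter> addresses n R l = {}" if "k \<in> {2 * i, 2 * i + 1}" "l \<in> {2 * j, 2 * j + 1}" for k l
  proof (rule addresses_disjoint)
    show "k < R" using that assms by auto
    have "k div 2 = i" "l div 2 = j" using that by auto
    then show "k \<noteq> l" using assms(2) by auto
  qed
  then show ?thesis unfolding round_addresses_def by blast
qed

lemma round_addresses_subset: "round_addresses n R i \<subseteq> bitstrings (n + R)"
  by (auto simp: round_addresses_def addresses_def bitstrings_def)

lemma key_set_cong:
  "(\<And>a. a \<in> addresses n R (2 * i + 1) \<Longrightarrow> \<omega> a = \<omega>' a) \<Longrightarrow> key_set n R \<omega> i lo = key_set n R \<omega>' i lo"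
  by (auto simp: key_set_def addresses_def bitstrings_def)

lemma coin_set_cong:
  "(\<And>a. a \<in> addresses n R (2 * i) \<Longrightarrow> \<omega> a = \<omega>' a) \<Longrightarrow> coin_set n R \<omega> i = coin_set n R \<omega>' i"
  by (auto simp: coin_set_def addresses_def)

lemma shuffle_perm_cong:
  assumes "\<And>i a. i \<in> fst ` set rs \<Longrightarrow> a \<in> round_addresses n R i \<Longrightarrow> \<omega> a = \<omega>' a"
  shows "shuffle_perm n R \<omega> rs = shuffle_perm n R \<omega>' rs"
proof
  fix x
  show "shuffle_perm n R \<omega> rs x = shuffle_perm n R \<omega>' rs x"
    using assms
  proof (induction rs arbitrary: x)
    case (Cons q rs)
    obtain i A lo where q: "q = (i, A, lo)" by (cases q)
    have "key_set n R \<omega> i lo = key_set n R \<omega>' i lo" "coin_set n R \<omega> i = coin_set n R \<omega>' i"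
      using Cons.prems[of i] q by (auto intro!: key_set_cong coin_set_cong simp: round_addresses_def)
    moreover have "shuffle_perm n R \<omega> rs y = shuffle_perm n R \<omega>' rs y" for y
      by (rule Cons.IH) (use Cons.prems in auto)
    ultimately show ?case using q by simp
  qed simp
qed

text \<open>Distinct rounds read disjoint sets of addresses, and so do the key and the coins of one
  round. Splitting the random set \<open>w\<close> along the addresses of the first round therefore
  makes its key and coins uniform and independent of the later rounds.\<close>

lemma avg_shuffle_perm:
  assumes "distinct (map fst rs)" "\<And>i. i \<in> fst ` set rs \<Longrightarrow> 2 * i + 1 < R"
    and "finite U" "\<And>i. i \<in> fst ` set rs \<Longrightarrow> round_addresses n R i \<subseteq> U"
  shows "avg (Pow U) (\<lambda>w. h (shuffle_perm n R (\<lambda>a. a \<in> w) rs)) =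
    shuffle_avg xor_mask (bitstrings n) (map (\<lambda>(i, A, lo). (A, Pow {lo..<n})) rs) h"
  using assms
proof (induction rs arbitrary: U h)
  case Nil
  have "shuffle_perm n R \<omega> [] = id" for \<omega> by (simp add: fun_eq_iff)
  then show ?case
    by (simp only: list.map shuffle_avg.simps, intro avg_const) (use Nil in auto)
next
  case (Cons q rs)
  obtain i A lo where q: "q = (i, A, lo)" by (cases q)
  let ?X = "addresses n R (2 * i)" and ?Y = "addresses n R (2 * i + 1)"
  define W where "W = U - ?X - ?Y"
  have iR: "2 * i + 1 < R" using Cons.prems(2)[of i] q by simp
  have XY: "?X \<inter> ?Y = {}" using iR by (intro addresses_disjoint) auto
  have U: "U = (W \<union> ?X) \<union> ?Y"
    using Cons.prems(4)[of i] q by (auto simp: W_def round_addresses_def)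
  have rs: "round_addresses n R k \<inter> (?X \<union> ?Y) = {}" if "k \<in> fst ` set rs" for k
  proof -
    have "k \<noteq> i" using that Cons.prems(1) q by (auto simp: image_iff)
    moreover have "2 * k + 1 < R" using that Cons.prems(2)[of k] by auto
    ultimately show ?thesis using round_addresses_disjoint[of k R i n] by (simp add: round_addresses_def)
  qed
  let ?f = "\<lambda>K B. swap_or_not (xor_mask K) A B"
  define sel where "sel x = {z \<in> bitstrings n. z @ onehot R (2 * i) \<in> x}" for x
  define key where "key y = {k \<in> {lo..<n}. onehot n k @ onehot R (2 * i + 1) \<in> y}" for y
  have split: "shuffle_perm n R (\<lambda>a. a \<in> w \<union> x \<union> y) (q # rs) = shuffle_perm n R (\<lambda>a. a \<in> w) rs \<circ> ?f (key y) (sel x)"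
    if "w \<subseteq> W" "x \<subseteq> ?X" "y \<subseteq> ?Y" for w x y
  proof -
    have "shuffle_perm n R (\<lambda>a. a \<in> w \<union> x \<union> y) rs = shuffle_perm n R (\<lambda>a. a \<in> w) rs"
      using rs that by (intro shuffle_perm_cong) blast
    moreover have "key_set n R (\<lambda>a. a \<in> w \<union> x \<union> y) i lo = key_set n R (\<lambda>a. a \<in> y) i lo"
      using that XY by (intro key_set_cong) (auto simp: W_def)
    moreover have "coin_set n R (\<lambda>a. a \<in> w \<union> x \<union> y) i = coin_set n R (\<lambda>a. a \<in> x) i"
      using that XY by (intro coin_set_cong) (auto simp: W_def)
    ultimately show ?thesis
      by (simp add: q fun_eq_iff key_set_def coin_set_def key_def sel_def)
  qed
  have "avg (Pow U) (\<lambda>w. h (shuffle_perm n R (\<lambda>a. a \<in> w) (q # rs))) =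
     avg (Pow W) (\<lambda>w. avg (Pow ?X) (\<lambda>x. avg (Pow ?Y) (\<lambda>y. h (shuffle_perm n R (\<lambda>a. a \<in> w \<union> x \<union> y) (q # rs)))))"
    unfolding U using XY by (subst avg_Pow_Un, fastforce simp: W_def)+ simp
  also have "\<dots> = avg (Pow W) (\<lambda>w. avg (Pow ?X) (\<lambda>x. avg (Pow ?Y) (\<lambda>y. h (shuffle_perm n R (\<lambda>a. a \<in> w) rs \<circ> ?f (key y) (sel x)))))"
    by (intro avg_cong refl arg_cong[where f = h] split) auto
  also have "\<dots> = avg (Pow W) (\<lambda>w. avg (Pow ?X) (\<lambda>x. avg (Pow {lo..<n}) (\<lambda>K. h (shuffle_perm n R (\<lambda>a. a \<in> w) rs \<circ> ?f K (sel x)))))"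
  proof (rule avg_cong[OF refl], rule avg_cong[OF refl])
    fix w x
    show "avg (Pow ?Y) (\<lambda>y. h (shuffle_perm n R (\<lambda>a. a \<in> w) rs \<circ> ?f (key y) (sel x))) =
        avg (Pow {lo..<n}) (\<lambda>K. h (shuffle_perm n R (\<lambda>a. a \<in> w) rs \<circ> ?f K (sel x)))"
      unfolding key_def
      by (rule avg_Pow_select[OF finite_addresses]) (auto simp: inj_on_def onehot_inject addresses_def bitstrings_def)
  qed
  also have "\<dots> = avg (Pow W) (\<lambda>w. avg (Pow (bitstrings n)) (\<lambda>B. avg (Pow {lo..<n}) (\<lambda>K. h (shuffle_perm n R (\<lambda>a. a \<in> w) rs \<circ> ?f K B))))"
  proof (rule avg_cong[OF refl])
    fix w
    show "avg (Pow ?X) (\<lambda>x. avg (Pow {lo..<n}) (\<lambda>K. h (shuffle_perm n R (\<lambda>a. a \<in> w) rs \<circ> ?f K (sel x)))) =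
        avg (Pow (bitstrings n)) (\<lambda>B. avg (Pow {lo..<n}) (\<lambda>K. h (shuffle_perm n R (\<lambda>a. a \<in> w) rs \<circ> ?f K B)))"
      unfolding sel_def
      by (rule avg_Pow_select[OF finite_addresses]) (auto simp: inj_on_def addresses_def)
  qed
  also have "\<dots> = avg (Pow {lo..<n}) (\<lambda>K. avg (Pow (bitstrings n)) (\<lambda>B. avg (Pow W) (\<lambda>w. h (shuffle_perm n R (\<lambda>a. a \<in> w) rs \<circ> ?f K B))))"
  proof -
    have "avg (Pow W) (\<lambda>w. avg (Pow (bitstrings n)) (\<lambda>B. avg (Pow {lo..<n}) (\<lambda>K. F w B K))) =
      avg (Pow {lo..<n}) (\<lambda>K. avg (Pow (bitstrings n)) (\<lambda>B. avg (Pow W) (\<lambda>w. F w B K)))" for F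
      by (simp add: avg_swap[of "Pow W"] avg_swap[of "Pow (bitstrings n)" "Pow {lo..<n}"])
    then show ?thesis .
  qed
  also have "\<dots> = avg (Pow {lo..<n}) (\<lambda>K. avg (Pow (bitstrings n)) (\<lambda>B.
      shuffle_avg xor_mask (bitstrings n) (map (\<lambda>(i, A, lo). (A, Pow {lo..<n})) rs) (\<lambda>\<sigma>. h (\<sigma> \<circ> ?f K B))))"
  proof (intro avg_cong refl Cons.IH)
    show "round_addresses n R k \<subseteq> W" if "k \<in> fst ` set rs" for k
      using Cons.prems(4)[of k] that rs[OF that] by (auto simp: W_def)
  qed (use Cons.prems in \<open>auto simp: W_def\<close>)
  finally show ?case unfolding q list.map prod.case shuffle_avg.simps .
qed

lemma rounds_levels: "map (\<lambda>(i, A, lo). (A, Pow {lo..<n})) (rounds n w Z b t J) = levels n w Z t J"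
  by (simp add: rounds_def levels_def level_def map_concat comp_def map_replicate_const)

lemma rounds_indices: "fst ` set (rounds n w Z b t J) \<subseteq> {b * t..<(b + J) * t}"
proof -
  have "(b + j) * t + s < (b + J) * t" if "j < J" "s < t" for j s
  proof -
    have "(b + j) * t + s < (b + j + 1) * t" using that by simp
    also have "\<dots> \<le> (b + J) * t" using that by (intro mult_le_mono1) simp
    finally show ?thesis .
  qed
  moreover have "b * t \<le> (b + j) * t + s" for j s by (simp add: algebra_simps)
  ultimately show ?thesis by (auto simp: rounds_def)
qed

lemma distinct_rounds: "distinct (map fst (rounds n w Z b t J))"
proof (induction J)
  case (Suc J)
  have "rounds n w Z b t (Suc J) = map (\<lambda>s. ((b + J) * t + s, active n w Z J, w + J)) [0..<t] @ rounds n w Z b t J"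
    by (simp add: rounds_def)
  with Suc show ?case
    using rounds_indices[of n w Z b t J] by (fastforce simp: distinct_map inj_on_def)
qed (simp add: rounds_def)

text \<open>The offset \<open>n\<close> gives the outer rounds indices from \<open>n * t\<close> on,
  while those of the inner rounds lie below; hence the two shuffles read disjoint parts
  \<open>U2\<close> and \<open>U1\<close> of the random function and are independent.\<close>

lemma avg_sim_perm:
  assumes R: "R = 2 * (2 * (r + c) * t)" and n: "n = r + c"
  shows "avg (Pow (bitstrings (n + R))) (\<lambda>w. h (sim_perm r c R t f (\<lambda>a. a \<in> w))) =
    shuffle_avg xor_mask (bitstrings n) (levels n 0 (padded r c) t (n - 1)) (\<lambda>\<kappa>.
      shuffle_avg xor_mask (bitstrings n) (levels n r {} t c) (\<lambda>\<tau>. h (\<tau> \<circ> feistel_perm r c f \<circ> \<kappa>)))"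
proof -
  let ?K = "rounds n 0 (padded r c) 0 t (n - 1)" and ?T = "rounds n r {} n t c"
  let ?g = "feistel_perm r c f"
  define U1 where "U1 = (\<Union>i\<in>fst ` set ?K. round_addresses n R i)"
  define U2 where "U2 = bitstrings (n + R) - U1"
  have U: "bitstrings (n + R) = U1 \<union> U2" "U1 \<inter> U2 = {}"
    using round_addresses_subset by (auto simp: U1_def U2_def)
  have fin: "finite U1" "finite U2" using finite_bitstrings[of "n + R"] U by (metis finite_Un)+
  have iK: "i < n * t" if "i \<in> fst ` set ?K" for i
  proof -
    have "i < (0 + (n - 1)) * t" using that rounds_indices[of n 0 "padded r c" 0 t "n - 1"] by (auto simp: subset_iff)
    also have "\<dots> \<le> n * t" by (intro mult_le_mono1) simp
    finally show ?thesis .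
  qed
  have iT: "n * t \<le> i" "i < 2 * n * t" if "i \<in> fst ` set ?T" for i
  proof -
    have "n * t \<le> i" "i < (n + c) * t" using that rounds_indices[of n r "{}" n t c] by (auto simp: subset_iff)
    moreover have "(n + c) * t \<le> 2 * n * t" using n by (intro mult_le_mono1) simp
    ultimately show "n * t \<le> i" "i < 2 * n * t" by linarith+
  qed
  have small: "2 * i + 1 < R" if "i < 2 * n * t" for i
    by (rule double_less[of _ "2 * n * t"]) (use that R n in simp_all)
  have iK2: "i < 2 * n * t" if "i \<in> fst ` set ?K" for i
    using iK[OF that] by (rule order_less_le_trans) simp
  have T2: "round_addresses n R i \<subseteq> U2" if "i \<in> fst ` set ?T" for i
  proof -
    have "round_addresses n R i \<inter> round_addresses n R k = {}" if "k \<in> fst ` set ?K" for k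
      using iT[OF \<open>i \<in> _\<close>] iK[OF that] small by (intro round_addresses_disjoint) auto
    then show ?thesis using round_addresses_subset[of n R i] by (auto simp: U1_def U2_def)
  qed
  have split: "sim_perm r c R t f (\<lambda>a. a \<in> u \<union> v) =
      shuffle_perm n R (\<lambda>a. a \<in> v) ?T \<circ> ?g \<circ> shuffle_perm n R (\<lambda>a. a \<in> u) ?K"
    if "u \<subseteq> U1" "v \<subseteq> U2" for u v
  proof -
    have "shuffle_perm n R (\<lambda>a. a \<in> u \<union> v) ?T = shuffle_perm n R (\<lambda>a. a \<in> v) ?T"
      using that T2 U(2) by (intro shuffle_perm_cong) blast
    moreover have "shuffle_perm n R (\<lambda>a. a \<in> u \<union> v) ?K = shuffle_perm n R (\<lambda>a. a \<in> u) ?K"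
      using that U(2) by (intro shuffle_perm_cong) (auto simp: U1_def)
    ultimately show ?thesis unfolding sim_perm_def n[symmetric] by simp
  qed
  have "avg (Pow (bitstrings (n + R))) (\<lambda>w. h (sim_perm r c R t f (\<lambda>a. a \<in> w))) =
      avg (Pow U1) (\<lambda>u. avg (Pow U2) (\<lambda>v. h (sim_perm r c R t f (\<lambda>a. a \<in> u \<union> v))))"
    unfolding U(1) by (rule avg_Pow_Un[OF U(2)])
  also have "\<dots> = avg (Pow U1) (\<lambda>u. avg (Pow U2) (\<lambda>v. h (shuffle_perm n R (\<lambda>a. a \<in> v) ?T \<circ> ?g \<circ> shuffle_perm n R (\<lambda>a. a \<in> u) ?K)))"
    by (intro avg_cong refl arg_cong[where f = h] split) auto
  also have "\<dots> = avg (Pow U1) (\<lambda>u. shuffle_avg xor_mask (bitstrings n) (levels n r {} t c)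
      (\<lambda>\<tau>. h (\<tau> \<circ> ?g \<circ> shuffle_perm n R (\<lambda>a. a \<in> u) ?K)))"
    unfolding rounds_levels[of n r "{}" n t c, symmetric]
    by (intro avg_cong refl avg_shuffle_perm[where h = "\<lambda>\<tau>. h (\<tau> \<circ> ?g \<circ> \<kappa>)" for \<kappa>])
      (use iT small T2 fin distinct_rounds in auto)
  also have "\<dots> = shuffle_avg xor_mask (bitstrings n) (levels n 0 (padded r c) t (n - 1)) (\<lambda>\<kappa>.
      shuffle_avg xor_mask (bitstrings n) (levels n r {} t c) (\<lambda>\<tau>. h (\<tau> \<circ> ?g \<circ> \<kappa>)))"
    unfolding rounds_levels[of n 0 "padded r c" 0 t "n - 1", symmetric]
    by (rule avg_shuffle_perm[where h = "\<lambda>\<kappa>. shuffle_avg xor_mask (bitstrings n) (levels n r {} t c) (\<lambda>\<tau>. h (\<tau> \<circ> ?g \<circ> \<kappa>))"])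
      (use iK2 small fin distinct_rounds in \<open>auto simp: U1_def\<close>)
  finally show ?thesis .
qed

text \<open>A string of length \<open>2 ^ l\<close> is the truth table of a set of addresses. The
  binary digits of \<open>k\<close> form an address at which bit \<open>k\<close> can be read off,
  which gives injectivity, and surjectivity follows by counting.\<close>

lemma bij_betw_coin_at:
  "bij_betw (\<lambda>sr. {a \<in> bitstrings l. coin_at sr a}) (bitstrings (2 ^ l)) (Pow (bitstrings l))"
proof -
  have inj: "inj_on (\<lambda>sr. {a \<in> bitstrings l. coin_at sr a}) (bitstrings (2 ^ l))"
  proof (rule inj_onI, rule nth_equalityI)
    fix sr sr' assume sr: "sr \<in> bitstrings (2 ^ l)" "sr' \<in> bitstrings (2 ^ l)"
      and eq: "{a \<in> bitstrings l. coin_at sr a} = {a \<in> bitstrings l. coin_at sr' a}"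
    then show "length sr = length sr'" by (simp add: bitstrings_def)
    fix k assume "k < length sr"
    then have k: "k < 2 ^ l" using sr by (simp add: bitstrings_def)
    define a where "a = map (bit k) [0..<l]"
    have "horner_sum of_bool 2 a = k"
      using k by (simp add: a_def horner_sum_bit_eq_take_bit take_bit_nat_eq_self)
    then have "coin_at s a \<longleftrightarrow> s ! k" if "s \<in> bitstrings (2 ^ l)" for s
      using that k by (simp add: coin_at_def bitstrings_def)
    moreover have "a \<in> bitstrings l" by (simp add: a_def bitstrings_def)
    ultimately show "sr ! k = sr' ! k" using eq sr by blast
  qed
  have "(\<lambda>sr. {a \<in> bitstrings l. coin_at sr a}) ` bitstrings (2 ^ l) = Pow (bitstrings l)"
    by (rule card_subset_eq) (auto simp: card_image[OF inj] card_Pow card_bitstrings)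
  with inj show ?thesis by (simp add: bij_betw_def)
qed

text \<open>The inner and then the outer shuffle are replaced by exactly uniform permutations, each
  at the cost \<open>1 / 2 ^ n\<close>; \<open>avg_double_coset\<close> identifies the
  result.\<close>

lemma sim_perm_near_uniform:
  assumes r: "0 < r" "r \<le> c" and f: "f \<in> bitstrings r \<rightarrow>\<^sub>E bitstrings r" and h: "\<And>\<phi>. \<bar>h \<phi>\<bar> \<le> 1"
    and t: "t = 48 * (r + c)" and R: "R = 2 * (2 * (r + c) * t)"
  shows "\<bar>avg (bitstrings (2 ^ (r + c + R))) (\<lambda>sr. h (sim_perm r c R t f (coin_at sr))) - avg (prescribed r c f) h\<bar>
    \<le> 2 / 2 ^ (r + c)"
proof -
  define n where "n = r + c"
  let ?V = "bitstrings n" and ?g = "feistel_perm r c f"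
  let ?G = "block_perms (take r) ?V" and ?H = "{\<pi>. \<pi> permutes ?V - padded r c}"
  let ?SK = "shuffle_avg xor_mask ?V (levels n 0 (padded r c) t (n - 1))"
  let ?ST = "shuffle_avg xor_mask ?V (levels n r {} t c)"
  \<comment> \<open>All addresses in use have length \<open>n + R\<close>, so
    \<open>coin_at sr\<close> may be cut down to these.\<close>
  have "sim_perm r c R t f (coin_at sr) = sim_perm r c R t f (\<lambda>a. a \<in> {a \<in> bitstrings (n + R). coin_at sr a})" for sr
    unfolding sim_perm_def n_def[symmetric] using round_addresses_subset[of n R]
    by (intro arg_cong2[where f = "(\<circ>)"] shuffle_perm_cong refl) auto
  then have "avg (bitstrings (2 ^ (r + c + R))) (\<lambda>sr. h (sim_perm r c R t f (coin_at sr))) =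
      avg (bitstrings (2 ^ (n + R))) (\<lambda>sr. h (sim_perm r c R t f (\<lambda>a. a \<in> {a \<in> bitstrings (n + R). coin_at sr a})))"
    by (simp only: n_def)
  also have "\<dots> = avg (Pow (bitstrings (n + R))) (\<lambda>w. h (sim_perm r c R t f (\<lambda>a. a \<in> w)))"
    by (rule avg_bij_betw[OF bij_betw_coin_at, symmetric])
  also have "\<dots> = ?SK (\<lambda>\<kappa>. ?ST (\<lambda>\<tau>. h (\<tau> \<circ> ?g \<circ> \<kappa>)))"
    by (rule avg_sim_perm[OF R n_def])
  finally have eq: "avg (bitstrings (2 ^ (r + c + R))) (\<lambda>sr. h (sim_perm r c R t f (coin_at sr))) = \<dots>" .
  have tn: "t = 48 * n" by (simp add: t n_def)
  have 1: "\<bar>?SK (\<lambda>\<kappa>. ?ST (\<lambda>\<tau>. h (\<tau> \<circ> ?g \<circ> \<kappa>))) - avg ?H (\<lambda>\<kappa>. ?ST (\<lambda>\<tau>. h (\<tau> \<circ> ?g \<circ> \<kappa>)))\<bar> \<le> 1 / 2 ^ n"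
    unfolding tn using r by (intro levels_near_uniform_inner shuffle_avg_abs_le h n_def) simp
  have 2: "\<bar>avg ?H (\<lambda>\<kappa>. ?ST (\<lambda>\<tau>. h (\<tau> \<circ> ?g \<circ> \<kappa>))) - avg ?H (\<lambda>\<kappa>. avg ?G (\<lambda>\<tau>. h (\<tau> \<circ> ?g \<circ> \<kappa>)))\<bar> \<le> 1 / 2 ^ n"
    unfolding tn by (intro avg_diff_abs_le levels_near_uniform_outer h n_def) simp
  have "avg ?H (\<lambda>\<kappa>. avg ?G (\<lambda>\<tau>. h (\<tau> \<circ> ?g \<circ> \<kappa>))) = avg ?G (\<lambda>\<tau>. avg ?H (\<lambda>\<kappa>. h (\<tau> \<circ> ?g \<circ> \<kappa>)))"
    by (rule avg_swap)
  also have "\<dots> = avg (prescribed r c f) h"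
    unfolding n_def using r f by (intro avg_double_coset feistel_perm_permutes Sp_feistel_perm)
  finally show ?thesis using 1 2 unfolding eq n_def by linarith
qed

section \<open>Programs for the circuits\<close>

text \<open>De Bruijn shift for an expression that moves under one more loop.\<close>

primrec lift :: "aexp \<Rightarrow> aexp" where
  "lift (Const k) = Const k"
| "lift (Var i) = Var (Suc i)"
| "lift (Plus d e) = Plus (lift d) (lift e)"
| "lift (Minus d e) = Minus (lift d) (lift e)"
| "lift (Times d e) = Times (lift d) (lift e)"
| "lift (Div d e) = Div (lift d) (lift e)"

lemma aval_lift [simp]: "aval (i # env) (lift e) = aval env e"
  by (induction e) auto

text \<open>Gates are kept and only their order is reversed; as well-formed classical gates are
  involutions, this inverts the circuit.\<close>

primrec rev_prog :: "prog \<Rightarrow> prog" where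
  "rev_prog Skip = Skip"
| "rev_prog (Emit g) = Emit g"
| "rev_prog (Seq p q) = Seq (rev_prog q) (rev_prog p)"
| "rev_prog (IfLess d e p q) = IfLess d e (rev_prog p) (rev_prog q)"
| "rev_prog (For e p) = ForDown e (rev_prog p)"
| "rev_prog (ForDown e p) = For e (rev_prog p)"

lemma unroll_rev_prog [simp]: "unroll (rev_prog p) env = rev (unroll p env)"
  by (induction p arbitrary: env) (auto simp: rev_concat rev_map comp_def)

definition seqs :: "prog list \<Rightarrow> prog" where
  "seqs ps = foldr Seq ps Skip"

lemma unroll_seqs [simp]: "unroll (seqs ps) env = concat (map (\<lambda>p. unroll p env) ps)"
  by (induction ps) (auto simp: seqs_def)

definition cnots_prog :: "aexp \<Rightarrow> aexp \<Rightarrow> aexp \<Rightarrow> prog" where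
  "cnots_prog a b k = For k (Emit (CNot (Plus (lift a) (Var 0)) (Plus (lift b) (Var 0))))"

lemma unroll_cnots_prog [simp]:
  "unroll (cnots_prog a b k) env = cnots (aval env a) (aval env b) (aval env k)"
  by (simp add: cnots_prog_def cnots_def concat_map_singleton)

definition toffolis_prog :: "aexp \<Rightarrow> aexp \<Rightarrow> aexp \<Rightarrow> aexp \<Rightarrow> prog" where
  "toffolis_prog s a b k = For k (Emit (Toffoli (lift s) (Plus (lift a) (Var 0)) (Plus (lift b) (Var 0))))"

lemma unroll_toffolis_prog [simp]:
  "unroll (toffolis_prog s a b k) env = toffolis (aval env s) (aval env a) (aval env b) (aval env k)"
  by (simp add: toffolis_prog_def toffolis_def concat_map_singleton)

definition zero_chain_prog :: "aexp \<Rightarrow> aexp \<Rightarrow> aexp \<Rightarrow> prog" where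
  "zero_chain_prog q a k = For k (seqs (map Emit
     [Flip (Plus (lift a) (Var 0)),
      Toffoli (Plus (lift q) (Var 0)) (Plus (lift a) (Var 0)) (Plus (Plus (lift q) (Var 0)) (Const 1)),
      Flip (Plus (lift a) (Var 0))]))"

lemma unroll_zero_chain_prog [simp]:
  "unroll (zero_chain_prog q a k) env = zero_chain (aval env q) (aval env a) (aval env k)"
  by (simp add: zero_chain_prog_def zero_chain_def)

text \<open>The wire positions take \<open>r\<close>, \<open>c\<close> and \<open>R\<close> as
  expressions, because the de Bruijn indices of the parameters depend on the number of enclosing
  loops.\<close>

definition "eN er ec = Plus er ec"
definition "eAR er ec = Times (Const 2) (Plus er ec)"
definition "eO1 er ec = Times (Const 3) (Plus er ec)"
definition "eKA er ec eR = Plus (Times (Const 3) (Plus er ec)) eR"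
definition "eO2 er ec eR = Plus (Times (Const 4) (Plus er ec)) eR"
definition "eKR er ec eR = Plus (Times (Const 4) (Plus er ec)) (Times (Const 2) eR)"
definition "eFlag er ec eR k = Plus (Plus (Times (Const 5) (Plus er ec)) (Times (Const 2) eR)) (Const k)"

definition read_coin_prog :: "aexp \<Rightarrow> aexp \<Rightarrow> aexp \<Rightarrow> aexp \<Rightarrow> prog" where
  "read_coin_prog er ec eR i = seqs (map Emit
     [Flip (Plus (eO1 er ec) i), Coin (eAR er ec) (Plus (eN er ec) eR) (eFlag er ec eR 3), Flip (Plus (eO1 er ec) i)])"

definition read_key_prog :: "aexp \<Rightarrow> aexp \<Rightarrow> aexp \<Rightarrow> aexp \<Rightarrow> aexp \<Rightarrow> prog" where
  "read_key_prog er ec eR lo i = For (Minus (eN er ec) lo) (seqs (map Emit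
     [Flip (Plus (lift (eKA er ec eR)) (Plus (lift lo) (Var 0))), Flip (Plus (lift (eO2 er ec eR)) (lift i)),
      Coin (lift (eKA er ec eR)) (lift (Plus (eN er ec) eR)) (Plus (lift (eKR er ec eR)) (Plus (lift lo) (Var 0))),
      Flip (Plus (lift (eO2 er ec eR)) (lift i)), Flip (Plus (lift (eKA er ec eR)) (Plus (lift lo) (Var 0)))]))"

definition test_prog :: "prog \<Rightarrow> aexp list \<Rightarrow> aexp \<Rightarrow> prog" where
  "test_prog C outs d = seqs [C, seqs (map (\<lambda>q. Emit (CNot q d)) outs), rev_prog C]"

definition compare_prog :: "aexp \<Rightarrow> aexp \<Rightarrow> aexp \<Rightarrow> prog \<Rightarrow> aexp list \<Rightarrow> aexp \<Rightarrow> prog" where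
  "compare_prog er ec eR C outs i = seqs
     [test_prog C outs (eFlag er ec eR 0), read_coin_prog er ec eR (Times (Const 2) i),
      cnots_prog (eKR er ec eR) (eAR er ec) (eN er ec),
      test_prog C outs (eFlag er ec eR 1), read_coin_prog er ec eR (Times (Const 2) i),
      Emit (Toffoli (eFlag er ec eR 0) (eFlag er ec eR 1) (eFlag er ec eR 2))]"

definition decide_prog :: "aexp \<Rightarrow> aexp \<Rightarrow> aexp \<Rightarrow> prog \<Rightarrow> aexp list \<Rightarrow> aexp \<Rightarrow> prog" where
  "decide_prog er ec eR C outs i = seqs
     [compare_prog er ec eR C outs i, Emit (Toffoli (eFlag er ec eR 2) (eFlag er ec eR 3) (eFlag er ec eR 4)),
      rev_prog (compare_prog er ec eR C outs i)]"

definition round_prog :: "aexp \<Rightarrow> aexp \<Rightarrow> aexp \<Rightarrow> prog \<Rightarrow> aexp list \<Rightarrow> aexp \<Rightarrow> aexp \<Rightarrow> prog" where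
  "round_prog er ec eR C outs lo i = seqs
     [read_key_prog er ec eR lo (Plus (Times (Const 2) i) (Const 1)), decide_prog er ec eR C outs i,
      toffolis_prog (eFlag er ec eR 4) (eKR er ec eR) (eAR er ec) (eN er ec), decide_prog er ec eR C outs i,
      rev_prog (read_key_prog er ec eR lo (Plus (Times (Const 2) i) (Const 1)))]"

definition outer_chain_prog :: "aexp \<Rightarrow> aexp \<Rightarrow> aexp \<Rightarrow> aexp \<Rightarrow> prog" where
  "outer_chain_prog er ec eR j = Seq (Emit (Flip (eFlag er ec eR 5)))
     (zero_chain_prog (eFlag er ec eR 5) (Plus (eAR er ec) er) j)"

definition inner_chain_prog :: "aexp \<Rightarrow> aexp \<Rightarrow> aexp \<Rightarrow> aexp \<Rightarrow> prog" where
  "inner_chain_prog er ec eR j = seqs [Emit (Flip (eFlag er ec eR 5)),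
     zero_chain_prog (eFlag er ec eR 5) (eAR er ec) j,
     zero_chain_prog (Plus (eFlag er ec eR 5) j) (Plus (eAR er ec) er) ec]"

text \<open>Inside the two loops \<open>Var 1\<close> is the level and \<open>Var 0\<close> the
  round within it; \<open>ForDown\<close> starts with the smallest active set.\<close>

definition inner_prog :: "aexp \<Rightarrow> aexp \<Rightarrow> aexp \<Rightarrow> aexp \<Rightarrow> prog" where
  "inner_prog er ec eR eT =
     (let er' = lift (lift er); ec' = lift (lift ec); eR' = lift (lift eR); eT' = lift (lift eT) in
      ForDown (Minus (eN er ec) (Const 1)) (For (lift eT)
        (round_prog er' ec' eR' (inner_chain_prog er' ec' eR' (Var 1))
           [Plus (eFlag er' ec' eR' 5) (Var 1), Plus (Plus (eFlag er' ec' eR' 5) (Var 1)) ec']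
           (Plus (Const 0) (Var 1)) (Plus (Times (Plus (Const 0) (Var 1)) eT') (Var 0)))))"

definition outer_prog :: "aexp \<Rightarrow> aexp \<Rightarrow> aexp \<Rightarrow> aexp \<Rightarrow> prog" where
  "outer_prog er ec eR eT =
     (let er' = lift (lift er); ec' = lift (lift ec); eR' = lift (lift eR); eT' = lift (lift eT) in
      ForDown ec (For (lift eT)
        (round_prog er' ec' eR' (outer_chain_prog er' ec' eR' (Var 1))
           [Plus (eFlag er' ec' eR' 5) (Var 1)]
           (Plus er' (Var 1)) (Plus (Times (Plus (eN er' ec') (Var 1)) eT') (Var 0)))))"

definition feistel_prog :: "aexp \<Rightarrow> aexp \<Rightarrow> prog" where
  "feistel_prog er ec = seqs [cnots_prog (eAR er ec) (Plus (eAR er ec) er) er,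
     cnots_prog (Plus (eAR er ec) er) (eAR er ec) er, Emit (Pub (Plus (eAR er ec) er) (eAR er ec))]"

definition perm_prog :: "aexp \<Rightarrow> aexp \<Rightarrow> aexp \<Rightarrow> aexp \<Rightarrow> prog" where
  "perm_prog er ec eR eT = seqs [inner_prog er ec eR eT, feistel_prog er ec, outer_prog er ec eR eT]"

definition query_prog :: "aexp \<Rightarrow> aexp \<Rightarrow> prog \<Rightarrow> prog \<Rightarrow> prog" where
  "query_prog er ec G G' = seqs [cnots_prog (Const 0) (eAR er ec) (eN er ec), G,
     cnots_prog (eAR er ec) (eN er ec) (eN er ec), G', cnots_prog (Const 0) (eAR er ec) (eN er ec)]"

context layout
begin

context
  fixes env :: "nat list" and er ec eR :: aexp
  assumes env: "aval env er = r" "aval env ec = c" "aval env eR = R"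
begin

lemma aval_wires [simp]:
  "aval env (eN er ec) = r + c" "aval env (eAR er ec) = wAR" "aval env (eO1 er ec) = wO1"
  "aval env (eKA er ec eR) = wKA" "aval env (eO2 er ec eR) = wO2" "aval env (eKR er ec eR) = wKR"
  "aval env (eFlag er ec eR 0) = wD1" "aval env (eFlag er ec eR (Suc 0)) = wD2" "aval env (eFlag er ec eR 2) = wD3"
  "aval env (eFlag er ec eR 3) = wE" "aval env (eFlag er ec eR 4) = wS" "aval env (eFlag er ec eR 5) = wQ"
  by (simp_all add: env eN_def eAR_def eO1_def eKA_def eO2_def eKR_def eFlag_def flag_wires)

lemma unroll_read_coin_prog [simp]: "unroll (read_coin_prog er ec eR i) env = read_coin (aval env i)"
  by (simp add: read_coin_prog_def read_coin_def env)

lemma unroll_read_key_prog [simp]: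
  "unroll (read_key_prog er ec eR lo i) env = read_key (aval env lo) (aval env i)"
  by (simp add: read_key_prog_def read_key_def env)

lemma unroll_test_prog [simp]:
  "unroll (test_prog C outs d) env = test (unroll C env) (map (aval env) outs) (aval env d)"
  by (simp add: test_prog_def test_def concat_map_singleton comp_def)

lemma unroll_compare_prog [simp]:
  "unroll (compare_prog er ec eR C outs i) env = compare (unroll C env) (map (aval env) outs) (aval env i)"
  by (simp add: compare_prog_def compare_def xor_key_def)

lemma unroll_decide_prog [simp]:
  "unroll (decide_prog er ec eR C outs i) env = decide (unroll C env) (map (aval env) outs) (aval env i)"
  by (simp add: decide_prog_def decide_def)

lemma unroll_round_prog [simp]:
  "unroll (round_prog er ec eR C outs lo i) env =
     round_gates (unroll C env) (map (aval env) outs) (aval env lo) (aval env i)"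
  by (simp add: round_prog_def round_gates_def)

lemma unroll_outer_chain_prog [simp]:
  "unroll (outer_chain_prog er ec eR j) env = outer_chain (aval env j)"
  by (simp add: outer_chain_prog_def outer_chain_def env)

lemma unroll_inner_chain_prog [simp]:
  "unroll (inner_chain_prog er ec eR j) env = inner_chain (aval env j)"
  by (simp add: inner_chain_prog_def inner_chain_def env)

lemma unroll_feistel_prog [simp]: "unroll (feistel_prog er ec) env = feistel_gates"
  by (simp add: feistel_prog_def feistel_gates_def env)

lemma unroll_query_prog [simp]:
  "unroll (query_prog er ec G G') env = query_gates (unroll G env) (unroll G' env)"
  by (simp add: query_prog_def query_gates_def)

end

lemma unroll_perm_prog:
  assumes env: "aval env er = r" "aval env ec = c" "aval env eR = R" "aval env eT = t"
  shows "unroll (perm_prog er ec eR eT) env = perm_gates t"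
proof -
  have e: "aval (s # j # env) (lift (lift er)) = r" "aval (s # j # env) (lift (lift ec)) = c"
    "aval (s # j # env) (lift (lift eR)) = R" "aval (s # j # env) (lift (lift eT)) = t" for s j
    using env by simp_all
  note E = e(1-3)
  have "unroll (inner_prog er ec eR eT) env = inner_gates t"
    unfolding inner_prog_def inner_gates_def Let_def
    by (simp add: unroll_round_prog[OF E] unroll_inner_chain_prog[OF E] aval_wires[OF E] aval_wires[OF env(1-3)] env)
  moreover have "unroll (outer_prog er ec eR eT) env = outer_gates t"
    unfolding outer_prog_def outer_gates_def Let_def
    by (simp add: unroll_round_prog[OF E] unroll_outer_chain_prog[OF E] aval_wires[OF E] env)
  ultimately show ?thesis
    by (simp add: perm_prog_def perm_gates_def unroll_feistel_prog[OF env(1-3)])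
qed

end

section \<open>Polynomial bounds on the size of the circuits\<close>

lemma length_concat_map_le:
  assumes "\<And>x. x \<in> set xs \<Longrightarrow> length (f x) \<le> k"
  shows "length (concat (map f xs)) \<le> length xs * k"
  using assms
proof (induction xs)
  case (Cons x xs)
  then have "length (f x) \<le> k" "length (concat (map f xs)) \<le> length xs * k" by auto
  then show ?case by simp
qed simp

context layout
begin

lemma length_zero_chain [simp]: "length (zero_chain q a k) = 3 * k"
  by (simp add: zero_chain_def length_concat comp_def sum_list_triv)

lemma length_read_key: "length (read_key lo i) \<le> 5 * n"
proof -
  have "length (read_key lo i) = 5 * (r + c - lo)"
    by (simp add: read_key_def length_concat comp_def sum_list_triv)
  then show ?thesis by simp
qed

text \<open>A round runs \<open>compare\<close> four times, forwards or backwards, and each run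
  contains two tests that compute and uncompute a chain. This makes up \<open>100 * n\<close> of the
  bound; reading and clearing the key takes \<open>10 * n\<close> and the controlled XOR
  \<open>n\<close>.\<close>

lemma length_round_gates:
  assumes "length C \<le> 6 * n + 1" "length outs \<le> 2"
  shows "length (round_gates C outs lo i) \<le> 111 * n + 62"
proof -
  have "length (compare C outs i) \<le> 25 * n + 15"
    using assms by (simp add: compare_def test_def read_coin_def xor_key_def cnots_def)
  then have "length (decide C outs i) \<le> 50 * n + 31"
    by (simp add: decide_def)
  then show ?thesis
    using length_read_key[of lo "2 * i + 1"] by (simp add: round_gates_def toffolis_def)
qed

lemma length_perm_gates: "length (perm_gates t) \<le> 2 * n * (t * (111 * n + 62)) + 2 * n + 1"
proof -
  have 1: "length (inner_gates t) \<le> length (rev [0..<r + c - 1]) * (t * (111 * n + 62))"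
    unfolding inner_gates_def
  proof (rule length_concat_map_le)
    fix j assume "j \<in> set (rev [0..<r + c - 1])"
    then have "length (inner_chain j) \<le> 6 * n + 1" by (simp add: inner_chain_def)
    then have "length (concat (map (\<lambda>s. round_gates (inner_chain j) [wQ + j, wQ + j + c] (0 + j) ((0 + j) * t + s)) [0..<t]))
        \<le> length [0..<t] * (111 * n + 62)"
      by (intro length_concat_map_le length_round_gates) auto
    then show "length (concat (map (\<lambda>s. round_gates (inner_chain j) [wQ + j, wQ + j + c] (0 + j) ((0 + j) * t + s)) [0..<t]))
        \<le> t * (111 * n + 62)" by simp
  qed
  have 2: "length (outer_gates t) \<le> length (rev [0..<c]) * (t * (111 * n + 62))"
    unfolding outer_gates_def
  proof (rule length_concat_map_le)
    fix j assume "j \<in> set (rev [0..<c])"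
    then have "length (outer_chain j) \<le> 6 * n + 1" by (simp add: outer_chain_def)
    then have "length (concat (map (\<lambda>s. round_gates (outer_chain j) [wQ + j] (r + j) ((r + c + j) * t + s)) [0..<t]))
        \<le> length [0..<t] * (111 * n + 62)"
      by (intro length_concat_map_le length_round_gates) auto
    then show "length (concat (map (\<lambda>s. round_gates (outer_chain j) [wQ + j] (r + j) ((r + c + j) * t + s)) [0..<t]))
        \<le> t * (111 * n + 62)" by simp
  qed
  have 3: "length feistel_gates \<le> 2 * n + 1" by (simp add: feistel_gates_def cnots_def)
  have "length (rev [0..<r + c - 1]) * (t * (111 * n + 62)) \<le> n * (t * (111 * n + 62))"
    by (intro mult_le_mono1) simp
  moreover have "length (rev [0..<c]) * (t * (111 * n + 62)) \<le> n * (t * (111 * n + 62))"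
    by (intro mult_le_mono1) simp
  ultimately have "length (inner_gates t) + length (outer_gates t) \<le> 2 * (n * (t * (111 * n + 62)))"
    using 1 2 by linarith
  then have "length (inner_gates t) + length (outer_gates t) \<le> 2 * n * (t * (111 * n + 62))"
    by (simp only: mult.assoc)
  moreover have "length (perm_gates t) = length (inner_gates t) + length (outer_gates t) + length feistel_gates"
    by (simp add: perm_gates_def)
  ultimately show ?thesis using 3 by linarith
qed

lemma length_query_gates: "length (query_gates G G') = length G + length G' + 3 * n"
  by (simp add: query_gates_def cnots_def)

lemma wf_query_gates:
  assumes "\<And>g. g \<in> set G \<Longrightarrow> wfg g" "\<And>g. g \<in> set G' \<Longrightarrow> wfg g" "g \<in> set (query_gates G G')"
  shows "wfg g"
  using assms by (fastforce simp: query_gates_def cnots_def)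

end

section \<open>The simulator\<close>

definition round_count :: "nat \<Rightarrow> nat" where
  "round_count n = 48 * n"

definition index_count :: "nat \<Rightarrow> nat" where
  "index_count n = 2 * (2 * n * round_count n)"

definition sim_perm_prog :: prog where
  "sim_perm_prog = (let n = Plus (Var 0) (Var 1); t = Times (Const 48) n;
     R = Times (Const 2) (Times (Times (Const 2) n) t) in perm_prog (Var 0) (Var 1) R t)"

text \<open>The highest wire is the end \<open>wQ + 2 * n\<close> of the chain, so
  \<open>7 * n + 2 * R + 6\<close> wires are needed, of which \<open>2 * n\<close> hold query and
  answer. The shared string is a truth table over addresses of \<open>n + R\<close> bits.\<close>

definition sponge_simulator :: simulator where
  "sponge_simulator = Simulator
     (query_prog (Var 0) (Var 1) sim_perm_prog (rev_prog sim_perm_prog))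
     (query_prog (Var 0) (Var 1) (rev_prog sim_perm_prog) sim_perm_prog)
     (let n = Plus (Var 0) (Var 1); t = Times (Const 48) n;
        R = Times (Const 2) (Times (Times (Const 2) n) t)
      in Plus (Plus (Times (Const 5) n) (Times (Const 2) R)) (Const 6))
     (\<lambda>r c. 2 ^ (r + c + index_count (r + c)))"

lemma anc_sponge_simulator: "anc sponge_simulator r c = 5 * (r + c) + 2 * index_count (r + c) + 6"
  by (simp add: anc_def sponge_simulator_def index_count_def round_count_def Let_def)

abbreviation "sim_gates r c \<equiv> layout.perm_gates r c (index_count (r + c)) (round_count (r + c))"

text \<open>Supplies a memory for statements about the circuits themselves rather than about their
  runs.\<close>

lemma layout_zero: "layout r c (\<lambda>_. False)"
  by unfold_locales simp

lemma unroll_sim_perm_prog: "unroll sim_perm_prog [r, c] = sim_gates r c"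
proof -
  interpret layout r c "index_count (r + c)" f sr "\<lambda>_. False" for f sr by (rule layout_zero)
  show ?thesis
    unfolding sim_perm_prog_def Let_def
    by (rule unroll_perm_prog) (simp_all add: index_count_def round_count_def)
qed

lemma unroll_sponge_simulator:
  "unroll (sim_fwd sponge_simulator) [r, c] = layout.query_gates r c (sim_gates r c) (rev (sim_gates r c))"
  "unroll (sim_bwd sponge_simulator) [r, c] = layout.query_gates r c (rev (sim_gates r c)) (sim_gates r c)"
proof -
  interpret layout r c "index_count (r + c)" f sr "\<lambda>_. False" for f sr by (rule layout_zero)
  have R: "aval [r, c] (Const (index_count (r + c))) = index_count (r + c)" by simp
  show "unroll (sim_fwd sponge_simulator) [r, c] = query_gates (sim_gates r c) (rev (sim_gates r c))"
    "unroll (sim_bwd sponge_simulator) [r, c] = query_gates (rev (sim_gates r c)) (sim_gates r c)"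
    using unroll_query_prog[OF _ _ R, of "Var 0" "Var (Suc 0)"]
    by (simp_all add: sponge_simulator_def unroll_sim_perm_prog)
qed

section \<open>Classical circuits as quantum circuits\<close>

lemma length_xor_into [simp]: "length (xor_into t v b) = length b"
  by (simp add: xor_into_def)

lemma nth_xor_into:
  "i < length b \<Longrightarrow> xor_into t v b ! i \<longleftrightarrow> (if t \<le> i \<and> i < t + length v then b ! i \<noteq> v ! (i - t) else b ! i)"
  by (simp add: xor_into_def)

lemma take_xor_into [simp]: "take t (xor_into t v b) = take t b"
  by (rule nth_equalityI) (auto simp: nth_xor_into)

lemma xor_into_xor_into [simp]: "xor_into t v (xor_into t v b) = b"
  by (rule nth_equalityI) (auto simp: nth_xor_into)

lemma length_gate_map [simp]: "length (gate_map r f sr g b) = length b"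
  by (cases g) auto

lemma gate_op_classical:
  "classical_gate g \<Longrightarrow> gate_op r f sr g a b = of_bool (a = gate_map r f sr g b)"
  by (cases g) auto

lemma sum_of_bool_mult:
  "finite A \<Longrightarrow> (\<Sum>d\<in>A. F d * of_bool (d = x)) = (if x \<in> A then F x else (0 :: complex))"
  "finite A \<Longrightarrow> (\<Sum>d\<in>A. of_bool (d = x) * F d) = (if x \<in> A then F x else (0 :: complex))"
  by (simp_all add: of_bool_def if_distrib[of "\<lambda>z. _ * z"] if_distrib[of "\<lambda>z. z * _"] sum.delta cong: if_cong)

lemma circuit_op_classical:
  assumes "\<And>g. g \<in> set C \<Longrightarrow> classical_gate g" "length b = N"
  shows "circuit_op N r f sr C a b = of_bool (a = fold (gate_map r f sr) C b)"
  using assms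
proof (induction C arbitrary: b)
  case (Cons g C)
  have "circuit_op N r f sr (g # C) a b =
      (\<Sum>d\<in>bitstrings N. circuit_op N r f sr C a d * of_bool (d = gate_map r f sr g b))"
    using Cons.prems by (simp add: mult_op_def gate_op_classical)
  also have "\<dots> = circuit_op N r f sr C a (gate_map r f sr g b)"
    using Cons.prems by (subst sum_of_bool_mult[OF finite_bitstrings]) (auto simp: bitstrings_def)
  finally show ?case using Cons by simp
qed simp

lemma conj_op_cong:
  assumes "\<And>a b. a \<in> bitstrings m \<Longrightarrow> b \<in> bitstrings m \<Longrightarrow> U a b = U' a b"
    and "\<And>a b. a \<in> bitstrings m \<Longrightarrow> b \<in> bitstrings m \<Longrightarrow> \<rho> a b = \<rho>' a b"
    and "a \<in> bitstrings m" "b \<in> bitstrings m"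
  shows "conj_op m U \<rho> a b = conj_op m U' \<rho>' a b"
  unfolding conj_op_def using assms by (auto intro!: sum.cong)

text \<open>Operators that represent the same map may differ outside the computational basis. All
  sums in a run range over the basis, so it suffices that the query maps preserve agreement
  there.\<close>

lemma qrun_cong:
  assumes Q: "\<And>i \<rho> \<rho>' a b. i \<in> {QPriv, QFwd, QBwd} \<Longrightarrow>
      (\<And>a b. a \<in> bitstrings m \<Longrightarrow> b \<in> bitstrings m \<Longrightarrow> \<rho> a b = \<rho>' a b) \<Longrightarrow>
      a \<in> bitstrings m \<Longrightarrow> b \<in> bitstrings m \<Longrightarrow> qstep_run m Q i \<rho> a b = qstep_run m Q' i \<rho>' a b"
  shows "qrun m Q D = qrun m Q' D"
proof -
  have "fold (qstep_run m Q) D \<rho> a b = fold (qstep_run m Q') D \<rho>' a b"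
    if "a \<in> bitstrings m" "b \<in> bitstrings m" "\<And>a b. a \<in> bitstrings m \<Longrightarrow> b \<in> bitstrings m \<Longrightarrow> \<rho> a b = \<rho>' a b"
    for \<rho> \<rho>' a b
    using that(3)
  proof (induction D arbitrary: \<rho> \<rho>')
    case (Cons s D)
    have "qstep_run m Q s \<rho> a b = qstep_run m Q' s \<rho>' a b" if "a \<in> bitstrings m" "b \<in> bitstrings m" for a b
    proof (cases s)
      case (Unitary U)
      then show ?thesis using that Cons.prems by (auto intro: conj_op_cong)
    qed (use Q[of s \<rho> \<rho>'] Cons.prems that in auto)
    then have "fold (qstep_run m Q) D (qstep_run m Q s \<rho>) a b = fold (qstep_run m Q') D (qstep_run m Q' s \<rho>') a b"
      by (rule Cons.IH)
    then show ?case by simp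
  qed (use that in simp)
  then show ?thesis unfolding qrun_def Let_def by (intro sum.cong refl) auto
qed

lemma qrun_conj_op_cong:
  assumes "\<And>a b. a \<in> bitstrings m \<Longrightarrow> b \<in> bitstrings m \<Longrightarrow> U1 a b = V1 a b"
    "\<And>a b. a \<in> bitstrings m \<Longrightarrow> b \<in> bitstrings m \<Longrightarrow> U2 a b = V2 a b"
    "\<And>a b. a \<in> bitstrings m \<Longrightarrow> b \<in> bitstrings m \<Longrightarrow> U3 a b = V3 a b"
  shows "qrun m (conj_op m U1, conj_op m U2, conj_op m U3) D = qrun m (conj_op m V1, conj_op m V2, conj_op m V3) D"
  by (rule qrun_cong) (use assms in \<open>auto intro!: conj_op_cong\<close>)

lemma query_op_unitary: "k \<le> m \<Longrightarrow> unitary_op m (query_op k F)"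
proof -
  let ?T = "\<lambda>b. xor_into k (F (take k b)) b"
  have inj: "inj ?T" by (rule inj_on_inverseI[where g = ?T]) simp
  have "(\<Sum>d\<in>bitstrings m. cnj (query_op k F d a) * query_op k F d b) = of_bool (a = b)"
    if ab: "a \<in> bitstrings m" "b \<in> bitstrings m" for a b
  proof -
    have "(\<Sum>d\<in>bitstrings m. cnj (query_op k F d a) * query_op k F d b) =
        (\<Sum>d\<in>bitstrings m. of_bool (d = ?T a) * of_bool (d = ?T b))"
      unfolding query_op_def by (intro sum.cong refl) (auto simp: of_bool_def)
    also have "\<dots> = of_bool (?T a = ?T b)"
      using ab by (subst sum_of_bool_mult[OF finite_bitstrings]) (auto simp: bitstrings_def)
    also have "\<dots> = of_bool (a = b)" by (simp only: inj_eq[OF inj])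
    finally show ?thesis .
  qed
  then show "unitary_op m (query_op k F)" by (simp add: unitary_op_def)
qed

text \<open>With unitary queries the state stays pure, of rank one and norm 1, and the output
  probability is a partial sum of the squared amplitudes.\<close>

lemma qrun_bounds:
  assumes D: "\<And>U. Unitary U \<in> set D \<Longrightarrow> unitary_op m U"
    and U: "unitary_op m U1" "unitary_op m U2" "unitary_op m U3"
  shows "0 \<le> qrun m (conj_op m U1, conj_op m U2, conj_op m U3) D"
    "qrun m (conj_op m U1, conj_op m U2, conj_op m U3) D \<le> 1"
proof -
  let ?B = "bitstrings m" and ?Q = "(conj_op m U1, conj_op m U2, conj_op m U3)"
  define pure where "pure \<rho> \<longleftrightarrow> (\<exists>\<psi>. (\<forall>a\<in>?B. \<forall>b\<in>?B. \<rho> a b = \<psi> a * cnj (\<psi> b)) \<and> (\<Sum>a\<in>?B. \<psi> a * cnj (\<psi> a)) = 1)"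
    for \<rho> :: qop
  have step: "pure (conj_op m W \<rho>)" if W: "unitary_op m W" and "pure \<rho>" for W \<rho>
  proof -
    from \<open>pure \<rho>\<close> obtain \<psi> where psi: "\<And>a b. a \<in> ?B \<Longrightarrow> b \<in> ?B \<Longrightarrow> \<rho> a b = \<psi> a * cnj (\<psi> b)"
      "(\<Sum>a\<in>?B. \<psi> a * cnj (\<psi> a)) = 1" by (auto simp: pure_def)
    define u where "u a = (\<Sum>d\<in>?B. W a d * \<psi> d)" for a
    have "conj_op m W \<rho> a b = u a * cnj (u b)" for a b
    proof -
      have "conj_op m W \<rho> a b = (\<Sum>a'\<in>?B. \<Sum>b'\<in>?B. (W a a' * \<psi> a') * cnj (W b b' * \<psi> b'))"
        unfolding conj_op_def using psi(1) by (intro sum.cong refl) (simp add: mult_ac)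
      also have "\<dots> = u a * cnj (u b)" by (simp add: u_def sum_product)
      finally show ?thesis .
    qed
    moreover have "(\<Sum>a\<in>?B. u a * cnj (u a)) = 1"
    proof -
      have "(\<Sum>a\<in>?B. u a * cnj (u a)) = (\<Sum>a\<in>?B. \<Sum>d\<in>?B. \<Sum>e\<in>?B. (W a d * \<psi> d) * cnj (W a e * \<psi> e))"
        by (simp add: u_def sum_product)
      also have "\<dots> = (\<Sum>d\<in>?B. \<Sum>a\<in>?B. \<Sum>e\<in>?B. (W a d * \<psi> d) * cnj (W a e * \<psi> e))"
        by (rule sum.swap)
      also have "\<dots> = (\<Sum>d\<in>?B. \<Sum>e\<in>?B. \<Sum>a\<in>?B. (W a d * \<psi> d) * cnj (W a e * \<psi> e))"
        by (intro sum.cong refl sum.swap)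
      also have "\<dots> = (\<Sum>d\<in>?B. \<Sum>e\<in>?B. \<psi> d * cnj (\<psi> e) * (\<Sum>a\<in>?B. cnj (W a e) * W a d))"
        by (intro sum.cong refl) (simp add: sum_distrib_left mult_ac)
      also have "\<dots> = (\<Sum>d\<in>?B. \<Sum>e\<in>?B. \<psi> d * cnj (\<psi> e) * of_bool (e = d))"
        using W by (intro sum.cong refl) (simp add: unitary_op_def)
      also have "\<dots> = (\<Sum>d\<in>?B. \<psi> d * cnj (\<psi> d))"
        by (intro sum.cong refl) (subst sum_of_bool_mult[OF finite_bitstrings], auto)
      finally show ?thesis using psi(2) by simp
    qed
    ultimately show ?thesis unfolding pure_def by blast
  qed
  let ?z = "replicate m False"
  have "?z \<in> ?B" by (simp add: bitstrings_def)
  then have init: "pure (\<lambda>a b. of_bool (a = ?z \<and> b = ?z))"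
    unfolding pure_def
    by (intro exI[of _ "\<lambda>a. of_bool (a = ?z)"]) (auto simp: sum_of_bool_mult)
  have "pure (fold (qstep_run m ?Q) E \<rho>)" if "pure \<rho>" "set E \<subseteq> set D" for E \<rho>
    using that
  proof (induction E arbitrary: \<rho>)
    case (Cons s E)
    have "pure (qstep_run m ?Q s \<rho>)"
      using Cons.prems D U by (cases s) (auto intro!: step)
    then show ?case using Cons by simp
  qed simp
  from this[OF init, of D] obtain \<psi> where
    psi: "\<And>a b. a \<in> ?B \<Longrightarrow> b \<in> ?B \<Longrightarrow> fold (qstep_run m ?Q) D (\<lambda>a b. of_bool (a = ?z \<and> b = ?z)) a b = \<psi> a * cnj (\<psi> b)"
    "(\<Sum>a\<in>?B. \<psi> a * cnj (\<psi> a)) = 1" by (auto simp: pure_def)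
  have "(\<Sum>a\<in>?B. complex_of_real ((cmod (\<psi> a))\<^sup>2)) = 1"
    using psi(2) by (simp only: complex_norm_square)
  then have one: "(\<Sum>a\<in>?B. (cmod (\<psi> a))\<^sup>2) = 1"
    by (metis of_real_sum of_real_eq_1_iff)
  have q: "qrun m ?Q D = (\<Sum>b\<in>{b \<in> ?B. last b}. (cmod (\<psi> b))\<^sup>2)"
    unfolding qrun_def Let_def
    by (intro sum.cong refl) (simp add: psi(1) flip: complex_norm_square)
  show "0 \<le> qrun m ?Q D" unfolding q by (intro sum_nonneg) simp
  show "qrun m ?Q D \<le> 1" unfolding q one[symmetric] by (intro sum_mono2) auto
qed

text \<open>The circuit returns its ancillas to zero, so tracing them out leaves one nonzero Kraus
  operator, \<open>z = replicate l False\<close>, and this one is the query unitary of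
  \<open>F\<close>.\<close>

lemma qsim_classical:
  assumes m: "2 * (r + c) < m" and cl: "\<And>g. g \<in> set (unroll p [r, c]) \<Longrightarrow> classical_gate g"
    and F: "\<And>x. length x = r + c \<Longrightarrow> length (F x) = r + c"
    and run: "\<And>y. length y = 2 * (r + c) \<Longrightarrow>
      fold (gate_map r f sr) (unroll p [r, c]) (y @ replicate (anc S r c) False) =
      xor_into (r + c) (F (take (r + c) y)) (y @ replicate (anc S r c) False)"
    and ab: "a \<in> bitstrings m" "b \<in> bitstrings m"
  shows "qsim S r c f sr p m \<rho> a b = conj_op m (query_op (r + c) F) \<rho> a b"
proof -
  define n where "n = r + c"
  define l where "l = anc S r c"
  define K where "K = (\<lambda>z x y. circuit_op (2 * n + l) r f sr (unroll p [r, c]) (x @ z) (y @ replicate l False))"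
  have K: "K z x y = of_bool (z = replicate l False \<and> x = xor_into n (F (take n y)) y)"
    if "length x = 2 * n" "length y = 2 * n" for x y z
  proof -
    have "xor_into n (F (take n y)) (y @ replicate l False) = xor_into n (F (take n y)) y @ replicate l False"
      using that F[of "take n y"] by (intro nth_equalityI) (auto simp: nth_xor_into nth_append n_def)
    then have "K z x y = of_bool (x @ z = xor_into n (F (take n y)) y @ replicate l False)"
      unfolding K_def using that run cl by (subst circuit_op_classical) (auto simp: n_def l_def)
    then show ?thesis using that by (auto simp: of_bool_def)
  qed
  have lift: "lift_op (2 * n) (K z) a b = of_bool (z = replicate l False) * query_op n F a b"
    if "a \<in> bitstrings m" "b \<in> bitstrings m" for a b z
  proof -
    have len: "length a = m" "length b = m" using that by (auto simp: bitstrings_def)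
    have t: "take (2 * n) (xor_into n (F (take n b)) b) = xor_into n (F (take n b)) (take (2 * n) b)"
      "drop (2 * n) (xor_into n (F (take n b)) b) = drop (2 * n) b"
      using len m F[of "take n b"] by (auto intro!: nth_equalityI simp: nth_xor_into n_def)
    have "a = xor_into n (F (take n b)) b \<longleftrightarrow>
        take (2 * n) a = take (2 * n) (xor_into n (F (take n b)) b) \<and> drop (2 * n) a = drop (2 * n) (xor_into n (F (take n b)) b)"
      by (metis append_take_drop_id)
    then have e: "a = xor_into n (F (take n b)) b \<longleftrightarrow>
        take (2 * n) a = xor_into n (F (take n b)) (take (2 * n) b) \<and> drop (2 * n) a = drop (2 * n) b"
      unfolding t .
    have "take n (take (2 * n) b) = take n b" by simp
    then show ?thesis
      using len m unfolding lift_op_def query_op_def e by (auto simp: K n_def)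
  qed
  have "qsim S r c f sr p m \<rho> a b = (\<Sum>z\<in>bitstrings l. conj_op m (lift_op (2 * n) (K z)) \<rho> a b)"
    by (simp add: qsim_def Let_def n_def l_def K_def)
  also have "\<dots> = (\<Sum>z\<in>bitstrings l. of_bool (z = replicate l False) * conj_op m (query_op n F) \<rho> a b)"
  proof (rule sum.cong[OF refl])
    fix z
    have "conj_op m (lift_op (2 * n) (K z)) \<rho> a b = conj_op m (\<lambda>a b. of_bool (z = replicate l False) * query_op n F a b) \<rho> a b"
      using ab lift by (intro conj_op_cong) auto
    then show "conj_op m (lift_op (2 * n) (K z)) \<rho> a b = of_bool (z = replicate l False) * conj_op m (query_op n F) \<rho> a b"
      by (cases "z = replicate l False") (auto simp: conj_op_def)
  qed
  also have "\<dots> = conj_op m (query_op n F) \<rho> a b"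
    by (subst sum_of_bool_mult[OF finite_bitstrings]) (auto simp: bitstrings_def)
  finally show ?thesis by (simp add: n_def)
qed

section \<open>The simulator evaluates the simulated permutation\<close>

lemma classical_round_gates:
  assumes "\<And>g. g \<in> set C \<Longrightarrow> classical_gate g" "g \<in> set (layout.round_gates r c R C outs lo i)"
  shows "classical_gate g"
proof -
  interpret layout r c R f sr "\<lambda>_. False" for f sr by (rule layout_zero)
  show ?thesis
    using assms
    by (auto simp: round_gates_def decide_def compare_def test_def read_coin_def read_key_def xor_key_def cnots_def toffolis_def)
qed

lemma classical_perm_gates: "g \<in> set (layout.perm_gates r c R t) \<Longrightarrow> classical_gate g"
proof -
  interpret layout r c R f sr "\<lambda>_. False" for f sr by (rule layout_zero)
  have chains: "classical_gate g" if "g \<in> set (inner_chain j) \<union> set (outer_chain j)" for g j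
    using that by (auto simp: inner_chain_def outer_chain_def zero_chain_def)
  assume "g \<in> set (perm_gates t)"
  then show ?thesis
    unfolding perm_gates_def inner_gates_def outer_gates_def
    by (auto simp: feistel_gates_def cnots_def dest!: classical_round_gates[rotated] intro: chains)
qed

lemma classical_query_gates:
  assumes "\<And>g. g \<in> set G \<union> set G' \<Longrightarrow> classical_gate g" "g \<in> set (layout.query_gates r c G G')"
  shows "classical_gate g"
proof -
  interpret layout r c R f sr "\<lambda>_. False" for R f sr by (rule layout_zero)
  show ?thesis using assms by (auto simp: query_gates_def cnots_def)
qed

lemma classical_sponge_simulator:
  assumes "p \<in> {sim_fwd sponge_simulator, sim_bwd sponge_simulator}" "g \<in> set (unroll p [r, c])"
  shows "classical_gate g"
  using assms classical_query_gates[of "sim_gates r c" "rev (sim_gates r c)" g r c]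
    classical_query_gates[of "rev (sim_gates r c)" "sim_gates r c" g r c] classical_perm_gates
  by (auto simp: unroll_sponge_simulator)

lemma efficient_sponge_simulator: "efficient {(r, c). r \<le> c} sponge_simulator"
proof -
  have wf: "wf_gate r (2 * (r + c) + anc sponge_simulator r c) g"
    if "r \<le> c" "p \<in> {sim_fwd sponge_simulator, sim_bwd sponge_simulator}" "g \<in> set (unroll p [r, c])" for r c p g
  proof -
    interpret layout r c "index_count (r + c)" f sr "\<lambda>_. False" for f sr by (rule layout_zero)
    have G: "wfg g" if "g \<in> set (perm_gates (round_count (r + c)))" for g
      using wf_perm_gates[OF \<open>r \<le> c\<close> _ that] by (simp add: index_count_def)
    have "wfg g"
    proof -
      let ?G = "perm_gates (round_count (r + c))"
      have "g \<in> set (query_gates ?G (rev ?G)) \<or> g \<in> set (query_gates (rev ?G) ?G)"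
        using that(2,3) by (auto simp: unroll_sponge_simulator)
      then show ?thesis
      proof
        assume "g \<in> set (query_gates ?G (rev ?G))"
        from wf_query_gates[OF _ _ this] G show ?thesis by simp
      next
        assume "g \<in> set (query_gates (rev ?G) ?G)"
        from wf_query_gates[OF _ _ this] G show ?thesis by simp
      qed
    qed
    then show ?thesis by (simp add: anc_sponge_simulator algebra_simps)
  qed
  \<comment> \<open>Rounded up from \<open>21312 * k ^ 3 + 11904 * k ^ 2 + 7 * k + 2\<close> gates
    and \<open>384 * k ^ 2 + 5 * k + 6\<close> ancillas, where \<open>k = r + c\<close>.\<close>
  define q :: "nat poly" where "q = [:6, 10, 12000, 22000:]"
  have len: "length (unroll p [r, c]) \<le> poly q (r + c)"
    if "p \<in> {sim_fwd sponge_simulator, sim_bwd sponge_simulator}" for r c p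
  proof -
    interpret layout r c "index_count (r + c)" f sr "\<lambda>_. False" for f sr by (rule layout_zero)
    define k where "k = r + c"
    have le: "length (perm_gates (round_count k)) \<le> 2 * k * (round_count k * (111 * k + 62)) + 2 * k + 1"
      unfolding k_def by (rule length_perm_gates)
    have "length (unroll p [r, c]) = 2 * length (perm_gates (round_count k)) + 3 * k"
      using that by (auto simp: unroll_sponge_simulator length_query_gates k_def)
    also have "\<dots> \<le> 2 * (2 * k * (round_count k * (111 * k + 62)) + 2 * k + 1) + 3 * k"
      using le by (intro add_le_mono1 mult_le_mono2)
    also have "\<dots> \<le> poly q k" by (simp add: q_def round_count_def algebra_simps)
    finally show ?thesis by (simp add: k_def)
  qed
  have "anc sponge_simulator r c \<le> poly q (r + c)" for r c
  proof -
    define k where "k = r + c"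
    have "5 * k + 2 * index_count k + 6 \<le> poly q k"
      by (simp add: q_def index_count_def round_count_def algebra_simps)
    then show ?thesis by (simp add: anc_sponge_simulator k_def)
  qed
  with wf len show ?thesis unfolding efficient_def by blast
qed

definition simulated :: "nat \<Rightarrow> nat \<Rightarrow> func \<Rightarrow> bits \<Rightarrow> func" where
  "simulated r c f sr = sim_perm r c (index_count (r + c)) (round_count (r + c)) f (coin_at sr)"

lemma simulated_permutes: "r \<le> c \<Longrightarrow> simulated r c f sr permutes bitstrings (r + c)"
  unfolding simulated_def by (rule sim_perm_permutes)

lemma run_sponge_simulator:
  assumes rc: "r \<le> c" and f: "\<And>x. length x = r \<Longrightarrow> length (f x) = r" and y: "length y = 2 * (r + c)"
  shows "fold (gate_map r f sr) (unroll (sim_fwd sponge_simulator) [r, c]) (y @ replicate (anc sponge_simulator r c) False) =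
      xor_into (r + c) (simulated r c f sr (take (r + c) y)) (y @ replicate (anc sponge_simulator r c) False)"
    (is ?fwd)
    and "fold (gate_map r f sr) (unroll (sim_bwd sponge_simulator) [r, c]) (y @ replicate (anc sponge_simulator r c) False) =
      xor_into (r + c) (inv (simulated r c f sr) (take (r + c) y)) (y @ replicate (anc sponge_simulator r c) False)"
    (is ?bwd)
proof -
  define R where "R = index_count (r + c)"
  define t where "t = round_count (r + c)"
  define N where "N = 2 * (r + c) + anc sponge_simulator r c"
  define b where "b = y @ replicate (anc sponge_simulator r c) False"
  define m where "m i \<longleftrightarrow> i < 2 * (r + c) \<and> y ! i" for i
  let ?G = "layout.perm_gates r c R t" and ?\<phi> = "simulated r c f sr"
  have R: "R = 2 * (2 * (r + c) * t)" by (simp add: R_def t_def index_count_def)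
  have perm: "?\<phi> permutes bitstrings (r + c)" by (rule simulated_permutes[OF rc])
  have len\<phi>: "length (?\<phi> x) = r + c" "length (inv ?\<phi> x) = r + c" if "length x = r + c" for x
    using that permutes_in_image[OF perm, of x] permutes_in_image[OF permutes_inv[OF perm], of x]
    by (simp_all add: bitstrings_def)
  have inv: "?\<phi> (inv ?\<phi> x) = x" "inv ?\<phi> (?\<phi> x) = x" for x
    using permutes_inverses[OF perm] by auto
  have b: "b = map m [0..<N]"
    using y by (intro nth_equalityI) (auto simp: b_def N_def m_def nth_append)
  have m: "\<not> m i" if "2 * (r + c) \<le> i" for i using that by (simp add: m_def)
  have my: "map m [0..<r + c] = take (r + c) y"
    using y by (intro nth_equalityI) (auto simp: m_def)
  have wf: "wf_gate r N g" if "p \<in> {sim_fwd sponge_simulator, sim_bwd sponge_simulator}" "g \<in> set (unroll p [r, c])" for g p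
    using efficient_sponge_simulator rc that unfolding efficient_def N_def by blast
  have wfG: "wf_gate r (7 * (r + c) + 2 * R + 6) g" if "g \<in> set ?G" for g
    by (rule layout.wf_perm_gates[OF layout_zero rc R that])
  have G: "run r f sr ?G (layout.st r c R m' x {} False False False False False) =
      layout.st r c R m' (?\<phi> x) {} False False False False False"
    if "\<And>i. 2 * (r + c) \<le> i \<Longrightarrow> \<not> m' i" "length x = r + c" for m' x
  proof -
    interpret layout r c R f sr m' by unfold_locales (rule that(1))
    show ?thesis
      using run_perm_gates[OF rc R that(2)] by (simp add: simulated_def R_def t_def)
  qed
  have G': "run r f sr (rev ?G) (layout.st r c R m' (?\<phi> x) {} False False False False False) =
      layout.st r c R m' x {} False False False False False"
    if "\<And>i. 2 * (r + c) \<le> i \<Longrightarrow> \<not> m' i" "length x = r + c" for m' x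
    using run_rev_run[OF wfG, of ?G f sr "layout.st r c R m' x {} False False False False False"] G[OF that] by simp
  have fin: "map (\<lambda>i. if r + c \<le> i \<and> i < 2 * (r + c) then m i \<noteq> \<psi> (map m [0..<r + c]) ! (i - (r + c)) else m i) [0..<N] =
      xor_into (r + c) (\<psi> (take (r + c) y)) b" if "\<And>x. length x = r + c \<Longrightarrow> length (\<psi> x) = r + c" for \<psi>
    unfolding my b using that[of "take (r + c) y"] y
    by (intro nth_equalityI) (auto simp: nth_xor_into)
  have "fold (gate_map r f sr) (unroll (sim_fwd sponge_simulator) [r, c]) b =
      map (run r f sr (unroll (sim_fwd sponge_simulator) [r, c]) m) [0..<N]"
    unfolding b by (rule fold_gate_map[OF wf f]) auto
  also have "run r f sr (unroll (sim_fwd sponge_simulator) [r, c]) m =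
      (\<lambda>i. if r + c \<le> i \<and> i < 2 * (r + c) then m i \<noteq> ?\<phi> (map m [0..<r + c]) ! (i - (r + c)) else m i)"
    unfolding unroll_sponge_simulator R_def[symmetric] t_def[symmetric]
    by (rule run_query_gates[OF m G G'])
  also note fin[OF len\<phi>(1)]
  finally show ?fwd unfolding b_def .
  have "fold (gate_map r f sr) (unroll (sim_bwd sponge_simulator) [r, c]) b =
      map (run r f sr (unroll (sim_bwd sponge_simulator) [r, c]) m) [0..<N]"
    unfolding b by (rule fold_gate_map[OF wf f]) auto
  also have "run r f sr (unroll (sim_bwd sponge_simulator) [r, c]) m =
      (\<lambda>i. if r + c \<le> i \<and> i < 2 * (r + c) then m i \<noteq> inv ?\<phi> (map m [0..<r + c]) ! (i - (r + c)) else m i)"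
    unfolding unroll_sponge_simulator R_def[symmetric] t_def[symmetric]
  proof (rule run_query_gates[OF m])
    fix m' :: mem and x :: bits
    assume m': "\<And>i. 2 * (r + c) \<le> i \<Longrightarrow> \<not> m' i" and x: "length x = r + c"
    show "run r f sr (rev ?G) (layout.st r c R m' x {} False False False False False) =
        layout.st r c R m' (inv ?\<phi> x) {} False False False False False"
      using G'[OF m' len\<phi>(2)[OF x]] by (simp add: inv)
    show "run r f sr ?G (layout.st r c R m' (inv ?\<phi> x) {} False False False False False) =
        layout.st r c R m' x {} False False False False False"
      using G[OF m' len\<phi>(2)[OF x]] by (simp add: inv)
  qed
  also note fin[OF len\<phi>(2)]
  finally show ?bwd unfolding b_def .
qed

section \<open>Indifferentiability\<close>

lemma function_length: "f \<in> bitstrings r \<rightarrow>\<^sub>E bitstrings r \<Longrightarrow> length x = r \<Longrightarrow> length (f x) = r"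
  by (auto simp: bitstrings_def PiE_def Pi_def)

lemma expectation_pmf_of_set:
  "finite A \<Longrightarrow> A \<noteq> {} \<Longrightarrow> measure_pmf.expectation (pmf_of_set A) f = avg A (f :: _ \<Rightarrow> real)"
  by (simp add: integral_pmf_of_set avg_def)

lemma pair_pmf_of_set:
  assumes "finite (A :: 'a set)" "A \<noteq> {}" "finite (B :: 'b set)" "B \<noteq> {}"
  shows "pair_pmf (pmf_of_set A) (pmf_of_set B) = pmf_of_set (A \<times> B)"
proof (rule pmf_eqI)
  fix z :: "'a \<times> 'b"
  obtain a b where z: "z = (a, b)" by (cases z)
  have AB: "A \<times> B \<noteq> {}" "finite (A \<times> B)" using assms by auto
  show "pmf (pair_pmf (pmf_of_set A) (pmf_of_set B)) z = pmf (pmf_of_set (A \<times> B)) z"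
    unfolding z pmf_pair pmf_of_set[OF assms(2,1)] pmf_of_set[OF assms(4,3)] pmf_of_set[OF AB]
    by (simp add: indicator_def card_cartesian_product)
qed

lemma finite_functions: "finite (bitstrings r \<rightarrow>\<^sub>E bitstrings r)" "bitstrings r \<rightarrow>\<^sub>E bitstrings r \<noteq> {}"
  by (auto intro: finite_PiE simp: PiE_eq_empty_iff)

lemma expectation_sponge:
  "measure_pmf.expectation (sponge r c) h =
     avg {\<phi>. \<phi> permutes bitstrings (r + c)} (\<lambda>\<phi>. h (Sp r c \<phi>, \<phi>, inv \<phi>) :: real)"
  unfolding sponge_def integral_map_pmf
  by (intro expectation_pmf_of_set finite_permutations) (auto intro: exI[of _ id] permutes_id)

lemma expectation_random_oracle:
  "measure_pmf.expectation (pair_pmf (random_oracle r c) (pmf_of_set (bitstrings l))) h =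
     avg (bitstrings r \<rightarrow>\<^sub>E bitstrings r) (\<lambda>f. avg (bitstrings l) (\<lambda>sr. h ((f, f), sr) :: real))"
  unfolding random_oracle_def pair_map_pmf1 integral_map_pmf
  using finite_functions[of r]
  by (simp add: pair_pmf_of_set expectation_pmf_of_set avg_Times)

text \<open>Common core of both settings: \<open>h f \<phi>\<close> stands for the probability that
  the distinguisher outputs 1 on the private interface \<open>f\<close> and the public permutation
  \<open>\<phi>\<close>. The restriction brings the sponge function into the extensional function
  space from which \<open>f\<close> is drawn.\<close>

lemma indifferentiability_bound:
  fixes h :: "func \<Rightarrow> func \<Rightarrow> real"
  assumes rc: "r \<le> c" and h: "\<And>f \<phi>. 0 \<le> h f \<phi> \<and> h f \<phi> \<le> 1"
  shows "\<bar>avg {\<phi>. \<phi> permutes bitstrings (r + c)} (\<lambda>\<phi>. h (restrict (Sp r c \<phi>) (bitstrings r)) \<phi>)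
     - avg (bitstrings r \<rightarrow>\<^sub>E bitstrings r) (\<lambda>f. avg (bitstrings (sim_coins sponge_simulator r c)) (\<lambda>sr. h f (simulated r c f sr)))\<bar>
    \<le> 6 * 2 powr (- real r / 2)" (is "\<bar>?real - ?ideal\<bar> \<le> _")
\<comment> \<open>For \<open>r = 0\<close> the bound is 6 and holds trivially; for
  \<open>r > 0\<close> also \<open>c > 0\<close>, as the inner shuffle requires.\<close>
proof (cases "r = 0")
  case True
  have "0 \<le> ?real" "?real \<le> 1" "0 \<le> ?ideal" "?ideal \<le> 1"
    using h by (auto intro!: avg_ge_0 avg_le)
  then have "\<bar>?real - ?ideal\<bar> \<le> 1" by linarith
  then show ?thesis using True by simp
next
  case False
  then have r: "0 < r" by simp
  let ?F = "bitstrings r \<rightarrow>\<^sub>E bitstrings r"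
  have coins: "sim_coins sponge_simulator r c = 2 ^ (r + c + index_count (r + c))"
    by (simp add: sponge_simulator_def)
  have "\<bar>avg ?F (\<lambda>f. avg (bitstrings (sim_coins sponge_simulator r c)) (\<lambda>sr. h f (simulated r c f sr))) -
      avg ?F (\<lambda>f. avg (prescribed r c f) (h f))\<bar> \<le> 2 / 2 ^ (r + c)"
    unfolding coins simulated_def
  proof (intro avg_diff_abs_le sim_perm_near_uniform r rc)
    show "\<bar>h f \<phi>\<bar> \<le> 1" for f \<phi> using h[of f \<phi>] by simp
  qed (simp_all add: round_count_def index_count_def)
  moreover have "\<bar>?real - avg ?F (\<lambda>f. avg (prescribed r c f) (h f))\<bar> \<le> 4 / sqrt (2 ^ r)"
    by (rule sponge_function_near_uniform[OF r rc h])
  ultimately have "\<bar>?real - ?ideal\<bar> \<le> 4 / sqrt (2 ^ r) + 2 / 2 ^ (r + c)" by linarith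
  also have "2 / 2 ^ (r + c) \<le> 2 / sqrt (2 ^ r)"
  proof (rule divide_left_mono)
    have "sqrt (2 ^ r) \<le> (2::real) ^ r"
      by (rule real_le_lsqrt) (auto simp: power2_eq_square mult_le_cancel_left1)
    also have "\<dots> \<le> 2 ^ (r + c)" by (intro power_increasing) auto
    finally show "sqrt (2 ^ r) \<le> (2::real) ^ (r + c)" .
  qed auto
  also have "4 / sqrt (2 ^ r) + 2 / sqrt (2 ^ r) = 6 * 2 powr (- real r / 2)"
  proof -
    have "sqrt (2 ^ r) = 2 powr (real r / 2)"
      by (simp add: powr_half_sqrt[symmetric] powr_powr flip: powr_realpow)
    then show ?thesis by (simp add: powr_minus_divide)
  qed
  finally show ?thesis by simp
qed

text \<open>Queries of the wrong length are intercepted by \<open>answer\<close>, so agreement on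
  the proper domains is enough.\<close>

lemma crun_cong:
  assumes "\<And>x. length x = r \<Longrightarrow> fst I x = fst J x"
    and "\<And>x. length x = r + c \<Longrightarrow> fst (snd I) x = fst (snd J) x"
    and "\<And>x. length x = r + c \<Longrightarrow> snd (snd I) x = snd (snd J) x"
  shows "crun r c I D = crun r c J D"
proof (induction D)
  case (Sample p D)
  then show ?case by (auto intro!: bind_pmf_cong)
next
  case (QueryPriv x D)
  then show ?case using assms(1)[of x] by (simp add: answer_def)
next
  case (QueryFwd x D)
  then show ?case using assms(2)[of x] by (simp add: answer_def)
next
  case (QueryBwd x D)
  then show ?case using assms(3)[of x] by (simp add: answer_def)
qed simp

lemma slice_xor_into:
  assumes "length x = n" "length v = n"
  shows "slice n n (xor_into n v (x @ replicate (n + l) False)) = v"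
  using assms by (intro nth_equalityI) (auto simp: slice_def nth_xor_into nth_append)

lemma csim_sponge_simulator:
  assumes rc: "r \<le> c" and f: "f \<in> bitstrings r \<rightarrow>\<^sub>E bitstrings r" and x: "length x = r + c"
  shows "csim sponge_simulator r c f sr (sim_fwd sponge_simulator) x = simulated r c f sr x"
    and "csim sponge_simulator r c f sr (sim_bwd sponge_simulator) x = inv (simulated r c f sr) x"
proof -
  let ?\<phi> = "simulated r c f sr" and ?l = "anc sponge_simulator r c"
  have perm: "?\<phi> permutes bitstrings (r + c)" by (rule simulated_permutes[OF rc])
  have len: "length (?\<phi> x) = r + c" "length (inv ?\<phi> x) = r + c"
    using x permutes_in_image[OF perm, of x] permutes_in_image[OF permutes_inv[OF perm], of x]
    by (simp_all add: bitstrings_def)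
  have e: "x @ replicate (r + c + ?l) False = (x @ replicate (r + c) False) @ replicate ?l False"
    by (simp add: replicate_add)
  have t: "take (r + c) (x @ replicate (r + c) False) = x" using x by simp
  have ly: "length (x @ replicate (r + c) False) = 2 * (r + c)" using x by simp
  have fl: "length (f z) = r" if "length z = r" for z
    using function_length[OF f that] .
  have run: "fold (gate_map r f sr) (unroll (sim_fwd sponge_simulator) [r, c]) (x @ replicate (r + c + ?l) False) =
      xor_into (r + c) (?\<phi> x) (x @ replicate (r + c + ?l) False)"
    "fold (gate_map r f sr) (unroll (sim_bwd sponge_simulator) [r, c]) (x @ replicate (r + c + ?l) False) =
      xor_into (r + c) (inv ?\<phi> x) (x @ replicate (r + c + ?l) False)"
    using run_sponge_simulator[where f = f and sr = sr, OF rc fl ly] unfolding e t by simp_all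
  show "csim sponge_simulator r c f sr (sim_fwd sponge_simulator) x = ?\<phi> x"
    "csim sponge_simulator r c f sr (sim_bwd sponge_simulator) x = inv ?\<phi> x"
    unfolding csim_def run by (rule slice_xor_into[OF x len(1)], rule slice_xor_into[OF x len(2)])
qed

lemma classical_bound:
  assumes rc: "r \<le> c"
  shows "\<bar>creal sponge r c D - cideal random_oracle sponge_simulator r c D\<bar> \<le> 6 * 2 powr (- real r / 2)"
proof -
  define h where "h f \<phi> = pmf (crun r c (f, \<phi>, inv \<phi>) D) True" for f \<phi>
  have "creal sponge r c D = avg {\<phi>. \<phi> permutes bitstrings (r + c)} (\<lambda>\<phi>. h (Sp r c \<phi>) \<phi>)"
    by (simp add: creal_def pmf_bind expectation_sponge h_def)
  also have "\<dots> = avg {\<phi>. \<phi> permutes bitstrings (r + c)} (\<lambda>\<phi>. h (restrict (Sp r c \<phi>) (bitstrings r)) \<phi>)"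
    unfolding h_def by (intro avg_cong refl arg_cong2[where f = pmf] crun_cong) (auto simp: bitstrings_def)
  finally have real: "creal sponge r c D = \<dots>" .
  let ?S = sponge_simulator
  have "cideal random_oracle ?S r c D =
      avg (bitstrings r \<rightarrow>\<^sub>E bitstrings r) (\<lambda>f. avg (bitstrings (sim_coins ?S r c)) (\<lambda>sr.
        pmf (crun r c (f, csim ?S r c f sr (sim_fwd ?S), csim ?S r c f sr (sim_bwd ?S)) D) True))"
    by (simp add: cideal_def pmf_bind expectation_random_oracle)
  also have "\<dots> = avg (bitstrings r \<rightarrow>\<^sub>E bitstrings r) (\<lambda>f. avg (bitstrings (sim_coins ?S r c)) (\<lambda>sr. h f (simulated r c f sr)))"
    unfolding h_def
    by (rule avg_cong[OF refl], rule avg_cong[OF refl], intro arg_cong2[where f = pmf] crun_cong refl)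
      (use rc csim_sponge_simulator in auto)
  finally have ideal: "cideal random_oracle ?S r c D = \<dots>" .
  show ?thesis
    unfolding real ideal using rc by (rule indifferentiability_bound) (simp add: h_def pmf_le_1)
qed

lemma quantum_bound:
  assumes rc: "r \<le> c" and D: "quantum_distinguisher r c m D"
  shows "\<bar>qreal sponge r c m D - qideal random_oracle sponge_simulator r c m D\<bar> \<le> 6 * 2 powr (- real r / 2)"
proof -
  define h where "h f \<phi> = qrun m (conj_op m (query_op r f), conj_op m (query_op (r + c) \<phi>),
    conj_op m (query_op (r + c) (inv \<phi>))) D" for f \<phi>
  have m: "2 * (r + c) < m" and unitary: "\<And>U. Unitary U \<in> set D \<Longrightarrow> unitary_op m U"
    using D by (auto simp: quantum_distinguisher_def)
  have h01: "0 \<le> h f \<phi> \<and> h f \<phi> \<le> 1" for f \<phi>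
    unfolding h_def using m by (intro conjI qrun_bounds query_op_unitary unitary) auto
  have "qreal sponge r c m D = avg {\<phi>. \<phi> permutes bitstrings (r + c)} (\<lambda>\<phi>. h (Sp r c \<phi>) \<phi>)"
    by (simp add: qreal_def expectation_sponge h_def)
  also have "\<dots> = avg {\<phi>. \<phi> permutes bitstrings (r + c)} (\<lambda>\<phi>. h (restrict (Sp r c \<phi>) (bitstrings r)) \<phi>)"
    unfolding h_def
    by (rule avg_cong[OF refl], rule qrun_conj_op_cong) (use m in \<open>auto simp: query_op_def bitstrings_def\<close>)
  finally have real: "qreal sponge r c m D = \<dots>" .
  let ?S = sponge_simulator
  have "qideal random_oracle ?S r c m D =
      avg (bitstrings r \<rightarrow>\<^sub>E bitstrings r) (\<lambda>f. avg (bitstrings (sim_coins ?S r c)) (\<lambda>sr.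
        qrun m (conj_op m (query_op r f), qsim ?S r c f sr (sim_fwd ?S) m, qsim ?S r c f sr (sim_bwd ?S) m) D))"
    by (simp add: qideal_def expectation_random_oracle)
  also have "\<dots> = avg (bitstrings r \<rightarrow>\<^sub>E bitstrings r) (\<lambda>f. avg (bitstrings (sim_coins ?S r c)) (\<lambda>sr. h f (simulated r c f sr)))"
  proof (rule avg_cong[OF refl], rule avg_cong[OF refl])
    fix f sr assume f: "f \<in> bitstrings r \<rightarrow>\<^sub>E bitstrings r"
    let ?\<phi> = "simulated r c f sr"
    have perm: "?\<phi> permutes bitstrings (r + c)" by (rule simulated_permutes[OF rc])
    have len: "length (?\<phi> x) = r + c" "length (inv ?\<phi> x) = r + c" if "length x = r + c" for x
      using that permutes_in_image[OF perm, of x] permutes_in_image[OF permutes_inv[OF perm], of x]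
      by (simp_all add: bitstrings_def)
    note run = run_sponge_simulator[where f = f, OF rc function_length[OF f]]
    have fwd: "qsim ?S r c f sr (sim_fwd ?S) m \<rho> a b = conj_op m (query_op (r + c) ?\<phi>) \<rho> a b"
      if "a \<in> bitstrings m" "b \<in> bitstrings m" for \<rho> a b
      by (rule qsim_classical[OF m _ len(1) run(1) that]) (rule classical_sponge_simulator, auto)
    have bwd: "qsim ?S r c f sr (sim_bwd ?S) m \<rho> a b = conj_op m (query_op (r + c) (inv ?\<phi>)) \<rho> a b"
      if "a \<in> bitstrings m" "b \<in> bitstrings m" for \<rho> a b
      by (rule qsim_classical[OF m _ len(2) run(2) that]) (rule classical_sponge_simulator, auto)
    show "qrun m (conj_op m (query_op r f), qsim ?S r c f sr (sim_fwd ?S) m, qsim ?S r c f sr (sim_bwd ?S) m) D =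
        h f ?\<phi>"
      unfolding h_def by (rule qrun_cong) (auto simp: fwd bwd intro!: conj_op_cong)
  qed
  finally have ideal: "qideal random_oracle ?S r c m D = \<dots>" .
  show ?thesis unfolding real ideal using rc h01 by (rule indifferentiability_bound)
qed

theorem theorem7:
  shows "\<exists>\<epsilon> :: nat \<Rightarrow> real. \<epsilon> \<in> O(\<lambda>r. 2 powr (- real r / 2)) \<and>
           classical_reset_indiff {(r, c). r \<le> c} sponge random_oracle \<epsilon> \<and>
           quantum_reset_indiff {(r, c). r \<le> c} sponge random_oracle \<epsilon>"
proof (intro exI conjI)
  let ?\<epsilon> = "\<lambda>r. 6 * 2 powr (- real r / 2)"
  show "?\<epsilon> \<in> O(\<lambda>r. 2 powr (- real r / 2))" by simp
  show "classical_reset_indiff {(r, c). r \<le> c} sponge random_oracle ?\<epsilon>"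
    unfolding classical_reset_indiff_def
  proof (intro exI[of _ sponge_simulator] conjI)
    show "classical_simulator {(r, c). r \<le> c} sponge_simulator"
      unfolding classical_simulator_def using classical_sponge_simulator by blast
  qed (use efficient_sponge_simulator classical_bound in \<open>auto simp: min_absorb1\<close>)
  show "quantum_reset_indiff {(r, c). r \<le> c} sponge random_oracle ?\<epsilon>"
    unfolding quantum_reset_indiff_def
    using efficient_sponge_simulator quantum_bound
    by (intro exI[of _ sponge_simulator] conjI) (auto simp: min_absorb1)
qed

end
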